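(* Let $\mathcal{C}$ be a small category and let $R:\mathcal{C}\to \mathrm{Add}$ be a representation of $\mathcal{C}$ (a pseudofunctor to small preadditive categories). If $\mathrm{Ob}\,\mathcal{C}$ is finite and $\mathrm{Ob}\,R(i)$ is finite for all $i\in\mathrm{Ob}\,\mathcal{C}$, then there is an equivalence of categories $$\mathrm{Mod}\text{-}R\;\simeq\;\mathrm{Mod}\text{-}R[\mathcal{C}],$$ where $\mathrm{Mod}\text{-}R$ is the category of right $R$-modules and $\mathrm{Mod}\text{-}R[\mathcal{C}]$ is the category of right modules over the pseudoskew category algebra $R[\mathcal{C}]$.
   Context: **Representation.** $\mathrm{Add}$ denotes the category of small preadditive categories (with additive functors and natural transformations). A representation of a small category $\mathcal{C}$ is a pseudofunctor $R:\mathcal{C}\to\mathrm{Add}$, i.e. the data of: a small preadditive category $R(i)$ for each $i\in \mathrm{Ob}\,\mathcal{C}$; an additive functor $R(a):R(i)\to R(j)$ for each morphism $a:i\to j$; a natural isomorphism $\delta_i:1_{R(i)}\to R(1_i)$ for each object $i$; a natural isomorphism $\mu_{b,a}:R(b)R(a)\to R(ba)$ for each composable pair $a,b$; such that (Rep.1) for composable $i\xrightarrow{a}j\xrightarrow{b}k\xrightarrow{c}h$: $\mu_{c,ba}\circ (R(c)\mu_{b,a})=\mu_{cb,a}\circ(\mu_{c,b}R(a))$; (Rep.2) for $a:i\to j$: $\mu_{a,1_i}\circ (R(a)\delta_i)=\mathrm{id}_{R(a)}=\mu_{1_j,a}\circ(\delta_jR(a))$. Write $\eta_i:=\delta_i^{-1}:R(1_i)\to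 1_{R(i)}$ and $\theta_{b,a}:=\mu_{b,a}^{-1}:R(ba)\to R(b)R(a)$; their components at $x$ are written $\eta_i x$, $\theta_{b,a}x$. **Right $R$-modules.** For a small preadditive category $\mathcal{A}$, a right $\mathcal{A}$-module is an additive functor $\mathcal{A}^{\mathrm{op}}\to\mathrm{Ab}$. For $a:i\to j$ in $\mathcal{C}$, $a^*$ is restriction along $R(a)$, so $(a^*N)(x)=N(R(a)x)$. A right $R$-module $M$ consists of a right $R(i)$-module $M_i:R(i)^{\mathrm{op}}\to\mathrm{Ab}$ for each $i\in\mathrm{Ob}\,\mathcal{C}$, and a natural transformation $M(a):a^*M_j\to M_i$ for each $a:i\to j$ in $\mathcal{C}$, such that (Mod.1) for $a:i\to j$, $b:j\to k$ and every $x\in \mathrm{Ob}\,R(i)$: $M(a)_x\circ M(b)_{R(a)x}=M(ba)_x\circ M_k(\theta_{b,a}x)$ as maps $M_k(R(b)R(a)x)\to M_i(x)$; (Mod.2) for every $i$ and $x\in\mathrm{Ob}\,R(i)$: $M(1_i)_x\circ M_i(\eta_i x)=1_{M_i(x)}$. A morphism $\varphi:M\to N$ of right $R$-modules is a family of natural transformations $\varphi_i:M_i\to N_i$ with $\varphi_i\circ M(a)=N(a)\circ a^*\varphi_j$ for all $a:i\to j$. $\mathrm{Mod}\text{-}R$ is the category of right $R$-modules. **Pseudoskew category algebra.** For a (non-empty) small category $\mathcal{C}$ and a representation $R$ of $\mathcal{C}$, $R[\mathcal{C}]$ is the $\mathbb{Z}$-module spanned by the elements $f_a$, where $a\in\mathcal{C}(i,j)$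 and $f:R(a)x\to y$ is a morphism of $R(j)$ with $x\in\mathrm{Ob}\,R(i)$, $y\in\mathrm{Ob}\,R(j)$ (the data $a,x,y$ being part of the element), addition of elements with the same $(a,x,y)$ being that of the group $R(j)(R(a)x,y)$; that is, as an abelian group $$R[\mathcal{C}]=\bigoplus_{i,j\in\mathrm{Ob}\,\mathcal{C}}\ \bigoplus_{x\in\mathrm{Ob}\,R(i),\,y\in\mathrm{Ob}\,R(j)}\ \bigoplus_{a\in\mathcal{C}(i,j)}R(j)(R(a)x,y).$$ Multiplication is the bilinear extension of: for $f_a$ with $f:R(a)x\to y$, $a:i\to j$, and $g_b$ with $g:R(b)y'\to z$, $$g_b * f_a=\big(g\circ R(b)(f)\circ\theta_{b,a}x\big)_{ba}\quad\text{if } \mathrm{dom}(b)=\mathrm{cod}(a)\text{ and }y'=y,$$ and $g_b*f_a=0$ otherwise; here $R(ba)x\xrightarrow{\theta_{b,a}x}R(b)R(a)x\xrightarrow{R(b)f}R(b)y\xrightarrow{g}z$. This is an associative ring. If $\mathrm{Ob}\,\mathcal{C}$ and all $\mathrm{Ob}\,R(i)$ are finite, it has the identity element $\sum_{i\in\mathrm{Ob}\,\mathcal{C},\,x\in\mathrm{Ob}\,R(i)}(\eta_ix)_{1_i}$, and $\mathrm{Mod}\text{-}R[\mathcal{C}]$ denotes its category of unital right modules. *)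

theory Defs
  imports "HOL-Algebra.Product_Groups" "HOL-Algebra.Ring"
begin

section \<open>Categories, functors and equivalences\<close>

text \<open>
  A small category is given by sets of objects and arrows; every arrow carries its source and
  target. \<open>g \<cdot>\<^bsub>C\<^esub> f\<close> is ``\<open>g\<close> after \<open>f\<close>''.
\<close>

record ('o, 'a) cat =
  obj :: "'o set"
  arr :: "'a set"
  src :: "'a \<Rightarrow> 'o"
  tgt :: "'a \<Rightarrow> 'o"
  idn :: "'o \<Rightarrow> 'a"
  cmp :: "'a \<Rightarrow> 'a \<Rightarrow> 'a"  (infixl \<open>\<cdot>\<index>\<close> 70)

definition homset :: "('o, 'a, 'e) cat_scheme \<Rightarrow> 'o \<Rightarrow> 'o \<Rightarrow> 'a set" where
  "homset C x y = {f \<in> arr C. src C f = x \<and> tgt C f = y}"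

locale category =
  fixes C :: "('o, 'a, 'e) cat_scheme" (structure)
  assumes src_obj: "f \<in> arr C \<Longrightarrow> src C f \<in> obj C"
    and tgt_obj: "f \<in> arr C \<Longrightarrow> tgt C f \<in> obj C"
    and idn_homset: "x \<in> obj C \<Longrightarrow> idn C x \<in> homset C x x"
    and cmp_homset: "\<lbrakk>f \<in> homset C x y; g \<in> homset C y z\<rbrakk> \<Longrightarrow> g \<cdot> f \<in> homset C x z"
    and cmp_idn: "f \<in> homset C x y \<Longrightarrow> f \<cdot> idn C x = f"
    and idn_cmp: "f \<in> homset C x y \<Longrightarrow> idn C y \<cdot> f = f"
    and cmp_assoc: "\<lbrakk>f \<in> homset C w x; g \<in> homset C x y; h \<in> homset C y z\<rbrakk>
      \<Longrightarrow> h \<cdot> (g \<cdot> f) = (h \<cdot> g) \<cdot> f"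

definition is_inverse :: "('o, 'a, 'e) cat_scheme \<Rightarrow> 'a \<Rightarrow> 'a \<Rightarrow> bool" where
  "is_inverse C f g \<longleftrightarrow> g \<in> homset C (tgt C f) (src C f) \<and>
     g \<cdot>\<^bsub>C\<^esub> f = idn C (src C f) \<and> f \<cdot>\<^bsub>C\<^esub> g = idn C (tgt C f)"

definition is_iso :: "('o, 'a, 'e) cat_scheme \<Rightarrow> 'a \<Rightarrow> bool" where
  "is_iso C f \<longleftrightarrow> f \<in> arr C \<and> (\<exists>g. is_inverse C f g)"

definition inv_arr :: "('o, 'a, 'e) cat_scheme \<Rightarrow> 'a \<Rightarrow> 'a" where
  "inv_arr C f = (THE g. is_inverse C f g)"

record ('o, 'a, 'p, 'b) fctr =
  fobj :: "'o \<Rightarrow> 'p"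
  farr :: "'a \<Rightarrow> 'b"

definition id_fctr :: "('o, 'a, 'o, 'a) fctr" where
  "id_fctr = \<lparr>fobj = (\<lambda>x. x), farr = (\<lambda>f. f)\<rparr>"

definition comp_fctr ::
    "('p, 'b, 'q, 'c) fctr \<Rightarrow> ('o, 'a, 'p, 'b) fctr \<Rightarrow> ('o, 'a, 'q, 'c) fctr" (infixl \<open>\<circ>\<^sub>F\<close> 55) where
  "G \<circ>\<^sub>F F = \<lparr>fobj = (\<lambda>x. fobj G (fobj F x)), farr = (\<lambda>f. farr G (farr F f))\<rparr>"

locale cat_functor = A: category A + B: category B
  for A :: "('o, 'a, 'e) cat_scheme" and B :: "('p, 'b, 'h) cat_scheme" +
  fixes F :: "('o, 'a, 'p, 'b) fctr"
  assumes fobj_obj: "x \<in> obj A \<Longrightarrow> fobj F x \<in> obj B"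
    and farr_homset: "f \<in> homset A x y \<Longrightarrow> farr F f \<in> homset B (fobj F x) (fobj F y)"
    and farr_idn: "x \<in> obj A \<Longrightarrow> farr F (idn A x) = idn B (fobj F x)"
    and farr_cmp: "\<lbrakk>f \<in> homset A x y; g \<in> homset A y z\<rbrakk>
      \<Longrightarrow> farr F (g \<cdot>\<^bsub>A\<^esub> f) = farr F g \<cdot>\<^bsub>B\<^esub> farr F f"

locale nat_transf = F: cat_functor A B F + G: cat_functor A B G
  for A :: "('o, 'a, 'e) cat_scheme" and B :: "('p, 'b, 'h) cat_scheme" and F G +
  fixes t :: "'o \<Rightarrow> 'b"
  assumes component: "x \<in> obj A \<Longrightarrow> t x \<in> homset B (fobj F x) (fobj G x)"
    and natural: "f \<in> homset A x y \<Longrightarrow> t y \<cdot>\<^bsub>B\<^esub> farr F f = farr G f \<cdot>\<^bsub>B\<^esub> t x"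

locale nat_isom = nat_transf +
  assumes component_iso: "x \<in> obj A \<Longrightarrow> is_iso B (t x)"

definition equivalent_categories ::
    "('o, 'a, 'e) cat_scheme \<Rightarrow> ('p, 'b, 'h) cat_scheme \<Rightarrow> bool" where
  "equivalent_categories A B \<longleftrightarrow> category A \<and> category B \<and>
     (\<exists>F G s t. cat_functor A B F \<and> cat_functor B A G \<and>
        nat_isom A A id_fctr (G \<circ>\<^sub>F F) s \<and> nat_isom B B (F \<circ>\<^sub>F G) id_fctr t)"


section \<open>Preadditive categories\<close>

record ('o, 'a) precat = "('o, 'a) cat" +
  padd :: "'a \<Rightarrow> 'a \<Rightarrow> 'a"
  pzero :: "'o \<Rightarrow> 'o \<Rightarrow> 'a"

text \<open>
  Abelian groups are \<^const>\<open>comm_group\<close>s: the group operation is written \<open>\<otimes>\<close> and the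
  neutral element \<open>\<one>\<close>, also where they stand for \<open>+\<close> and \<open>0\<close>.
\<close>

definition hom_group :: "('o, 'a, 'e) precat_scheme \<Rightarrow> 'o \<Rightarrow> 'o \<Rightarrow> 'a monoid" where
  "hom_group A x y = \<lparr>carrier = homset A x y, mult = padd A, one = pzero A x y\<rparr>"

locale preadditive = category A for A :: "('o, 'a, 'e) precat_scheme" (structure) +
  assumes hom_comm_group: "\<lbrakk>x \<in> obj A; y \<in> obj A\<rbrakk> \<Longrightarrow> comm_group (hom_group A x y)"
    and cmp_padd_right: "\<lbrakk>f \<in> homset A x y; f' \<in> homset A x y; g \<in> homset A y z\<rbrakk>
      \<Longrightarrow> g \<cdot> padd A f f' = padd A (g \<cdot> f) (g \<cdot> f')"
    and cmp_padd_left: "\<lbrakk>f \<in> homset A x y; g \<in> homset A y z; g' \<in> homset A y z\<rbrakk>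
      \<Longrightarrow> padd A g g' \<cdot> f = padd A (g \<cdot> f) (g' \<cdot> f)"

locale additive_functor = A: preadditive A + B: preadditive B + cat_functor A B F
  for A :: "('o, 'a, 'e) precat_scheme" and B :: "('p, 'b, 'h) precat_scheme"
    and F :: "('o, 'a, 'p, 'b) fctr" +
  assumes farr_padd: "\<lbrakk>f \<in> homset A x y; f' \<in> homset A x y\<rbrakk>
    \<Longrightarrow> farr F (padd A f f') = padd B (farr F f) (farr F f')"

definition opp :: "('o, 'a) precat \<Rightarrow> ('o, 'a) precat" where
  "opp A = \<lparr>obj = obj A, arr = arr A, src = tgt A, tgt = src A, idn = idn A,
     cmp = (\<lambda>g f. f \<cdot>\<^bsub>A\<^esub> g), padd = padd A, pzero = (\<lambda>x y. pzero A y x)\<rparr>"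

text \<open>
  Arrows between structures are triples of source, target and underlying map. The underlying maps
  are \<^const>\<open>extensional\<close>, so that arrows are equal iff they agree as maps on the carriers.
\<close>

datatype ('o, 'm) arrow = Arrow (asrc: 'o) (atgt: 'o) (amap: 'm)

type_synonym 'u ab_arrow = "('u monoid, 'u \<Rightarrow> 'u) arrow"

text \<open>
  The category of abelian groups whose underlying set is a subset of the type \<open>'u\<close>. The type plays
  the role of a universe of sets; it is closed under finite direct sums, up to isomorphism, if
  it is infinite.
\<close>

definition Ab :: "('u monoid, 'u ab_arrow) precat" where
  "Ab = \<lparr>obj = {G. comm_group G},
     arr = {Arrow G H h | G H h. comm_group G \<and> comm_group H \<and> h \<in> hom G H \<and>
              h \<in> extensional (carrier G)},
     src = asrc, tgt = atgt,
     idn = (\<lambda>G. Arrow G G (\<lambda>m\<in>carrier G. m)),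
     cmp = (\<lambda>g f. Arrow (asrc f) (atgt g) (compose (carrier (asrc f)) (amap g) (amap f))),
     padd = (\<lambda>f f'. Arrow (asrc f) (atgt f)
              (\<lambda>m\<in>carrier (asrc f). amap f m \<otimes>\<^bsub>atgt f\<^esub> amap f' m)),
     pzero = (\<lambda>G H. Arrow G H (\<lambda>m\<in>carrier G. \<one>\<^bsub>H\<^esub>))\<rparr>"


section \<open>Representations and their right modules\<close>

text \<open>
  In a representation of a category with objects in \<open>'i\<close> and arrows in \<open>'c\<close>,
  \<open>rcat R i\<close> and \<open>rfun R a\<close> are \<open>R(i)\<close> and \<open>R(a)\<close>; \<open>delta R i x\<close> and \<open>mu R b a x\<close> are the
  components at \<open>x\<close> of \<open>\<delta>\<^sub>i\<close> and \<open>\<mu>\<^sub>b\<^sub>,\<^sub>a\<close>.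
\<close>

record ('i, 'c, 'x, 'f) rep =
  rcat :: "'i \<Rightarrow> ('x, 'f) precat"
  rfun :: "'c \<Rightarrow> ('x, 'f, 'x, 'f) fctr"
  delta :: "'i \<Rightarrow> 'x \<Rightarrow> 'f"
  mu :: "'c \<Rightarrow> 'c \<Rightarrow> 'x \<Rightarrow> 'f"

locale representation = category C for C :: "('i, 'c) cat" (structure) +
  fixes R :: "('i, 'c, 'x, 'f) rep"
  assumes rcat_preadditive: "i \<in> obj C \<Longrightarrow> preadditive (rcat R i)"
    and rfun_additive: "a \<in> homset C i j \<Longrightarrow> additive_functor (rcat R i) (rcat R j) (rfun R a)"
    and delta_isom: "i \<in> obj C \<Longrightarrow>
      nat_isom (rcat R i) (rcat R i) id_fctr (rfun R (idn C i)) (delta R i)"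
    and mu_isom: "\<lbrakk>a \<in> homset C i j; b \<in> homset C j k\<rbrakk> \<Longrightarrow>
      nat_isom (rcat R i) (rcat R k) (rfun R b \<circ>\<^sub>F rfun R a) (rfun R (b \<cdot> a)) (mu R b a)"
    and mu_assoc: "\<lbrakk>a \<in> homset C i j; b \<in> homset C j k; c \<in> homset C k h; x \<in> obj (rcat R i)\<rbrakk> \<Longrightarrow>
      mu R c (b \<cdot> a) x \<cdot>\<^bsub>rcat R h\<^esub> farr (rfun R c) (mu R b a x) =
      mu R (c \<cdot> b) a x \<cdot>\<^bsub>rcat R h\<^esub> mu R c b (fobj (rfun R a) x)"
    and mu_delta_right: "\<lbrakk>a \<in> homset C i j; x \<in> obj (rcat R i)\<rbrakk> \<Longrightarrow>
      mu R a (idn C i) x \<cdot>\<^bsub>rcat R j\<^esub> farr (rfun R a) (delta R i x) =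
      idn (rcat R j) (fobj (rfun R a) x)"
    and mu_delta_left: "\<lbrakk>a \<in> homset C i j; x \<in> obj (rcat R i)\<rbrakk> \<Longrightarrow>
      mu R (idn C j) a x \<cdot>\<^bsub>rcat R j\<^esub> delta R j (fobj (rfun R a) x) =
      idn (rcat R j) (fobj (rfun R a) x)"

definition eta :: "('i, 'c, 'x, 'f) rep \<Rightarrow> 'i \<Rightarrow> 'x \<Rightarrow> 'f" where
  "eta R i x = inv_arr (rcat R i) (delta R i x)"

definition theta :: "('i, 'c) cat \<Rightarrow> ('i, 'c, 'x, 'f) rep \<Rightarrow> 'c \<Rightarrow> 'c \<Rightarrow> 'x \<Rightarrow> 'f" where
  "theta C R b a x = inv_arr (rcat R (tgt C b)) (mu R b a x)"

text \<open>
  \<open>mfun M i\<close> is the module \<open>M\<^sub>i\<close>, and \<open>mtr M a x\<close> is the component at \<open>x\<close> of \<open>M(a)\<close>. The functor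
  \<open>mfun M j \<circ>\<^sub>F rfun R a\<close> below is \<open>a\<^sup>*M\<^sub>j\<close>, as a functor and its opposite have the same
  underlying maps.
\<close>

record ('i, 'c, 'x, 'f, 'u) rep_mod =
  mfun :: "'i \<Rightarrow> ('x, 'f, 'u monoid, 'u ab_arrow) fctr"
  mtr :: "'c \<Rightarrow> 'x \<Rightarrow> 'u ab_arrow"

locale right_rep_module = representation C R
  for C :: "('i, 'c) cat" (structure) and R :: "('i, 'c, 'x, 'f) rep" +
  fixes M :: "('i, 'c, 'x, 'f, 'u) rep_mod"
  assumes mfun_additive: "i \<in> obj C \<Longrightarrow> additive_functor (opp (rcat R i)) Ab (mfun M i)"
    and mtr_nat_transf: "a \<in> homset C i j \<Longrightarrow>
      nat_transf (opp (rcat R i)) Ab (mfun M j \<circ>\<^sub>F rfun R a) (mfun M i) (mtr M a)"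
    and mtr_cmp: "\<lbrakk>a \<in> homset C i j; b \<in> homset C j k; x \<in> obj (rcat R i)\<rbrakk> \<Longrightarrow>
      mtr M a x \<cdot>\<^bsub>Ab\<^esub> mtr M b (fobj (rfun R a) x) =
      mtr M (b \<cdot> a) x \<cdot>\<^bsub>Ab\<^esub> farr (mfun M k) (theta C R b a x)"
    and mtr_idn: "\<lbrakk>i \<in> obj C; x \<in> obj (rcat R i)\<rbrakk> \<Longrightarrow>
      mtr M (idn C i) x \<cdot>\<^bsub>Ab\<^esub> farr (mfun M i) (eta R i x) = idn Ab (fobj (mfun M i) x)"

definition rep_mod_hom :: "('i, 'c) cat \<Rightarrow> ('i, 'c, 'x, 'f) rep \<Rightarrow>
    ('i, 'c, 'x, 'f, 'u) rep_mod \<Rightarrow> ('i, 'c, 'x, 'f, 'u) rep_mod \<Rightarrow>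
    ('i \<Rightarrow> 'x \<Rightarrow> 'u ab_arrow) \<Rightarrow> bool" where
  "rep_mod_hom C R M N \<phi> \<longleftrightarrow>
     (\<forall>i\<in>obj C. nat_transf (opp (rcat R i)) Ab (mfun M i) (mfun N i) (\<phi> i)) \<and>
     (\<forall>i j. \<forall>a\<in>homset C i j. \<forall>x\<in>obj (rcat R i).
        \<phi> i x \<cdot>\<^bsub>Ab\<^esub> mtr M a x = mtr N a x \<cdot>\<^bsub>Ab\<^esub> \<phi> j (fobj (rfun R a) x))"

type_synonym ('i, 'c, 'x, 'f, 'u) rep_mod_arrow =
  "(('i, 'c, 'x, 'f, 'u) rep_mod, 'i \<Rightarrow> 'x \<Rightarrow> 'u ab_arrow) arrow"

text \<open>
  The values of \<open>mfun M\<close> and \<open>mtr M\<close> outside their domains are left unconstrained (as are those of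
  the multiplication of an abelian group outside its carrier). This only produces additional
  copies of an object, and copies are isomorphic via the identity maps.
\<close>

definition Mod_rep :: "('i, 'c) cat \<Rightarrow> ('i, 'c, 'x, 'f) rep \<Rightarrow>
    (('i, 'c, 'x, 'f, 'u) rep_mod, ('i, 'c, 'x, 'f, 'u) rep_mod_arrow) cat" where
  "Mod_rep C R = \<lparr>obj = {M. right_rep_module C R M},
     arr = {Arrow M N \<phi> | M N \<phi>. right_rep_module C R M \<and> right_rep_module C R N \<and>
              rep_mod_hom C R M N \<phi> \<and> \<phi> \<in> extensional (obj C) \<and>
              (\<forall>i\<in>obj C. \<phi> i \<in> extensional (obj (rcat R i)))},
     src = asrc, tgt = atgt,
     idn = (\<lambda>M. Arrow M M (\<lambda>i\<in>obj C. \<lambda>x\<in>obj (rcat R i). idn Ab (fobj (mfun M i) x))),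
     cmp = (\<lambda>g f. Arrow (asrc f) (atgt g)
              (\<lambda>i\<in>obj C. \<lambda>x\<in>obj (rcat R i). amap g i x \<cdot>\<^bsub>Ab\<^esub> amap f i x))\<rparr>"


section \<open>Right modules over a ring\<close>

record ('s, 'u) rmod = "'u monoid" +
  act :: "'u \<Rightarrow> 's \<Rightarrow> 'u"  (infixl \<open>\<star>\<index>\<close> 70)

locale right_module = S: ring S + M: comm_group M
  for S :: "('s, 'e) ring_scheme" and M :: "('s, 'u) rmod" +
  assumes act_closed: "\<lbrakk>m \<in> carrier M; s \<in> carrier S\<rbrakk> \<Longrightarrow> m \<star>\<^bsub>M\<^esub> s \<in> carrier M"
    and act_add_left: "\<lbrakk>m \<in> carrier M; n \<in> carrier M; s \<in> carrier S\<rbrakk>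
      \<Longrightarrow> (m \<otimes>\<^bsub>M\<^esub> n) \<star>\<^bsub>M\<^esub> s = (m \<star>\<^bsub>M\<^esub> s) \<otimes>\<^bsub>M\<^esub> (n \<star>\<^bsub>M\<^esub> s)"
    and act_add_right: "\<lbrakk>m \<in> carrier M; s \<in> carrier S; t \<in> carrier S\<rbrakk>
      \<Longrightarrow> m \<star>\<^bsub>M\<^esub> (s \<oplus>\<^bsub>S\<^esub> t) = (m \<star>\<^bsub>M\<^esub> s) \<otimes>\<^bsub>M\<^esub> (m \<star>\<^bsub>M\<^esub> t)"
    and act_mult: "\<lbrakk>m \<in> carrier M; s \<in> carrier S; t \<in> carrier S\<rbrakk>
      \<Longrightarrow> m \<star>\<^bsub>M\<^esub> (s \<otimes>\<^bsub>S\<^esub> t) = (m \<star>\<^bsub>M\<^esub> s) \<star>\<^bsub>M\<^esub> t"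
    and act_one: "m \<in> carrier M \<Longrightarrow> m \<star>\<^bsub>M\<^esub> \<one>\<^bsub>S\<^esub> = m"

type_synonym ('s, 'u) rmod_arrow = "(('s, 'u) rmod, 'u \<Rightarrow> 'u) arrow"

definition Mod_ring :: "('s, 'e) ring_scheme \<Rightarrow> (('s, 'u) rmod, ('s, 'u) rmod_arrow) cat" where
  "Mod_ring S = \<lparr>obj = {M. right_module S M},
     arr = {Arrow M N h | M N h. right_module S M \<and> right_module S N \<and> h \<in> hom M N \<and>
              (\<forall>m\<in>carrier M. \<forall>s\<in>carrier S. h (m \<star>\<^bsub>M\<^esub> s) = h m \<star>\<^bsub>N\<^esub> s) \<and>
              h \<in> extensional (carrier M)},
     src = asrc, tgt = atgt,
     idn = (\<lambda>M. Arrow M M (\<lambda>m\<in>carrier M. m)),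
     cmp = (\<lambda>g f. Arrow (asrc f) (atgt g) (compose (carrier (asrc f)) (amap g) (amap f)))\<rparr>"


section \<open>The pseudoskew category algebra\<close>

text \<open>
  The additive group of \<open>R[C]\<close> is the direct sum of the groups \<open>R(j)(R(a)x, y)\<close>, indexed by the
  triples \<open>(a, x, y)\<close> with \<open>a : i \<rightarrow> j\<close>, \<open>x\<close> in \<open>R(i)\<close> and \<open>y\<close> in \<open>R(j)\<close>; \<open>skew_elem C R (a, x, y) f\<close> is
  the element \<open>f\<^sub>a\<close>.
\<close>

definition skew_index :: "('i, 'c) cat \<Rightarrow> ('i, 'c, 'x, 'f) rep \<Rightarrow> ('c \<times> 'x \<times> 'x) set" where
  "skew_index C R =
     {(a, x, y). a \<in> arr C \<and> x \<in> obj (rcat R (src C a)) \<and> y \<in> obj (rcat R (tgt C a))}"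

definition skew_hom ::
    "('i, 'c) cat \<Rightarrow> ('i, 'c, 'x, 'f) rep \<Rightarrow> 'c \<times> 'x \<times> 'x \<Rightarrow> 'f monoid" where
  "skew_hom C R = (\<lambda>(a, x, y). hom_group (rcat R (tgt C a)) (fobj (rfun R a) x) y)"

definition skew_group ::
    "('i, 'c) cat \<Rightarrow> ('i, 'c, 'x, 'f) rep \<Rightarrow> ('c \<times> 'x \<times> 'x \<Rightarrow> 'f) monoid" where
  "skew_group C R = sum_group (skew_index C R) (skew_hom C R)"

definition skew_elem ::
    "('i, 'c) cat \<Rightarrow> ('i, 'c, 'x, 'f) rep \<Rightarrow> 'c \<times> 'x \<times> 'x \<Rightarrow> 'f \<Rightarrow> ('c \<times> 'x \<times> 'x \<Rightarrow> 'f)" where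
  "skew_elem C R p f = (\<lambda>q\<in>skew_index C R. if q = p then f else \<one>\<^bsub>skew_hom C R q\<^esub>)"

definition skew_elem_mult :: "('i, 'c) cat \<Rightarrow> ('i, 'c, 'x, 'f) rep \<Rightarrow>
    'c \<times> 'x \<times> 'x \<Rightarrow> 'f \<Rightarrow> 'c \<times> 'x \<times> 'x \<Rightarrow> 'f \<Rightarrow> ('c \<times> 'x \<times> 'x \<Rightarrow> 'f)" where
  "skew_elem_mult C R = (\<lambda>(b, y', z) g (a, x, y) f.
     if src C b = tgt C a \<and> y' = y
     then skew_elem C R (b \<cdot>\<^bsub>C\<^esub> a, x, z)
       (g \<cdot>\<^bsub>rcat R (tgt C b)\<^esub> farr (rfun R b) f \<cdot>\<^bsub>rcat R (tgt C b)\<^esub> theta C R b a x)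
     else \<one>\<^bsub>skew_group C R\<^esub>)"

definition skew_supp ::
    "('i, 'c) cat \<Rightarrow> ('i, 'c, 'x, 'f) rep \<Rightarrow> ('c \<times> 'x \<times> 'x \<Rightarrow> 'f) \<Rightarrow> ('c \<times> 'x \<times> 'x) set" where
  "skew_supp C R u = {p \<in> skew_index C R. u p \<noteq> \<one>\<^bsub>skew_hom C R p\<^esub>}"

text \<open>
  Each \<^const>\<open>finprod\<close> is a finite sum in the additive group. The sum defining the product is the
  bilinear extension of \<^const>\<open>skew_elem_mult\<close>; the one defining the unit is a finite sum
  only if there are finitely many pairs \<open>(i, x)\<close>.
\<close>

definition skew_algebra ::
    "('i, 'c) cat \<Rightarrow> ('i, 'c, 'x, 'f) rep \<Rightarrow> ('c \<times> 'x \<times> 'x \<Rightarrow> 'f) ring" where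
  "skew_algebra C R = \<lparr>carrier = carrier (skew_group C R),
     mult = (\<lambda>v u. finprod (skew_group C R) (\<lambda>(q, p). skew_elem_mult C R q (v q) p (u p))
               (skew_supp C R v \<times> skew_supp C R u)),
     one = finprod (skew_group C R) (\<lambda>(i, x). skew_elem C R (idn C i, x, x) (eta R i x))
             (SIGMA i:obj C. obj (rcat R i)),
     zero = \<one>\<^bsub>skew_group C R\<^esub>,
     add = mult (skew_group C R)\<rparr>"

end

theory Submission
  imports Defs "HOL-Algebra.Free_Abelian_Groups"
begin

text \<open>
  The generators \<open>f\<^sub>a\<close> of \<open>R[C]\<close>, with \<open>f : R(a)x \<rightarrow> y\<close> and \<open>a : i \<rightarrow> j\<close>, are arrows
  \<open>(i, x) \<rightarrow> (j, y)\<close> of a preadditive category, the Grothendieck construction of \<open>R\<close>. A right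
  \<open>R\<close>-module \<open>M\<close> is the same as an additive functor on the opposite of this category: \<open>f\<^sub>a\<close> acts as
  \<open>M(a)\<^sub>x \<circ> M\<^sub>j(f)\<close>, and conversely \<open>M\<^sub>i(f)\<close> and \<open>M(a)\<^sub>x\<close> are the actions of \<open>f \<circ> \<eta>\<^sub>i x\<close>, in degree
  \<open>1\<^sub>i\<close>, and of \<open>1 : R(a)x \<rightarrow> R(a)x\<close>, in degree \<open>a\<close>. Since there are finitely many objects, these
  functors are in turn the right modules over \<open>R[C]\<close>: the direct sum of the values of a functor is
  a module, and every module is the direct sum of the images of the idempotents \<open>\<eta>\<^sub>i x\<close>. The
  direct sum consists of finite tuples over \<open>'u\<close>; it is moved back into \<open>'u\<close> along an injection,
  which exists because \<open>'u\<close> is infinite. Taking direct sums is shown to be fully faithful and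
  essentially surjective.
\<close>

section \<open>Fully faithful and essentially surjective functors\<close>

text \<open>A morphism \<open>f : x \<rightarrow> y\<close> of \<open>R(i)\<close> is not itself a
  generator of degree \<open>1\<^sub>i\<close>, since \<open>R(1\<^sub>i)\<close> is only isomorphic
  to the identity; composing with \<open>\<eta>\<^sub>i x\<close> corrects its source. Likewise,
  \<open>1\<close> in degree \<open>b\<close> times \<open>1\<close> in degree \<open>a\<close> is
  not \<open>1\<close> but \<open>\<theta>\<^sub>b\<^sub>,\<^sub>a x\<close> in degree
  \<open>ba\<close>, and this is what (Mod.1) accounts for. Every generator \<open>f\<^sub>a\<close>
  is the product of \<open>f \<circ> \<eta>\<close> in degree \<open>1\<^sub>j\<close> and
  \<open>1\<close> in degree \<open>a\<close>. As the action reverses composition, this explains the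
  formula \<open>M(a)\<^sub>x \<circ> M\<^sub>j(f)\<close>, and it shows that generators of these
  two special kinds determine an action. The coherence laws of \<open>R\<close> enter only through
  the laws of composition in the Grothendieck construction. The ring theory is done for an arbitrary
  graded category, where all identities are additive in each argument and need checking on
  generators only. The images of the idempotents give back the summands of a direct sum only up to
  isomorphism. Naturality of such isomorphisms is settled once, in the criterion that a fully
  faithful and essentially surjective functor is an equivalence.\<close>

lemma homsetD:
  assumes "f \<in> homset C x y"
  shows "f \<in> arr C" "src C f = x" "tgt C f = y"
  using assms by (simp_all add: homset_def)

context category
begin

lemma homset_obj:
  assumes "f \<in> homset C x y"
  shows "x \<in> obj C" "y \<in> obj C"
  using homsetD[OF assms] src_obj[of f] tgt_obj[of f] by simp_all

lemma is_inverse_unique: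
  assumes f: "f \<in> arr C" and g: "is_inverse C f g" and h: "is_inverse C f h"
  shows "g = h"
proof -
  have f': "f \<in> homset C (src C f) (tgt C f)"
    using f by (simp add: homset_def)
  have g': "g \<in> homset C (tgt C f) (src C f)" "g \<cdot> f = idn C (src C f)"
    and h': "h \<in> homset C (tgt C f) (src C f)" "f \<cdot> h = idn C (tgt C f)"
    using g h unfolding is_inverse_def by blast+
  have "g = g \<cdot> (f \<cdot> h)"
    by (simp only: h'(2) cmp_idn[OF g'(1)])
  also have "\<dots> = (g \<cdot> f) \<cdot> h"
    by (rule cmp_assoc[OF h'(1) f' g'(1)])
  also have "\<dots> = h"
    by (simp only: g'(2) idn_cmp[OF h'(1)])
  finally show ?thesis .
qed

lemma inv_arr:
  assumes f: "f \<in> homset C x y" and iso: "is_iso C f"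
  shows "inv_arr C f \<in> homset C y x" "inv_arr C f \<cdot> f = idn C x" "f \<cdot> inv_arr C f = idn C y"
proof -
  obtain g where g: "is_inverse C f g" and f': "f \<in> arr C"
    using iso unfolding is_iso_def by blast
  have "is_inverse C f (inv_arr C f)"
    unfolding inv_arr_def by (rule theI[of "is_inverse C f", OF g])
        (rule is_inverse_unique[OF f' _ g])
  then show "inv_arr C f \<in> homset C y x" "inv_arr C f \<cdot> f = idn C x" "f \<cdot> inv_arr C f = idn C y"
    unfolding is_inverse_def homsetD[OF f] by blast+
qed

lemma is_isoI:
  assumes "f \<in> homset C x y" "g \<in> homset C y x" "g \<cdot> f = idn C x" "f \<cdot> g = idn C y"
  shows "is_iso C f"
  unfolding is_iso_def is_inverse_def homsetD[OF assms(1)] using assms homsetD(1)[OF assms(1)] by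
      blast

text \<open>Arrows into \<open>F (G y)\<close> are compared after composition with the chosen
  isomorphism to \<open>y\<close>, where they can be computed; only a left inverse is needed for
  this.\<close>

lemma cmp_left_cancel:
  assumes e: "e \<in> homset C y z" "e' \<in> homset C z y" "e' \<cdot> e = idn C y"
    and f: "f \<in> homset C x y" and g: "g \<in> homset C x y" and eq: "e \<cdot> f = e \<cdot> g"
  shows "f = g"
proof -
  have "f = (e' \<cdot> e) \<cdot> f"
    by (simp only: e(3) idn_cmp[OF f])
  also have "\<dots> = e' \<cdot> (e \<cdot> f)"
    by (rule cmp_assoc[OF f e(1,2), symmetric])
  also have "\<dots> = (e' \<cdot> e) \<cdot> g"
    unfolding eq by (rule cmp_assoc[OF g e(1,2)])
  also have "\<dots> = g"
    by (simp only: e(3) idn_cmp[OF g])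
  finally show ?thesis .
qed

end

lemma (in category) cat_functor_id: "cat_functor C C id_fctr"
  by unfold_locales (auto simp: id_fctr_def)

lemma cat_functor_comp:
  assumes "cat_functor A B F" and "cat_functor B C G"
  shows "cat_functor A C (G \<circ>\<^sub>F F)"
proof -
  interpret F: cat_functor A B F by fact
  interpret G: cat_functor B C G by fact
  show ?thesis
  proof
    fix f g x y z assume f: "f \<in> homset A x y" and g: "g \<in> homset A y z"
    show "farr (G \<circ>\<^sub>F F) (g \<cdot>\<^bsub>A\<^esub> f) = farr (G \<circ>\<^sub>F F) g \<cdot>\<^bsub>C\<^esub> farr (G \<circ>\<^sub>F F) f"
      using F.farr_cmp[OF f g] G.farr_cmp[OF F.farr_homset[OF f] F.farr_homset[OF g]]
      by (simp add: comp_fctr_def)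
  qed (simp_all add: comp_fctr_def F.fobj_obj G.fobj_obj F.farr_homset G.farr_homset
      F.farr_idn G.farr_idn)
qed

text \<open>Choice picks for every \<open>y\<close> an object \<open>G y\<close> and an isomorphism
  \<open>e y\<close> from \<open>F (G y)\<close> to \<open>y\<close>. Fullness lifts the conjugate
  of an arrow by these isomorphisms, and faithfulness reduces every identity between lifts to one
  that holds after applying \<open>F\<close>.\<close>

lemma equivalent_categories_if_fully_faithful:
  assumes "cat_functor A B F"
    and full: "\<And>x y g. \<lbrakk>x \<in> obj A; y \<in> obj A; g \<in> homset B (fobj F x) (fobj F y)\<rbrakk>
      \<Longrightarrow> \<exists>f\<in>homset A x y. farr F f = g"
    and faithful: "\<And>x y f f'. \<lbrakk>f \<in> homset A x y; f' \<in> homset A x y; farr F f = farr F f'\<rbrakk>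
      \<Longrightarrow> f = f'"
    and ess_surj: "\<And>y. y \<in> obj B \<Longrightarrow> \<exists>x\<in>obj A. \<exists>f\<in>homset B (fobj F x) y. is_iso B f"
  shows "equivalent_categories A B"
proof -
  interpret A: category A using assms(1) by (rule cat_functor.axioms)
  interpret B: category B using assms(1) by (rule cat_functor.axioms)
  interpret F: cat_functor A B F by fact
  \<comment> \<open>The side condition stands under the existential quantifiers, so that
    skolemization yields total functions \<open>G\<close> and \<open>e\<close>.\<close>
  have "\<forall>y. \<exists>x e. y \<in> obj B \<longrightarrow> x \<in> obj A \<and> e \<in> homset B (fobj F x) y \<and> is_iso B e"
    using ess_surj by meson
  then obtain G e where G: "y \<in> obj B \<Longrightarrow> G y \<in> obj A"
    and e: "y \<in> obj B \<Longrightarrow> e y \<in> homset B (fobj F (G y)) y"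
    and iso: "y \<in> obj B \<Longrightarrow> is_iso B (e y)" for y
    by metis
  define e' where "e' y = inv_arr B (e y)" for y
  have e': "e' y \<in> homset B y (fobj F (G y))" "e' y \<cdot>\<^bsub>B\<^esub> e y = idn B (fobj F (G y))"
    "e y \<cdot>\<^bsub>B\<^esub> e' y = idn B y" if "y \<in> obj B" for y
    using B.inv_arr[OF e[OF that] iso[OF that]] by (simp_all add: e'_def)
  have "\<forall>x y g. \<exists>f. x \<in> obj A \<longrightarrow> y \<in> obj A \<longrightarrow> g \<in> homset B (fobj F x) (fobj F y) \<longrightarrow>
      f \<in> homset A x y \<and> farr F f = g"
    using full by meson
  then obtain L where L: "\<lbrakk>x \<in> obj A; y \<in> obj A; g \<in> homset B (fobj F x) (fobj F y)\<rbrakk>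
      \<Longrightarrow> L x y g \<in> homset A x y \<and> farr F (L x y g) = g" for x y g
    by metis
  \<comment> \<open>The lift of \<open>f\<close> conjugated by \<open>e\<close>. With this choice
    \<open>e\<close> is natural by construction, which is \<open>e_Ga\<close>.\<close>
  define Ga where "Ga f = L (G (src B f)) (G (tgt B f))
      (e' (tgt B f) \<cdot>\<^bsub>B\<^esub> (f \<cdot>\<^bsub>B\<^esub> e (src B f)))" for f
  define GF where "GF = \<lparr>fobj = G, farr = Ga\<rparr>"
  have Ga: "Ga f \<in> homset A (G x) (G y) \<and> farr F (Ga f) = e' y \<cdot>\<^bsub>B\<^esub> (f \<cdot>\<^bsub>B\<^esub> e x)"
    if f: "f \<in> homset B x y" for f x y
  proof -
    have x: "x \<in> obj B" and y: "y \<in> obj B"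
      using B.homset_obj[OF f] by auto
    have "e' y \<cdot>\<^bsub>B\<^esub> (f \<cdot>\<^bsub>B\<^esub> e x) \<in> homset B (fobj F (G x)) (fobj F (G y))"
      by (rule B.cmp_homset[OF B.cmp_homset[OF e[OF x] f] e'(1)[OF y]])
    from L[OF G[OF x] G[OF y] this] show ?thesis
      using homsetD[OF f] by (simp add: Ga_def)
  qed
  have e_Ga: "e y \<cdot>\<^bsub>B\<^esub> farr F (Ga f) = f \<cdot>\<^bsub>B\<^esub> e x" if f: "f \<in> homset B x y" for f x y
  proof -
    have x: "x \<in> obj B" and y: "y \<in> obj B"
      using B.homset_obj[OF f] by auto
    have fe: "f \<cdot>\<^bsub>B\<^esub> e x \<in> homset B (fobj F (G x)) y"
      by (rule B.cmp_homset[OF e[OF x] f])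
    show ?thesis
      using Ga[OF f] B.cmp_assoc[OF fe e'(1)[OF y] e[OF y]] e'(3)[OF y] B.idn_cmp[OF fe] by simp
  qed
  have GF: "cat_functor B A GF"
  proof
    fix y assume y: "y \<in> obj B"
    show "fobj GF y \<in> obj A"
      using G[OF y] by (simp add: GF_def)
    have id: "idn B y \<in> homset B y y" by (rule B.idn_homset[OF y])
    have "Ga (idn B y) = idn A (G y)"
    proof (rule faithful)
      show "Ga (idn B y) \<in> homset A (G y) (G y)" "idn A (G y) \<in> homset A (G y) (G y)"
        using Ga[OF id] A.idn_homset[OF G[OF y]] by auto
      show "farr F (Ga (idn B y)) = farr F (idn A (G y))"
        using Ga[OF id] B.idn_cmp[OF e[OF y]] e'(2)[OF y] F.farr_idn[OF G[OF y]] by simp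
    qed
    then show "farr GF (idn B y) = idn A (fobj GF y)"
      by (simp add: GF_def)
  next
    fix f x y assume "f \<in> homset B x y"
    then show "farr GF f \<in> homset A (fobj GF x) (fobj GF y)"
      using Ga by (simp add: GF_def)
  next
    fix f g x y z assume f: "f \<in> homset B x y" and g: "g \<in> homset B y z"
    have x: "x \<in> obj B" and y: "y \<in> obj B" and z: "z \<in> obj B"
      using B.homset_obj[OF f] B.homset_obj[OF g] by auto
    have gf: "g \<cdot>\<^bsub>B\<^esub> f \<in> homset B x z" by (rule B.cmp_homset[OF f g])
    have Gf: "Ga f \<in> homset A (G x) (G y)" and Gg: "Ga g \<in> homset A (G y) (G z)"
      and Ggf: "Ga (g \<cdot>\<^bsub>B\<^esub> f) \<in> homset A (G x) (G z)"
      using Ga f g gf by blast+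
    have "Ga (g \<cdot>\<^bsub>B\<^esub> f) = Ga g \<cdot>\<^bsub>A\<^esub> Ga f"
    proof (rule faithful[OF Ggf A.cmp_homset[OF Gf Gg]])
      note Ff = F.farr_homset[OF Gf] and Fg = F.farr_homset[OF Gg]
      show "farr F (Ga (g \<cdot>\<^bsub>B\<^esub> f)) = farr F (Ga g \<cdot>\<^bsub>A\<^esub> Ga f)"
      proof (rule B.cmp_left_cancel[OF e[OF z] e'(1,2)[OF z]])
        show "farr F (Ga (g \<cdot>\<^bsub>B\<^esub> f)) \<in> homset B (fobj F (G x)) (fobj F (G z))"
          "farr F (Ga g \<cdot>\<^bsub>A\<^esub> Ga f) \<in> homset B (fobj F (G x)) (fobj F (G z))"
          using F.farr_homset Ggf A.cmp_homset[OF Gf Gg] by blast+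
        have "e z \<cdot>\<^bsub>B\<^esub> farr F (Ga g \<cdot>\<^bsub>A\<^esub> Ga f) = (e z \<cdot>\<^bsub>B\<^esub> farr F (Ga g)) \<cdot>\<^bsub>B\<^esub> farr F (Ga f)"
          using F.farr_cmp[OF Gf Gg] B.cmp_assoc[OF Ff Fg e[OF z]] by simp
        also have "\<dots> = g \<cdot>\<^bsub>B\<^esub> (e y \<cdot>\<^bsub>B\<^esub> farr F (Ga f))"
          using e_Ga[OF g] B.cmp_assoc[OF Ff e[OF y] g] by simp
        also have "\<dots> = (g \<cdot>\<^bsub>B\<^esub> f) \<cdot>\<^bsub>B\<^esub> e x"
          using e_Ga[OF f] B.cmp_assoc[OF e[OF x] f g] by simp
        finally show "e z \<cdot>\<^bsub>B\<^esub> farr F (Ga (g \<cdot>\<^bsub>B\<^esub> f)) = e z \<cdot>\<^bsub>B\<^esub> farr F (Ga g \<cdot>\<^bsub>A\<^esub> Ga f)"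
          using e_Ga[OF gf] by simp
      qed
    qed
    then show "farr GF (g \<cdot>\<^bsub>B\<^esub> f) = farr GF g \<cdot>\<^bsub>A\<^esub> farr GF f"
      by (simp add: GF_def)
  qed
  interpret G: cat_functor B A GF by fact
  \<comment> \<open>The unit is the lift of the inverse of \<open>e\<close> at \<open>F x\<close>;
    its naturality is that of \<open>e\<close>, read back through \<open>F\<close>.\<close>
  define s where "s x = L x (G (fobj F x)) (e' (fobj F x))" for x
  have s: "s x \<in> homset A x (G (fobj F x)) \<and> farr F (s x) = e' (fobj F x)" if x: "x \<in> obj A" for x
    using L[OF x G[OF F.fobj_obj[OF x]] e'(1)[OF F.fobj_obj[OF x]]] by (simp add: s_def)
  interpret GF: cat_functor A A "GF \<circ>\<^sub>F F"
    by (rule cat_functor_comp[OF F.cat_functor_axioms GF])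
  interpret FG: cat_functor B B "F \<circ>\<^sub>F GF"
    by (rule cat_functor_comp[OF GF F.cat_functor_axioms])
  interpret IA: cat_functor A A id_fctr by (rule A.cat_functor_id)
  interpret IB: cat_functor B B id_fctr by (rule B.cat_functor_id)
  have "nat_isom A A id_fctr (GF \<circ>\<^sub>F F) s"
  proof
    fix x assume x: "x \<in> obj A"
    then have Fx: "fobj F x \<in> obj B" by (rule F.fobj_obj)
    have sx: "s x \<in> homset A x (G (fobj F x))" "farr F (s x) = e' (fobj F x)"
      using s[OF x] by auto
    show "s x \<in> homset A (fobj id_fctr x) (fobj (GF \<circ>\<^sub>F F) x)"
      using sx by (simp add: id_fctr_def comp_fctr_def GF_def)
    \<comment> \<open>The lift of \<open>e\<close> at \<open>F x\<close> inverts \<open>s x\<close>: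
      \<open>F\<close> sends the two to mutually inverse arrows and is faithful.\<close>
    obtain r where r: "r \<in> homset A (G (fobj F x)) x" "farr F r = e (fobj F x)"
      using full[OF G[OF Fx] x e[OF Fx]] by blast
    show "is_iso A (s x)"
    proof (rule A.is_isoI[OF sx(1) r(1)])
      show "r \<cdot>\<^bsub>A\<^esub> s x = idn A x"
        using faithful[OF A.cmp_homset[OF sx(1) r(1)] A.idn_homset[OF x]]
          F.farr_cmp[OF sx(1) r(1)] e'(3)[OF Fx] F.farr_idn[OF x] r sx by simp
      show "s x \<cdot>\<^bsub>A\<^esub> r = idn A (G (fobj F x))"
        using faithful[OF A.cmp_homset[OF r(1) sx(1)] A.idn_homset[OF G[OF Fx]]]
          F.farr_cmp[OF r(1) sx(1)] e'(2)[OF Fx] F.farr_idn[OF G[OF Fx]] r sx by simp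
    qed
  next
    fix f x y assume f: "f \<in> homset A x y"
    have x: "x \<in> obj A" and y: "y \<in> obj A"
      using A.homset_obj[OF f] by auto
    have Ff: "farr F f \<in> homset B (fobj F x) (fobj F y)" by (rule F.farr_homset[OF f])
    have Fx: "fobj F x \<in> obj B" and Fy: "fobj F y \<in> obj B" using F.fobj_obj x y by auto
    have sx: "s x \<in> homset A x (G (fobj F x))" "farr F (s x) = e' (fobj F x)"
      and sy: "s y \<in> homset A y (G (fobj F y))" "farr F (s y) = e' (fobj F y)"
      using s[OF x] s[OF y] by auto
    have GFf: "Ga (farr F f) \<in> homset A (G (fobj F x)) (G (fobj F y))" using Ga[OF Ff] by blast
    have "s y \<cdot>\<^bsub>A\<^esub> f = Ga (farr F f) \<cdot>\<^bsub>A\<^esub> s x"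
    proof (rule faithful[OF A.cmp_homset[OF f sy(1)] A.cmp_homset[OF sx(1) GFf]])
      show "farr F (s y \<cdot>\<^bsub>A\<^esub> f) = farr F (Ga (farr F f) \<cdot>\<^bsub>A\<^esub> s x)"
      proof (rule B.cmp_left_cancel[OF e[OF Fy] e'(1,2)[OF Fy]])
        show "farr F (s y \<cdot>\<^bsub>A\<^esub> f) \<in> homset B (fobj F x) (fobj F (G (fobj F y)))"
          "farr F (Ga (farr F f) \<cdot>\<^bsub>A\<^esub> s x) \<in> homset B (fobj F x) (fobj F (G (fobj F y)))"
          using F.farr_homset A.cmp_homset[OF f sy(1)] A.cmp_homset[OF sx(1) GFf] by blast+
        have "e (fobj F y) \<cdot>\<^bsub>B\<^esub> farr F (Ga (farr F f) \<cdot>\<^bsub>A\<^esub> s x) =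
            (e (fobj F y) \<cdot>\<^bsub>B\<^esub> farr F (Ga (farr F f))) \<cdot>\<^bsub>B\<^esub> e' (fobj F x)"
          using F.farr_cmp[OF sx(1) GFf] sx(2)
            B.cmp_assoc[OF e'(1)[OF Fx] F.farr_homset[OF GFf] e[OF Fy]] by simp
        also have "\<dots> = farr F f"
          using e_Ga[OF Ff] B.cmp_assoc[OF e'(1)[OF Fx] e[OF Fx] Ff] e'(3)[OF Fx] B.cmp_idn[OF Ff]
          by simp
        finally show "e (fobj F y) \<cdot>\<^bsub>B\<^esub> farr F (s y \<cdot>\<^bsub>A\<^esub> f) =
            e (fobj F y) \<cdot>\<^bsub>B\<^esub> farr F (Ga (farr F f) \<cdot>\<^bsub>A\<^esub> s x)"
          using F.farr_cmp[OF f sy(1)] sy(2) B.cmp_assoc[OF Ff e'(1)[OF Fy] e[OF Fy]] e'(3)[OF Fy]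
            B.idn_cmp[OF Ff] by simp
      qed
    qed
    then show "s y \<cdot>\<^bsub>A\<^esub> farr id_fctr f = farr (GF \<circ>\<^sub>F F) f \<cdot>\<^bsub>A\<^esub> s x"
      by (simp add: id_fctr_def comp_fctr_def GF_def)
  qed
  moreover have "nat_isom B B (F \<circ>\<^sub>F GF) id_fctr e"
  proof
    fix y assume y: "y \<in> obj B"
    show "e y \<in> homset B (fobj (F \<circ>\<^sub>F GF) y) (fobj id_fctr y)" "is_iso B (e y)"
      using e[OF y] iso[OF y] by (simp_all add: id_fctr_def comp_fctr_def GF_def)
  next
    fix f x y assume f: "f \<in> homset B x y"
    show "e y \<cdot>\<^bsub>B\<^esub> farr (F \<circ>\<^sub>F GF) f = farr id_fctr f \<cdot>\<^bsub>B\<^esub> e x"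
      using e_Ga[OF f] by (simp add: id_fctr_def comp_fctr_def GF_def)
  qed
  ultimately show ?thesis
    unfolding equivalent_categories_def
    using A.category_axioms B.category_axioms F.cat_functor_axioms GF by blast
qed

section \<open>Direct sums of abelian groups\<close>

text \<open>Agrees with \<open>skew_elem\<close> for the groups that make up \<open>R[C]\<close>.
  The general form serves a second purpose: it is also the inclusion of a summand into the direct
  sum that carries a module.\<close>

definition sum_single :: "'a set \<Rightarrow> ('a \<Rightarrow> ('b, 'c) monoid_scheme) \<Rightarrow> 'a \<Rightarrow> 'b \<Rightarrow> 'a \<Rightarrow> 'b" where
  "sum_single I G p f = (\<lambda>q\<in>I. if q = p then f else \<one>\<^bsub>G q\<^esub>)"

lemma sum_single_apply: "q \<in> I \<Longrightarrow> sum_single I G p f q = (if q = p then f else \<one>\<^bsub>G q\<^esub>)"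
  by (simp add: sum_single_def)

lemma sum_single_same: "q \<in> I \<Longrightarrow> sum_single I G q f q = f"
  by (simp add: sum_single_def)

locale direct_sum =
  fixes I :: "'a set" and G :: "'a \<Rightarrow> ('b, 'c) monoid_scheme"
  assumes summand: "i \<in> I \<Longrightarrow> comm_group (G i)"
begin

abbreviation S where "S \<equiv> sum_group I G"
abbreviation single where "single \<equiv> sum_single I G"

lemma summand_group: "i \<in> I \<Longrightarrow> group (G i)"
  by (rule comm_group.axioms(2)[OF summand])

lemma summand_monoid: "i \<in> I \<Longrightarrow> monoid (G i)"
  by (rule group.is_monoid[OF summand_group])

lemma carrier_S: "carrier S = {x \<in> \<Pi>\<^sub>E i\<in>I. carrier (G i). finite {i \<in> I. x i \<noteq> \<one>\<^bsub>G i\<^esub>}}"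
  by (rule carrier_sum_group[OF summand_group])

lemma S_component: "\<lbrakk>u \<in> carrier S; i \<in> I\<rbrakk> \<Longrightarrow> u i \<in> carrier (G i)"
  by (auto simp: carrier_S PiE_iff)

lemma S_eqI:
  assumes "u \<in> carrier S" "v \<in> carrier S" "\<And>i. i \<in> I \<Longrightarrow> u i = v i"
  shows "u = v"
  using assms(1,2) by (intro extensionalityI[OF _ _ assms(3)]) (auto simp: carrier_S PiE_iff)

lemma mult_apply: "i \<in> I \<Longrightarrow> (u \<otimes>\<^bsub>S\<^esub> v) i = u i \<otimes>\<^bsub>G i\<^esub> v i"
  by simp

lemma comm_group_S: "comm_group S"
proof (rule group.group_comm_groupI[OF sum_group[OF summand_group]])
  fix x y assume x: "x \<in> carrier S" and y: "y \<in> carrier S"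
  show "x \<otimes>\<^bsub>S\<^esub> y = y \<otimes>\<^bsub>S\<^esub> x"
    unfolding mult_sum_group
    using S_component[OF x] S_component[OF y] comm_groupE(4)[OF summand]
    by (intro restrict_ext) blast
qed

sublocale S: comm_group S
  by (rule comm_group_S)

lemma single_closed:
  assumes p: "p \<in> I" and f: "f \<in> carrier (G p)"
  shows "single p f \<in> carrier S"
proof -
  have "finite {q \<in> I. single p f q \<noteq> \<one>\<^bsub>G q\<^esub>}"
    by (rule finite_subset[of _ "{p}"]) (auto simp: sum_single_def)
  moreover have "single p f \<in> (\<Pi>\<^sub>E i\<in>I. carrier (G i))"
    using p f monoid.one_closed[OF summand_monoid] by (auto simp: sum_single_def)
  ultimately show ?thesis
    by (simp add: carrier_S)
qed

lemma single_mult: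
  assumes p: "p \<in> I" and f: "f \<in> carrier (G p)" and g: "g \<in> carrier (G p)"
  shows "single p (f \<otimes>\<^bsub>G p\<^esub> g) = single p f \<otimes>\<^bsub>S\<^esub> single p g"
proof (rule S_eqI)
  show "single p (f \<otimes>\<^bsub>G p\<^esub> g) \<in> carrier S" "single p f \<otimes>\<^bsub>S\<^esub> single p g \<in> carrier S"
    using assms single_closed monoid.m_closed[OF summand_monoid] S.m_closed by blast+
  fix i assume i: "i \<in> I"
  show "single p (f \<otimes>\<^bsub>G p\<^esub> g) i = (single p f \<otimes>\<^bsub>S\<^esub> single p g) i"
    unfolding mult_apply[OF i] using i monoid.l_one[OF summand_monoid[OF i]]
      monoid.one_closed[OF summand_monoid[OF i]]
    by (simp add: sum_single_apply)
qed

lemma single_hom: "p \<in> I \<Longrightarrow> single p \<in> hom (G p) S"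
  by (rule homI) (simp_all add: single_closed single_mult del: mult_sum_group)

lemma single_one: "p \<in> I \<Longrightarrow> single p \<one>\<^bsub>G p\<^esub> = \<one>\<^bsub>S\<^esub>"
  by (auto simp: sum_single_def)

text \<open>Elements of a direct sum have finite support, so the induction runs on the support and
  splits off one component at a time.\<close>

lemma sum_induct [consumes 1, case_names one single]:
  assumes "u \<in> carrier S"
    and one: "P \<one>\<^bsub>S\<^esub>"
    and single: "\<And>p f w. \<lbrakk>p \<in> I; f \<in> carrier (G p); w \<in> carrier S; P w\<rbrakk>
      \<Longrightarrow> P (single p f \<otimes>\<^bsub>S\<^esub> w)"
  shows "P u"
proof -
  have "finite A \<Longrightarrow> \<forall>u\<in>carrier S. {i \<in> I. u i \<noteq> \<one>\<^bsub>G i\<^esub>} = A \<longrightarrow> P u" for A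
  proof (induction A rule: finite_induct)
    case empty
    show ?case
    proof (intro ballI impI)
      fix u assume u: "u \<in> carrier S" and "{i \<in> I. u i \<noteq> \<one>\<^bsub>G i\<^esub>} = {}"
      then have "u = \<one>\<^bsub>S\<^esub>"
        by (intro S_eqI[OF u S.one_closed]) auto
      then show "P u" using one by (simp only:)
    qed
  next
    case (insert p A)
    show ?case
    proof (intro ballI impI)
      fix u assume u: "u \<in> carrier S" and supp: "{i \<in> I. u i \<noteq> \<one>\<^bsub>G i\<^esub>} = insert p A"
      then have p: "p \<in> I" by blast
      \<comment> \<open>Erasing the component at \<open>p\<close> removes exactly \<open>p\<close>
        from the support, so that the induction hypothesis applies to \<open>w\<close>.\<close>
      define w where "w = u(p := \<one>\<^bsub>G p\<^esub>)"
      have supp_w: "{i \<in> I. w i \<noteq> \<one>\<^bsub>G i\<^esub>} = A"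
        using supp insert.hyps by (auto simp: w_def split: if_splits)
      have "w \<in> (\<Pi>\<^sub>E i\<in>I. carrier (G i))"
        using u p monoid.one_closed[OF summand_monoid[OF p]]
        by (auto simp: w_def carrier_S PiE_iff extensional_def)
      then have w: "w \<in> carrier S"
        using supp_w insert.hyps by (simp add: carrier_S)
      have "u = single p (u p) \<otimes>\<^bsub>S\<^esub> w"
      proof (rule S_eqI[OF u S.m_closed[OF single_closed[OF p S_component[OF u p]] w]])
        fix i assume i: "i \<in> I"
        show "u i = (single p (u p) \<otimes>\<^bsub>S\<^esub> w) i"
          unfolding mult_apply[OF i] using monoid.r_one[OF summand_monoid[OF i] S_component[OF u i]]
            monoid.l_one[OF summand_monoid[OF i] S_component[OF u i]]
          by (auto simp: sum_single_apply[OF i] w_def)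
      qed
      moreover have "P w"
        using insert.IH w supp_w by blast
      ultimately show "P u"
        using single[OF p S_component[OF u p] w] by (simp only:)
    qed
  qed
  then show ?thesis
    using assms(1) by (auto simp: carrier_S)
qed

lemma component_hom: "i \<in> I \<Longrightarrow> (\<lambda>u. u i) \<in> hom S (G i)"
  by (rule homI) (auto intro: S_component)

text \<open>The elements \<open>single p f\<close> generate the direct sum. Every identity below
  that is additive in some argument is reduced to generators in this way, one argument at a
  time.\<close>

lemma hom_eqI:
  assumes u: "u \<in> carrier S" and T: "group T" and h: "h \<in> hom S T" and k: "k \<in> hom S T"
    and eq: "\<And>p f. \<lbrakk>p \<in> I; f \<in> carrier (G p)\<rbrakk> \<Longrightarrow> h (single p f) = k (single p f)"
  shows "h u = k u"
  using u
proof (induction u rule: sum_induct)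
  case one
  show ?case
    using hom_one[OF h S.is_group T] hom_one[OF k S.is_group T] by (simp only:)
next
  case (single p f w)
  then show ?case
    using hom_mult[OF h single_closed] hom_mult[OF k single_closed] eq by (simp only:)
qed

text \<open>All terms off \<open>p\<close> are values of homomorphisms at neutral elements. The
  operator \<open>gfinprod\<close> takes the product over the non-neutral terms when they are
  finitely many, so \<open>I\<close> may be infinite.\<close>

lemma gfinprod_single:
  assumes T: "comm_group T" and h: "\<And>i. i \<in> I \<Longrightarrow> h i \<in> hom (G i) T"
    and p: "p \<in> I" and f: "f \<in> carrier (G p)"
  shows "gfinprod T (\<lambda>i. h i (single p f i)) I = h p f"
proof -
  interpret T: comm_group T by fact
  have one: "h i \<one>\<^bsub>G i\<^esub> = \<one>\<^bsub>T\<^esub>" if "i \<in> I" for i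
    by (rule hom_one[OF h[OF that] summand_group[OF that] T.is_group])
  have "gfinprod T (\<lambda>i. h i (single p f i)) I = gfinprod T (\<lambda>i. h i f) {p}"
  proof (rule T.gfinprod_mono_neutral_cong_right)
    show "h i (single p f i) = \<one>\<^bsub>T\<^esub>" if "i \<in> I - {p}" for i
      using that one by (simp add: sum_single_apply)
    show "(\<lambda>i. h i (single p f i)) \<in> I \<rightarrow> carrier T"
      using S_component[OF single_closed[OF p f]] hom_in_carrier[OF h] by blast
    show "h i (single p f i) = h i f" if "i \<in> {p}" for i
      using that p by (simp add: sum_single_apply)
  qed (use p in auto)
  also have "\<dots> = h p f"
    using hom_in_carrier[OF h[OF p] f] by (simp add: Pi_iff)
  finally show ?thesis .
qed

text \<open>
  Terms of two summands may cancel in their sum. Additivity in each argument is therefore shown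
  on a common finite index set that contains all supports.
\<close>

definition biext :: "('d, 'e) monoid_scheme \<Rightarrow> ('a \<Rightarrow> 'b \<Rightarrow> 'a \<Rightarrow> 'b \<Rightarrow> 'd) \<Rightarrow>
    ('a \<Rightarrow> 'b) \<Rightarrow> ('a \<Rightarrow> 'b) \<Rightarrow> 'd" where
  "biext T B v u = finprod T (\<lambda>(q, p). B q (v q) p (u p))
     ({q \<in> I. v q \<noteq> \<one>\<^bsub>G q\<^esub>} \<times> {p \<in> I. u p \<noteq> \<one>\<^bsub>G p\<^esub>})"

context
  fixes T :: "('d, 'e) monoid_scheme" and B :: "'a \<Rightarrow> 'b \<Rightarrow> 'a \<Rightarrow> 'b \<Rightarrow> 'd"
  assumes T: "comm_group T"
    and B_right: "\<lbrakk>q \<in> I; p \<in> I; g \<in> carrier (G q)\<rbrakk> \<Longrightarrow> B q g p \<in> hom (G p) T"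
    and B_left: "\<lbrakk>q \<in> I; p \<in> I; f \<in> carrier (G p)\<rbrakk> \<Longrightarrow> (\<lambda>g. B q g p f) \<in> hom (G q) T"
begin

interpretation T: comm_group T by (rule T)

lemma B_closed: "\<lbrakk>q \<in> I; p \<in> I; g \<in> carrier (G q); f \<in> carrier (G p)\<rbrakk> \<Longrightarrow> B q g p f \<in> carrier T"
  by (rule hom_in_carrier[OF B_right])

lemma B_one:
  assumes "q \<in> I" "p \<in> I"
  shows "g \<in> carrier (G q) \<Longrightarrow> B q g p \<one>\<^bsub>G p\<^esub> = \<one>\<^bsub>T\<^esub>"
    and "f \<in> carrier (G p) \<Longrightarrow> B q \<one>\<^bsub>G q\<^esub> p f = \<one>\<^bsub>T\<^esub>"
  using hom_one[OF B_right[OF assms] summand_group[OF assms(2)] T.is_group]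
    hom_one[OF B_left[OF assms] summand_group[OF assms(1)] T.is_group] by auto

lemma B_Pi:
  assumes "v \<in> carrier S" "u \<in> carrier S" "Q \<subseteq> I" "P \<subseteq> I"
  shows "(\<lambda>(q, p). B q (v q) p (u p)) \<in> Q \<times> P \<rightarrow> carrier T"
  using assms S_component by (auto intro!: B_closed)

text \<open>A pair outside the product of the supports has a neutral entry, and \<open>B\<close>
  sends it to the neutral element because it is additive in each argument. Hence any finite index
  sets that contain the supports give the same value.\<close>

lemma biext_eq:
  assumes v: "v \<in> carrier S" and u: "u \<in> carrier S"
    and Q: "finite Q" "Q \<subseteq> I" "{q \<in> I. v q \<noteq> \<one>\<^bsub>G q\<^esub>} \<subseteq> Q"
    and P: "finite P" "P \<subseteq> I" "{p \<in> I. u p \<noteq> \<one>\<^bsub>G p\<^esub>} \<subseteq> P"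
  shows "biext T B v u = finprod T (\<lambda>(q, p). B q (v q) p (u p)) (Q \<times> P)"
  unfolding biext_def
proof (rule T.finprod_mono_neutral_cong_left)
  fix i assume i: "i \<in> Q \<times> P - {q \<in> I. v q \<noteq> \<one>\<^bsub>G q\<^esub>} \<times> {p \<in> I. u p \<noteq> \<one>\<^bsub>G p\<^esub>}"
  obtain q p where qp: "i = (q, p)" by (cases i)
  have "q \<in> I" "p \<in> I" using i qp Q P by auto
  moreover have "v q = \<one>\<^bsub>G q\<^esub> \<or> u p = \<one>\<^bsub>G p\<^esub>" using i qp Q P by auto
  ultimately show "(case i of (q, p) \<Rightarrow> B q (v q) p (u p)) = \<one>\<^bsub>T\<^esub>"
    using S_component[OF v] S_component[OF u] B_one qp by auto
qed (use Q P B_Pi[OF v u Q(2) P(2)] in auto)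

lemma finite_supp: "u \<in> carrier S \<Longrightarrow> finite {p \<in> I. u p \<noteq> \<one>\<^bsub>G p\<^esub>}"
  by (simp add: carrier_S)

lemma supp_mult:
  assumes "v \<in> carrier S" "w \<in> carrier S"
  shows "{q \<in> I. (v \<otimes>\<^bsub>S\<^esub> w) q \<noteq> \<one>\<^bsub>G q\<^esub>} \<subseteq> {q \<in> I. v q \<noteq> \<one>\<^bsub>G q\<^esub>} \<union> {q \<in> I. w q \<noteq> \<one>\<^bsub>G q\<^esub>}"
  using monoid.l_one[OF summand_monoid] monoid.one_closed[OF summand_monoid] by auto

lemma biext_closed: "\<lbrakk>v \<in> carrier S; u \<in> carrier S\<rbrakk> \<Longrightarrow> biext T B v u \<in> carrier T"
  unfolding biext_def by (intro T.finprod_closed B_Pi) auto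

lemma biext_hom_left:
  assumes u: "u \<in> carrier S"
  shows "(\<lambda>v. biext T B v u) \<in> hom S T"
proof (rule homI)
  fix v w assume v: "v \<in> carrier S" and w: "w \<in> carrier S"
  define Q where "Q = {q \<in> I. v q \<noteq> \<one>\<^bsub>G q\<^esub>} \<union> {q \<in> I. w q \<noteq> \<one>\<^bsub>G q\<^esub>}"
  define P where "P = {p \<in> I. u p \<noteq> \<one>\<^bsub>G p\<^esub>}"
  have Q: "finite Q" "Q \<subseteq> I" using finite_supp v w by (auto simp: Q_def)
  have P: "finite P" "P \<subseteq> I" "{p \<in> I. u p \<noteq> \<one>\<^bsub>G p\<^esub>} \<subseteq> P" using finite_supp u by (auto simp: P_def)
  have "biext T B (v \<otimes>\<^bsub>S\<^esub> w) u = finprod T (\<lambda>(q, p). B q ((v \<otimes>\<^bsub>S\<^esub> w) q) p (u p)) (Q \<times> P)"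
    by (rule biext_eq[OF S.m_closed[OF v w] u Q supp_mult[OF v w, folded Q_def] P])
  also have "\<dots> = finprod T (\<lambda>i. (case i of (q, p) \<Rightarrow> B q (v q) p (u p)) \<otimes>\<^bsub>T\<^esub>
      (case i of (q, p) \<Rightarrow> B q (w q) p (u p))) (Q \<times> P)"
  proof (rule T.finprod_cong'[OF refl])
    show "(\<lambda>i. (case i of (q, p) \<Rightarrow> B q (v q) p (u p)) \<otimes>\<^bsub>T\<^esub>
      (case i of (q, p) \<Rightarrow> B q (w q) p (u p))) \<in> Q \<times> P \<rightarrow> carrier T"
      using B_Pi[OF v u Q(2) P(2)] B_Pi[OF w u Q(2) P(2)] by (auto simp: Pi_iff)
  next
    fix i assume i: "i \<in> Q \<times> P"
    obtain q p where qp: "i = (q, p)" by (cases i)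
    have q: "q \<in> I" and p: "p \<in> I" using i qp Q P by auto
    show "(case i of (q, p) \<Rightarrow> B q ((v \<otimes>\<^bsub>S\<^esub> w) q) p (u p)) = (case i of (q, p) \<Rightarrow> B q (v q) p (u p)) \<otimes>\<^bsub>T\<^esub>
      (case i of (q, p) \<Rightarrow> B q (w q) p (u p))"
      unfolding qp prod.case mult_apply[OF q]
      by (rule hom_mult[OF B_left[OF q p S_component[OF u p]] S_component[OF v q]
          S_component[OF w q]])
  qed
  also have "\<dots> = finprod T (\<lambda>(q, p). B q (v q) p (u p)) (Q \<times> P) \<otimes>\<^bsub>T\<^esub>
      finprod T (\<lambda>(q, p). B q (w q) p (u p)) (Q \<times> P)"
    by (rule T.finprod_multf[OF B_Pi[OF v u Q(2) P(2)] B_Pi[OF w u Q(2) P(2)]])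
  also have "\<dots> = biext T B v u \<otimes>\<^bsub>T\<^esub> biext T B w u"
    using biext_eq[OF v u Q _ P] biext_eq[OF w u Q _ P] by (simp add: Q_def)
  finally show "biext T B (v \<otimes>\<^bsub>S\<^esub> w) u = biext T B v u \<otimes>\<^bsub>T\<^esub> biext T B w u" .
qed (rule biext_closed[OF _ u])

lemma biext_hom_right:
  assumes v: "v \<in> carrier S"
  shows "biext T B v \<in> hom S T"
proof (rule homI)
  fix u w assume u: "u \<in> carrier S" and w: "w \<in> carrier S"
  define P where "P = {q \<in> I. u q \<noteq> \<one>\<^bsub>G q\<^esub>} \<union> {q \<in> I. w q \<noteq> \<one>\<^bsub>G q\<^esub>}"
  define Q where "Q = {p \<in> I. v p \<noteq> \<one>\<^bsub>G p\<^esub>}"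
  have P: "finite P" "P \<subseteq> I" using finite_supp u w by (auto simp: P_def)
  have Q: "finite Q" "Q \<subseteq> I" "{p \<in> I. v p \<noteq> \<one>\<^bsub>G p\<^esub>} \<subseteq> Q" using finite_supp v by (auto simp: Q_def)
  have "biext T B v (u \<otimes>\<^bsub>S\<^esub> w) = finprod T (\<lambda>(q, p). B q (v q) p ((u \<otimes>\<^bsub>S\<^esub> w) p)) (Q \<times> P)"
    by (rule biext_eq[OF v S.m_closed[OF u w] Q P supp_mult[OF u w, folded P_def]])
  also have "\<dots> = finprod T (\<lambda>i. (case i of (q, p) \<Rightarrow> B q (v q) p (u p)) \<otimes>\<^bsub>T\<^esub>
      (case i of (q, p) \<Rightarrow> B q (v q) p (w p))) (Q \<times> P)"
  proof (rule T.finprod_cong'[OF refl])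
    show "(\<lambda>i. (case i of (q, p) \<Rightarrow> B q (v q) p (u p)) \<otimes>\<^bsub>T\<^esub>
      (case i of (q, p) \<Rightarrow> B q (v q) p (w p))) \<in> Q \<times> P \<rightarrow> carrier T"
      using B_Pi[OF v u Q(2) P(2)] B_Pi[OF v w Q(2) P(2)] by (auto simp: Pi_iff)
  next
    fix i assume i: "i \<in> Q \<times> P"
    obtain q p where qp: "i = (q, p)" by (cases i)
    have q: "q \<in> I" and p: "p \<in> I" using i qp Q P by auto
    show "(case i of (q, p) \<Rightarrow> B q (v q) p ((u \<otimes>\<^bsub>S\<^esub> w) p)) = (case i of (q, p) \<Rightarrow> B q (v q) p (u p)) \<otimes>\<^bsub>T\<^esub>
      (case i of (q, p) \<Rightarrow> B q (v q) p (w p))"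
      unfolding qp prod.case mult_apply[OF p]
      by (rule hom_mult[OF B_right[OF q p S_component[OF v q]] S_component[OF u p]
          S_component[OF w p]])
  qed
  also have "\<dots> = finprod T (\<lambda>(q, p). B q (v q) p (u p)) (Q \<times> P) \<otimes>\<^bsub>T\<^esub>
      finprod T (\<lambda>(q, p). B q (v q) p (w p)) (Q \<times> P)"
    by (rule T.finprod_multf[OF B_Pi[OF v u Q(2) P(2)] B_Pi[OF v w Q(2) P(2)]])
  also have "\<dots> = biext T B v u \<otimes>\<^bsub>T\<^esub> biext T B v w"
    using biext_eq[OF v u Q P] biext_eq[OF v w Q P] by (simp add: P_def)
  finally show "biext T B v (u \<otimes>\<^bsub>S\<^esub> w) = biext T B v u \<otimes>\<^bsub>T\<^esub> biext T B v w" .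
qed (rule biext_closed[OF v])

lemma biext_single:
  assumes q: "q \<in> I" and g: "g \<in> carrier (G q)" and p: "p \<in> I" and f: "f \<in> carrier (G p)"
  shows "biext T B (single q g) (single p f) = B q g p f"
proof -
  \<comment> \<open>The supports are empty if \<open>g\<close> or \<open>f\<close> is neutral, so
    the sum is enlarged to the one pair \<open>(q, p)\<close> instead of being read off the
    definition.\<close>
  have "biext T B (single q g) (single p f) =
      finprod T (\<lambda>(q', p'). B q' (single q g q') p' (single p f p')) ({q} \<times> {p})"
    using q p by (intro biext_eq single_closed g f) (auto simp: sum_single_apply split: if_splits)
  also have "\<dots> = B q g p f"
    using B_closed[OF q p g f] by (simp add: sum_single_same q p Pi_iff)
  finally show ?thesis .
qed

end

end

section \<open>Homomorphisms and finite sums\<close>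

lemma hom_finprod:
  assumes S: "comm_group S" and T: "comm_group T" and h: "h \<in> hom S T"
    and f: "f \<in> A \<rightarrow> carrier S" and A: "finite A"
  shows "h (finprod S f A) = finprod T (\<lambda>x. h (f x)) A"
  using A f
proof (induction A rule: finite_induct)
  case empty
  interpret S: comm_group S by fact
  interpret T: comm_group T by fact
  show ?case
    by (simp add: hom_one[OF h S.is_group T.is_group])
next
  case (insert x A)
  interpret S: comm_group S by fact
  interpret T: comm_group T by fact
  have fx: "f x \<in> carrier S" "f \<in> A \<rightarrow> carrier S"
    using insert.prems by auto
  have hf: "(\<lambda>x. h (f x)) \<in> A \<rightarrow> carrier T" "h (f x) \<in> carrier T"
    using fx hom_in_carrier[OF h] by auto
  show ?case
    using insert hf fx hom_mult[OF h fx(1) S.finprod_closed[OF fx(2)]] by simp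
qed

lemma hom_comp:
  assumes "f \<in> hom A B" "g \<in> hom B C"
  shows "(\<lambda>x. g (f x)) \<in> hom A C"
  using hom_in_carrier[OF assms(1)] hom_in_carrier[OF assms(2)] hom_mult[OF assms(1)]
    hom_mult[OF assms(2)]
  by (intro homI) simp_all

lemma hom_mult_pointwise:
  assumes B: "comm_group B" and f: "f \<in> hom A B" and g: "g \<in> hom A B"
  shows "(\<lambda>x. f x \<otimes>\<^bsub>B\<^esub> g x) \<in> hom A B"
proof -
  interpret B: comm_group B by fact
  show ?thesis
    using hom_in_carrier[OF f] hom_in_carrier[OF g] hom_mult[OF f] hom_mult[OF g]
    by (intro homI) (simp_all add: B.m_ac)
qed

lemma hom_const_one: "group B \<Longrightarrow> (\<lambda>_. \<one>\<^bsub>B\<^esub>) \<in> hom A B"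
  using group.is_monoid[of B] by (intro homI) (simp_all add: monoid.one_closed monoid.l_one)

text \<open>Written with \<open>gfinprod\<close>, the left-hand side is additive in
  \<open>u\<close>, so it suffices to compare it with the identity on generators.\<close>

lemma (in direct_sum) finprod_components:
  assumes I: "finite I" and u: "u \<in> carrier S"
  shows "finprod S (\<lambda>i. single i (u i)) I = u"
proof -
  have eq: "finprod S (\<lambda>i. single i (u i)) I = gfinprod S (\<lambda>i. single i (u i)) I"
    using I u single_closed S_component by (intro S.gfinprod_eq_finprod[symmetric]) auto
  have k: "(\<lambda>u. gfinprod S (\<lambda>i. single i (u i)) I) \<in> hom S S"
    by (rule S.hom_group_sum[OF single_hom summand_group])
  have "gfinprod S (\<lambda>i. single i (u i)) I = u"
    using hom_eqI[OF u S.is_group k, of "\<lambda>u. u"] gfinprod_single[OF comm_group_S single_hom]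
    by (simp add: hom_def)
  then show ?thesis
    using eq by simp
qed

section \<open>The algebra of a graded category\<close>

text \<open>
  A preadditive category whose arrows are graded: the arrows of degree \<open>q\<close> form a group \<open>H q\<close> of
  arrows from \<open>s q\<close> to \<open>t q\<close>; \<open>ic\<close> and \<open>mc\<close> compose degrees and arrows, and the identity of \<open>x\<close> is
  \<open>un x\<close> in degree \<open>iu x\<close>. The instance of interest is the Grothendieck construction of a
  representation: its objects are the pairs \<open>(i, x)\<close>, and its arrows are the generators \<open>f\<^sub>a\<close>, of
  degree \<open>(a, x, y)\<close>.
\<close>

locale graded_category =
  fixes Ob :: "'p set" and I :: "'q set" and H :: "'q \<Rightarrow> 'f monoid" and s t :: "'q \<Rightarrow> 'p"
    and ic :: "'q \<Rightarrow> 'q \<Rightarrow> 'q" and mc :: "'q \<Rightarrow> 'f \<Rightarrow> 'q \<Rightarrow> 'f \<Rightarrow> 'f"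
    and iu :: "'p \<Rightarrow> 'q" and un :: "'p \<Rightarrow> 'f"
  assumes finite_Ob: "finite Ob"
    and H_comm: "q \<in> I \<Longrightarrow> comm_group (H q)"
    and s_ob: "q \<in> I \<Longrightarrow> s q \<in> Ob"
    and t_ob: "q \<in> I \<Longrightarrow> t q \<in> Ob"
    and ic_I: "\<lbrakk>q \<in> I; p \<in> I; s q = t p\<rbrakk> \<Longrightarrow> ic q p \<in> I"
    and s_ic: "\<lbrakk>q \<in> I; p \<in> I; s q = t p\<rbrakk> \<Longrightarrow> s (ic q p) = s p"
    and t_ic: "\<lbrakk>q \<in> I; p \<in> I; s q = t p\<rbrakk> \<Longrightarrow> t (ic q p) = t q"
    and mc_hom_right: "\<lbrakk>q \<in> I; p \<in> I; s q = t p; g \<in> carrier (H q)\<rbrakk>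
      \<Longrightarrow> mc q g p \<in> hom (H p) (H (ic q p))"
    and mc_hom_left: "\<lbrakk>q \<in> I; p \<in> I; s q = t p; f \<in> carrier (H p)\<rbrakk>
      \<Longrightarrow> (\<lambda>g. mc q g p f) \<in> hom (H q) (H (ic q p))"
    and ic_assoc: "\<lbrakk>r \<in> I; q \<in> I; p \<in> I; s r = t q; s q = t p\<rbrakk> \<Longrightarrow> ic r (ic q p) = ic (ic r q) p"
    and mc_assoc: "\<lbrakk>r \<in> I; q \<in> I; p \<in> I; s r = t q; s q = t p;
        h \<in> carrier (H r); g \<in> carrier (H q); f \<in> carrier (H p)\<rbrakk>
      \<Longrightarrow> mc r h (ic q p) (mc q g p f) = mc (ic r q) (mc r h q g) p f"
    and iu_I: "x \<in> Ob \<Longrightarrow> iu x \<in> I"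
    and s_iu: "x \<in> Ob \<Longrightarrow> s (iu x) = x"
    and t_iu: "x \<in> Ob \<Longrightarrow> t (iu x) = x"
    and un_H: "x \<in> Ob \<Longrightarrow> un x \<in> carrier (H (iu x))"
    and ic_iu_left: "q \<in> I \<Longrightarrow> ic (iu (t q)) q = q"
    and ic_iu_right: "q \<in> I \<Longrightarrow> ic q (iu (s q)) = q"
    and mc_un_left: "\<lbrakk>q \<in> I; f \<in> carrier (H q)\<rbrakk> \<Longrightarrow> mc (iu (t q)) (un (t q)) q f = f"
    and mc_un_right: "\<lbrakk>q \<in> I; f \<in> carrier (H q)\<rbrakk> \<Longrightarrow> mc q f (iu (s q)) (un (s q)) = f"
begin

sublocale direct_sum I H
  by (rule direct_sum.intro) (rule H_comm)

lemma mc_closed: "\<lbrakk>q \<in> I; p \<in> I; s q = t p; g \<in> carrier (H q); f \<in> carrier (H p)\<rbrakk>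
    \<Longrightarrow> mc q g p f \<in> carrier (H (ic q p))"
  by (rule hom_in_carrier[OF mc_hom_right])

definition elem_mult :: "'q \<Rightarrow> 'f \<Rightarrow> 'q \<Rightarrow> 'f \<Rightarrow> 'q \<Rightarrow> 'f" where
  "elem_mult q g p f = (if s q = t p then single (ic q p) (mc q g p f) else \<one>\<^bsub>S\<^esub>)"

lemma elem_mult_hom_right:
  "\<lbrakk>q \<in> I; p \<in> I; g \<in> carrier (H q)\<rbrakk> \<Longrightarrow> elem_mult q g p \<in> hom (H p) S"
  unfolding elem_mult_def
  using hom_comp[OF mc_hom_right single_hom[OF ic_I]] hom_const_one[OF S.is_group]
  by (cases "s q = t p") simp_all

lemma elem_mult_hom_left:
  "\<lbrakk>q \<in> I; p \<in> I; f \<in> carrier (H p)\<rbrakk> \<Longrightarrow> (\<lambda>g. elem_mult q g p f) \<in> hom (H q) S"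
  unfolding elem_mult_def
  using hom_comp[OF mc_hom_left single_hom[OF ic_I]] hom_const_one[OF S.is_group]
  by (cases "s q = t p") simp_all

definition amult :: "('q \<Rightarrow> 'f) \<Rightarrow> ('q \<Rightarrow> 'f) \<Rightarrow> 'q \<Rightarrow> 'f" where
  "amult = biext S elem_mult"

lemma amult_hom_left: "u \<in> carrier S \<Longrightarrow> (\<lambda>v. amult v u) \<in> hom S S"
  unfolding amult_def
  by (rule biext_hom_left) (assumption | rule comm_group_S elem_mult_hom_right elem_mult_hom_left)+

lemma amult_hom_right: "v \<in> carrier S \<Longrightarrow> amult v \<in> hom S S"
  unfolding amult_def
  by (rule biext_hom_right) (assumption | rule comm_group_S elem_mult_hom_right elem_mult_hom_left)+

lemma amult_single: "\<lbrakk>q \<in> I; g \<in> carrier (H q); p \<in> I; f \<in> carrier (H p)\<rbrakk>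
    \<Longrightarrow> amult (single q g) (single p f) = elem_mult q g p f"
  unfolding amult_def
  by (rule biext_single) (assumption | rule comm_group_S elem_mult_hom_right elem_mult_hom_left)+

lemma amult_closed: "\<lbrakk>v \<in> carrier S; u \<in> carrier S\<rbrakk> \<Longrightarrow> amult v u \<in> carrier S"
  by (rule hom_in_carrier[OF amult_hom_right])

lemma amult_zero_right: "v \<in> carrier S \<Longrightarrow> amult v \<one>\<^bsub>S\<^esub> = \<one>\<^bsub>S\<^esub>"
  by (rule hom_one[OF amult_hom_right S.is_group S.is_group])

lemma amult_zero_left: "u \<in> carrier S \<Longrightarrow> amult \<one>\<^bsub>S\<^esub> u = \<one>\<^bsub>S\<^esub>"
  by (rule hom_one[OF amult_hom_left S.is_group S.is_group])

definition idem :: "'p \<Rightarrow> 'q \<Rightarrow> 'f" where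
  "idem x = single (iu x) (un x)"

definition aone :: "'q \<Rightarrow> 'f" where
  "aone = finprod S idem Ob"

lemma idem_closed: "x \<in> Ob \<Longrightarrow> idem x \<in> carrier S"
  unfolding idem_def by (rule single_closed[OF iu_I un_H])

lemma aone_closed: "aone \<in> carrier S"
  unfolding aone_def using idem_closed by (intro S.finprod_closed) blast

text \<open>Products are composites, so multiplication by an idempotent on the left tests the target
  of a generator; on the right it tests the source.\<close>

lemma idem_amult_single:
  assumes "x \<in> Ob" "q \<in> I" "f \<in> carrier (H q)"
  shows "amult (idem x) (single q f) = (if x = t q then single q f else \<one>\<^bsub>S\<^esub>)"
  using assms amult_single[OF iu_I[OF assms(1)] un_H[OF assms(1)] assms(2,3)] s_iu[of x]
      ic_iu_left[of q] mc_un_left[of q f]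
  by (simp add: idem_def elem_mult_def del: one_sum_group)

lemma single_amult_idem:
  assumes "x \<in> Ob" "q \<in> I" "f \<in> carrier (H q)"
  shows "amult (single q f) (idem x) = (if x = s q then single q f else \<one>\<^bsub>S\<^esub>)"
  using assms amult_single[OF assms(2,3) iu_I[OF assms(1)] un_H[OF assms(1)]] t_iu[of x]
      ic_iu_right[of q] mc_un_right[of q f]
  by (auto simp add: idem_def elem_mult_def simp del: one_sum_group)

text \<open>Both sides are additive in \<open>w\<close>, \<open>v\<close> and \<open>u\<close>. On
  generators the claim is associativity of composition, apart from triples that are not
  composable.\<close>

lemma amult_assoc:
  assumes w: "w \<in> carrier S" and v: "v \<in> carrier S" and u: "u \<in> carrier S"
  shows "amult (amult w v) u = amult w (amult v u)"
proof (rule hom_eqI[OF w S.is_group])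
  show "(\<lambda>w. amult (amult w v) u) \<in> hom S S" "(\<lambda>w. amult w (amult v u)) \<in> hom S S"
    by (rule hom_comp[OF amult_hom_left[OF v] amult_hom_left[OF u]])
      (rule amult_hom_left[OF amult_closed[OF v u]])
  fix r h assume r: "r \<in> I" and h: "h \<in> carrier (H r)"
  note rh = single_closed[OF r h]
  show "amult (amult (single r h) v) u = amult (single r h) (amult v u)"
  proof (rule hom_eqI[OF v S.is_group])
    show "(\<lambda>v. amult (amult (single r h) v) u) \<in> hom S S"
      "(\<lambda>v. amult (single r h) (amult v u)) \<in> hom S S"
      by (rule hom_comp[OF amult_hom_right[OF rh] amult_hom_left[OF u]])
        (rule hom_comp[OF amult_hom_left[OF u] amult_hom_right[OF rh]])
    fix q g assume q: "q \<in> I" and g: "g \<in> carrier (H q)"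
    note qg = single_closed[OF q g]
    show "amult (amult (single r h) (single q g)) u = amult (single r h) (amult (single q g) u)"
    proof (rule hom_eqI[OF u S.is_group])
      show "(\<lambda>u. amult (amult (single r h) (single q g)) u) \<in> hom S S"
        "(\<lambda>u. amult (single r h) (amult (single q g) u)) \<in> hom S S"
        by (rule amult_hom_right[OF amult_closed[OF rh qg]])
          (rule hom_comp[OF amult_hom_right[OF qg] amult_hom_right[OF rh]])
      fix p f assume p: "p \<in> I" and f: "f \<in> carrier (H p)"
      note pf = single_closed[OF p f]
      \<comment> \<open>As \<open>ic\<close> keeps the outer source and target, both bracketings
        vanish under the same condition, the failure of one of the two composability
        conditions.\<close>
      have L: "amult (amult (single r h) (single q g)) (single p f) =
        (if s r = t q \<and> s q = t p then single (ic (ic r q) p) (mc (ic r q) (mc r h q g) p f) else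
            \<one>\<^bsub>S\<^esub>)"
      proof (cases "s r = t q")
        case True
        then show ?thesis
          unfolding amult_single[OF r h q g] elem_mult_def
          using amult_single[OF ic_I[OF r q True] mc_closed[OF r q True h g] p f] s_ic[OF r q True]
          by (simp add: elem_mult_def del: one_sum_group)
      next
        case False
        then show ?thesis
          unfolding amult_single[OF r h q g] elem_mult_def using amult_zero_left[OF pf]
          by (simp del: one_sum_group)
      qed
      have R: "amult (single r h) (amult (single q g) (single p f)) =
        (if s r = t q \<and> s q = t p then single (ic r (ic q p)) (mc r h (ic q p) (mc q g p f)) else
            \<one>\<^bsub>S\<^esub>)"
      proof (cases "s q = t p")
        case True
        then show ?thesis
          unfolding amult_single[OF q g p f] elem_mult_def
          using amult_single[OF r h ic_I[OF q p True] mc_closed[OF q p True g f]] t_ic[OF q p True]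
          by (simp add: elem_mult_def del: one_sum_group)
      next
        case False
        then show ?thesis
          unfolding amult_single[OF q g p f] elem_mult_def using amult_zero_right[OF rh]
          by (simp del: one_sum_group)
      qed
      show "amult (amult (single r h) (single q g)) (single p f) =
          amult (single r h) (amult (single q g) (single p f))"
        unfolding L R using ic_assoc[OF r q p] mc_assoc[OF r q p _ _ h g f] by simp
    qed
  qed
qed

text \<open>Of all the idempotents in the sum, only the one at the target of a generator does not
  annihilate it from the left.\<close>

lemma aone_amult:
  assumes u: "u \<in> carrier S"
  shows "amult aone u = u"
proof (rule hom_eqI[OF u S.is_group amult_hom_right[OF aone_closed]])
  show "(\<lambda>u. u) \<in> hom S S" by (simp add: hom_def)
  fix q f assume q: "q \<in> I" and f: "f \<in> carrier (H q)"
  note qf = single_closed[OF q f]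
  have "amult aone (single q f) = finprod S (\<lambda>x. amult (idem x) (single q f)) Ob"
    unfolding aone_def using idem_closed
    by (intro hom_finprod[OF comm_group_S comm_group_S amult_hom_left[OF qf] _ finite_Ob]) blast
  also have "\<dots> = finprod S (\<lambda>x. if t q = x then single q f else \<one>\<^bsub>S\<^esub>) Ob"
    using idem_amult_single[OF _ q f] qf S.one_closed by (intro S.finprod_cong') auto
  also have "\<dots> = single q f"
    using qf by (intro S.finprod_singleton[OF t_ob[OF q] finite_Ob]) blast
  finally show "amult aone (single q f) = single q f" .
qed

lemma amult_aone:
  assumes u: "u \<in> carrier S"
  shows "amult u aone = u"
proof (rule hom_eqI[OF u S.is_group amult_hom_left[OF aone_closed]])
  show "(\<lambda>u. u) \<in> hom S S" by (simp add: hom_def)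
  fix q f assume q: "q \<in> I" and f: "f \<in> carrier (H q)"
  note qf = single_closed[OF q f]
  have "amult (single q f) aone = finprod S (\<lambda>x. amult (single q f) (idem x)) Ob"
    unfolding aone_def using idem_closed
    by (intro hom_finprod[OF comm_group_S comm_group_S amult_hom_right[OF qf] _ finite_Ob]) blast
  also have "\<dots> = finprod S (\<lambda>x. if s q = x then single q f else \<one>\<^bsub>S\<^esub>) Ob"
    using single_amult_idem[OF _ q f] qf S.one_closed by (intro S.finprod_cong') auto
  also have "\<dots> = single q f"
    using qf by (intro S.finprod_singleton[OF s_ob[OF q] finite_Ob]) blast
  finally show "amult (single q f) aone = single q f" .
qed

text \<open>Built with the same record fields as \<open>skew_algebra\<close>, so that for the
  Grothendieck construction the two are equal rings and not merely isomorphic ones.\<close>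

definition alg :: "('q \<Rightarrow> 'f) ring" where
  "alg = \<lparr>carrier = carrier S, monoid.mult = amult, one = aone, ring.zero = \<one>\<^bsub>S\<^esub>, add = monoid.mult
      S\<rparr>"

lemma alg_simps:
  "carrier alg = carrier S" "monoid.mult alg = amult" "one alg = aone" "add alg = monoid.mult S"
  by (simp_all add: alg_def)

lemma ring_alg: "ring alg"
proof (rule ringI)
  have "add_monoid alg = S"
    by (simp add: alg_def del: mult_sum_group one_sum_group)
  then show "abelian_group alg"
    by (intro comm_group_abelian_groupI) (simp only: comm_group_S)
  show "monoid alg"
    by (rule monoidI)
      (simp_all only: alg_simps amult_closed aone_closed amult_assoc aone_amult amult_aone)
qed (simp_all only: alg_simps hom_mult[OF amult_hom_left] hom_mult[OF amult_hom_right])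

end

section \<open>Right modules and transport of structure\<close>

text \<open>The carriers may have different types, unlike for arrows of \<open>Mod_ring\<close>:
  direct sums first live on tuples over \<open>'u\<close> and are compared there with modules on
  \<open>'u\<close>.\<close>

definition rmod_hom ::
    "('s, 'e) ring_scheme \<Rightarrow> ('s, 'u) rmod \<Rightarrow> ('s, 'v) rmod \<Rightarrow> ('u \<Rightarrow> 'v) \<Rightarrow> bool" where
  "rmod_hom A M N h \<longleftrightarrow> h \<in> hom M N \<and>
     (\<forall>m\<in>carrier M. \<forall>s\<in>carrier A. h (m \<star>\<^bsub>M\<^esub> s) = h m \<star>\<^bsub>N\<^esub> s)"

lemma rmod_homD:
  assumes "rmod_hom A M N h"
  shows "h \<in> hom M N" "\<lbrakk>m \<in> carrier M; s \<in> carrier A\<rbrakk> \<Longrightarrow> h (m \<star>\<^bsub>M\<^esub> s) = h m \<star>\<^bsub>N\<^esub> s"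
    "m \<in> carrier M \<Longrightarrow> h m \<in> carrier N"
  using assms by (auto simp: rmod_hom_def hom_def)

lemma comm_group_cong:
  assumes G: "comm_group G"
    and eq: "carrier H = carrier G" "monoid.mult H = monoid.mult G" "\<one>\<^bsub>H\<^esub> = \<one>\<^bsub>G\<^esub>"
  shows "comm_group H"
proof -
  interpret G: comm_group G by fact
  show ?thesis
    by (rule comm_groupI) (auto simp: eq G.m_ac intro!: bexI[of _ "inv\<^bsub>G\<^esub> _"])
qed

lemma rmod_hom_comp: "\<lbrakk>rmod_hom A L M f; rmod_hom A M N g\<rbrakk> \<Longrightarrow> rmod_hom A L N (\<lambda>x. g (f x))"
  unfolding rmod_hom_def using hom_in_carrier[of f L M] by (auto intro: hom_comp)

lemma rmod_hom_cong:
  assumes M: "right_module A M" and f: "rmod_hom A M N f"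
    and eq: "\<And>m. m \<in> carrier M \<Longrightarrow> g m = f m"
  shows "rmod_hom A M N g"
proof -
  interpret right_module A M by fact
  show ?thesis
    using f unfolding rmod_hom_def hom_def by (auto simp: eq act_closed)
qed

lemma rmod_hom_inv:
  assumes M: "right_module A M" and h: "rmod_hom A M N h"
    and bij: "bij_betw h (carrier M) (carrier N)"
  shows "rmod_hom A N M (inv_into (carrier M) h)"
proof -
  interpret right_module A M by fact
  define k where "k = inv_into (carrier M) h"
  have k: "k n \<in> carrier M" "h (k n) = n" if "n \<in> carrier N" for n
    using bij that by (auto simp: k_def bij_betw_def f_inv_into_f inv_into_into)
  have k_eqI: "k n = m" if "m \<in> carrier M" "h m = n" for m n
    using bij that by (auto simp: k_def bij_betw_def)
  have "k (n \<otimes>\<^bsub>N\<^esub> n') = k n \<otimes>\<^bsub>M\<^esub> k n'" if "n \<in> carrier N" "n' \<in> carrier N" for n n'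
    using k[OF that(1)] k[OF that(2)] hom_mult[OF rmod_homD(1)[OF h]] by (intro k_eqI) auto
  moreover have "k (n \<star>\<^bsub>N\<^esub> s) = k n \<star>\<^bsub>M\<^esub> s" if "n \<in> carrier N" "s \<in> carrier A" for n s
    using k[OF that(1)] rmod_homD(2)[OF h, of "k n" s] that by (intro k_eqI act_closed) auto
  ultimately show ?thesis
    using k(1) unfolding rmod_hom_def hom_def k_def[symmetric] by auto
qed

text \<open>The structure on the image of \<open>e\<close> that makes \<open>e\<close> an
  isomorphism, for \<open>e\<close> injective on the carrier. It changes the type of the carrier,
  and so brings a direct sum back into the universe.\<close>

definition transport :: "('u \<Rightarrow> 'v) \<Rightarrow> ('s, 'u) rmod \<Rightarrow> ('s, 'v) rmod" where
  "transport e M = \<lparr>carrier = e ` carrier M,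
     monoid.mult = (\<lambda>a b. e (inv_into (carrier M) e a \<otimes>\<^bsub>M\<^esub> inv_into (carrier M) e b)),
     one = e \<one>\<^bsub>M\<^esub>,
     act = (\<lambda>a s. e (inv_into (carrier M) e a \<star>\<^bsub>M\<^esub> s))\<rparr>"

lemma transport_simps:
  assumes "inj_on e (carrier M)"
  shows "carrier (transport e M) = e ` carrier M" "\<one>\<^bsub>transport e M\<^esub> = e \<one>\<^bsub>M\<^esub>"
    "\<lbrakk>m \<in> carrier M; n \<in> carrier M\<rbrakk> \<Longrightarrow> e m \<otimes>\<^bsub>transport e M\<^esub> e n = e (m \<otimes>\<^bsub>M\<^esub> n)"
    "m \<in> carrier M \<Longrightarrow> e m \<star>\<^bsub>transport e M\<^esub> s = e (m \<star>\<^bsub>M\<^esub> s)"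
  using assms by (simp_all add: transport_def)

lemma right_module_transport:
  assumes M: "right_module A M" and e: "inj_on e (carrier M)"
  shows "right_module A (transport e M)"
proof -
  interpret right_module A M by fact
  note simps = transport_simps[OF e]
  have "comm_group (transport e M)"
  proof (rule comm_groupI)
    fix x assume "x \<in> carrier (transport e M)"
    then obtain m where m: "x = e m" "m \<in> carrier M" by (auto simp: simps)
    then show "\<exists>y\<in>carrier (transport e M). y \<otimes>\<^bsub>transport e M\<^esub> x = \<one>\<^bsub>transport e M\<^esub>"
      by (intro bexI[of _ "e (inv\<^bsub>M\<^esub> m)"]) (simp_all add: simps)
  qed (auto simp: simps M.m_ac)
  then show ?thesis
    using S.ring_axioms
    by (intro right_module.intro right_module_axioms.intro)
      (auto simp: simps act_closed act_add_left act_add_right act_mult act_one)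
qed

lemma rmod_hom_transport:
  "inj_on e (carrier M) \<Longrightarrow> rmod_hom A M (transport e M) e"
  by (auto simp: rmod_hom_def transport_simps intro!: homI)

lemma bij_betw_transport:
  "inj_on e (carrier M) \<Longrightarrow> bij_betw e (carrier M) (carrier (transport e M))"
  by (simp add: bij_betw_def transport_simps)

section \<open>Modules over a graded category\<close>

text \<open>An additive functor from the opposite of the graded category to abelian groups, given
  degree by degree: \<open>\<alpha> q f\<close> is its value at the arrow \<open>f\<close> of degree
  \<open>q\<close>. It runs from the target to the source, hence the reversed order in
  \<open>\<alpha>_comp\<close>.\<close>

locale graded_module = graded_category Ob I H s t ic mc iu un
  for Ob :: "'p set" and I :: "'q set" and H :: "'q \<Rightarrow> 'f monoid" and s t :: "'q \<Rightarrow> 'p"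
    and ic :: "'q \<Rightarrow> 'q \<Rightarrow> 'q" and mc :: "'q \<Rightarrow> 'f \<Rightarrow> 'q \<Rightarrow> 'f \<Rightarrow> 'f"
    and iu :: "'p \<Rightarrow> 'q" and un :: "'p \<Rightarrow> 'f" +
  fixes K :: "'p \<Rightarrow> 'u monoid" and \<alpha> :: "'q \<Rightarrow> 'f \<Rightarrow> 'u \<Rightarrow> 'u"
  assumes K_comm: "x \<in> Ob \<Longrightarrow> comm_group (K x)"
    and \<alpha>_hom: "\<lbrakk>q \<in> I; f \<in> carrier (H q)\<rbrakk> \<Longrightarrow> \<alpha> q f \<in> hom (K (t q)) (K (s q))"
    and \<alpha>_add: "\<lbrakk>q \<in> I; m \<in> carrier (K (t q))\<rbrakk> \<Longrightarrow> (\<lambda>f. \<alpha> q f m) \<in> hom (H q) (K (s q))"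
    and \<alpha>_comp: "\<lbrakk>q \<in> I; p \<in> I; s q = t p; g \<in> carrier (H q); f \<in> carrier (H p); m \<in> carrier
        (K (t q))\<rbrakk>
      \<Longrightarrow> \<alpha> (ic q p) (mc q g p f) m = \<alpha> p f (\<alpha> q g m)"
    and \<alpha>_one: "\<lbrakk>x \<in> Ob; m \<in> carrier (K x)\<rbrakk> \<Longrightarrow> \<alpha> (iu x) (un x) m = m"
begin

sublocale K: direct_sum Ob K
  by (rule direct_sum.intro) (rule K_comm)

lemma \<alpha>_closed: "\<lbrakk>q \<in> I; f \<in> carrier (H q); m \<in> carrier (K (t q))\<rbrakk> \<Longrightarrow> \<alpha> q f m \<in> carrier (K (s q))"
  by (rule hom_in_carrier[OF \<alpha>_hom])

definition elem_act :: "'q \<Rightarrow> ('p \<Rightarrow> 'u) \<Rightarrow> 'f \<Rightarrow> 'p \<Rightarrow> 'u" where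
  "elem_act q m f = K.single (s q) (\<alpha> q f (m (t q)))"

text \<open>Only the object set is assumed finite, so there may be infinitely many degrees.
  \<open>gfinprod\<close> still gives a finite sum, as an element of the algebra has finite support
  and \<open>elem_act\<close> sends neutral arrows to zero.\<close>

definition tact :: "('p \<Rightarrow> 'u) \<Rightarrow> ('q \<Rightarrow> 'f) \<Rightarrow> 'p \<Rightarrow> 'u" where
  "tact m u = gfinprod K.S (\<lambda>q. elem_act q m (u q)) I"

definition tmod :: "('q \<Rightarrow> 'f, 'p \<Rightarrow> 'u) rmod" where
  "tmod = \<lparr>carrier = carrier K.S, monoid.mult = monoid.mult K.S, one = \<one>\<^bsub>K.S\<^esub>, act = tact\<rparr>"

lemma tmod_simps:
  "carrier tmod = carrier K.S" "monoid.mult tmod = monoid.mult K.S" "one tmod = one K.S" "act tmod =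
      tact"
  by (simp_all add: tmod_def)

lemma elem_act_hom:
  assumes q: "q \<in> I" and m: "m \<in> carrier K.S"
  shows "elem_act q m \<in> hom (H q) K.S"
  unfolding elem_act_def
  by (rule hom_comp[OF \<alpha>_add[OF q K.S_component[OF m t_ob[OF q]]] K.single_hom[OF s_ob[OF q]]])

lemma elem_act_hom_left:
  assumes q: "q \<in> I" and f: "f \<in> carrier (H q)"
  shows "(\<lambda>m. elem_act q m f) \<in> hom K.S K.S"
  unfolding elem_act_def
  by (rule hom_comp[OF hom_comp[OF K.component_hom[OF t_ob[OF q]] \<alpha>_hom[OF q f]]
        K.single_hom[OF s_ob[OF q]]])

lemma tact_hom_right: "m \<in> carrier K.S \<Longrightarrow> tact m \<in> hom S K.S"
  unfolding tact_def by (rule K.S.hom_group_sum[OF elem_act_hom summand_group])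

lemma tact_closed: "\<lbrakk>m \<in> carrier K.S; u \<in> carrier S\<rbrakk> \<Longrightarrow> tact m u \<in> carrier K.S"
  by (rule hom_in_carrier[OF tact_hom_right])

lemma tact_single: "\<lbrakk>m \<in> carrier K.S; q \<in> I; f \<in> carrier (H q)\<rbrakk>
    \<Longrightarrow> tact m (single q f) = K.single (s q) (\<alpha> q f (m (t q)))"
  unfolding tact_def elem_act_def[symmetric]
  by (rule gfinprod_single[OF K.comm_group_S elem_act_hom])

lemma tact_hom_left:
  assumes u: "u \<in> carrier S"
  shows "(\<lambda>m. tact m u) \<in> hom K.S K.S"
proof (rule homI)
  fix m n assume m: "m \<in> carrier K.S" and n: "n \<in> carrier K.S"
  note mn = K.S.m_closed[OF m n]
  show "tact (m \<otimes>\<^bsub>K.S\<^esub> n) u = tact m u \<otimes>\<^bsub>K.S\<^esub> tact n u"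
  proof (rule hom_eqI[OF u K.S.is_group tact_hom_right[OF mn]
        hom_mult_pointwise[OF K.comm_group_S tact_hom_right[OF m] tact_hom_right[OF n]]])
    fix q f assume q: "q \<in> I" and f: "f \<in> carrier (H q)"
    show "tact (m \<otimes>\<^bsub>K.S\<^esub> n) (single q f) = tact m (single q f) \<otimes>\<^bsub>K.S\<^esub> tact n (single q f)"
      unfolding tact_single[OF m q f] tact_single[OF n q f] tact_single[OF mn q f]
      using hom_mult[OF elem_act_hom_left[OF q f] m n] by (simp only: elem_act_def)
  qed
qed (rule tact_closed[OF _ u])

text \<open>By additivity in \<open>v\<close> and \<open>u\<close> it suffices to treat generators.
  If these are composable, the claim is functoriality, \<open>\<alpha>_comp\<close>. Otherwise the
  product is zero on the left, and on the right the tuple concentrated at \<open>s q\<close> has a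
  neutral component at \<open>t p\<close>.\<close>

lemma tact_amult:
  assumes m: "m \<in> carrier K.S" and v: "v \<in> carrier S" and u: "u \<in> carrier S"
  shows "tact m (amult v u) = tact (tact m v) u"
proof (rule hom_eqI[OF v K.S.is_group])
  show "(\<lambda>v. tact m (amult v u)) \<in> hom S K.S" "(\<lambda>v. tact (tact m v) u) \<in> hom S K.S"
    by (rule hom_comp[OF amult_hom_left[OF u] tact_hom_right[OF m]])
      (rule hom_comp[OF tact_hom_right[OF m] tact_hom_left[OF u]])
  fix q g assume q: "q \<in> I" and g: "g \<in> carrier (H q)"
  note qg = single_closed[OF q g]
  show "tact m (amult (single q g) u) = tact (tact m (single q g)) u"
  proof (rule hom_eqI[OF u K.S.is_group])
    show "(\<lambda>u. tact m (amult (single q g) u)) \<in> hom S K.S" "tact (tact m (single q g)) \<in> hom S K.S"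
      by (rule hom_comp[OF amult_hom_right[OF qg] tact_hom_right[OF m]])
        (rule tact_hom_right[OF tact_closed[OF m qg]])
    fix p f assume p: "p \<in> I" and f: "f \<in> carrier (H p)"
    have R: "tact (tact m (single q g)) (single p f) =
        K.single (s p) (\<alpha> p f (K.single (s q) (\<alpha> q g (m (t q))) (t p)))"
      unfolding tact_single[OF tact_closed[OF m qg] p f]
      by (simp only: tact_single[OF m q g])
    note mt = K.S_component[OF m t_ob[OF q]]
    show "tact m (amult (single q g) (single p f)) = tact (tact m (single q g)) (single p f)"
    proof (cases "s q = t p")
      case True
      have "tact m (amult (single q g) (single p f)) = K.single (s p)
          (\<alpha> (ic q p) (mc q g p f) (m (t q)))"
        using tact_single[OF m ic_I[OF q p True] mc_closed[OF q p True g f]] True s_ic[OF q p True]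
          t_ic[OF q p True]
        unfolding amult_single[OF q g p f] elem_mult_def by simp
      then show ?thesis
        unfolding R using True \<alpha>_comp[OF q p True g f mt] sum_single_same[OF t_ob[OF p], of K] by
            simp
    next
      case False
      have "\<alpha> p f \<one>\<^bsub>K (t p)\<^esub> = \<one>\<^bsub>K (s p)\<^esub>"
        by (rule hom_one[OF \<alpha>_hom[OF p f] K.summand_group[OF t_ob[OF p]]
            K.summand_group[OF s_ob[OF p]]])
      then have "tact (tact m (single q g)) (single p f) = \<one>\<^bsub>K.S\<^esub>"
        unfolding R using False K.single_one[OF s_ob[OF p]] sum_single_apply[OF t_ob[OF p], of K]
        by (auto simp del: one_sum_group)
      moreover have "tact m (amult (single q g) (single p f)) = \<one>\<^bsub>K.S\<^esub>"
        unfolding amult_single[OF q g p f] elem_mult_def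
        using False hom_one[OF tact_hom_right[OF m] S.is_group K.S.is_group] by
            (simp del: one_sum_group)
      ultimately show ?thesis by (simp only:)
    qed
  qed
qed

text \<open>The idempotents act as the projections onto the summands. This is how the decomposition
  can be recovered from the module structure alone.\<close>

lemma tact_idem:
  assumes m: "m \<in> carrier K.S" and x: "x \<in> Ob"
  shows "tact m (idem x) = K.single x (m x)"
  unfolding idem_def tact_single[OF m iu_I[OF x] un_H[OF x]] s_iu[OF x] t_iu[OF x]
  by (simp only: \<alpha>_one[OF x K.S_component[OF m x]])

lemma tact_aone:
  assumes m: "m \<in> carrier K.S"
  shows "tact m aone = m"
proof -
  have "tact m aone = finprod K.S (\<lambda>x. tact m (idem x)) Ob"
    unfolding aone_def using idem_closed
    by (intro hom_finprod[OF comm_group_S K.comm_group_S tact_hom_right[OF m] _ finite_Ob]) blast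
  also have "\<dots> = finprod K.S (\<lambda>x. K.single x (m x)) Ob"
    using tact_idem[OF m] K.single_closed K.S_component[OF m] by (intro K.S.finprod_cong') auto
  also have "\<dots> = m"
    by (rule K.finprod_components[OF finite_Ob m])
  finally show ?thesis .
qed

lemma right_module_tmod: "right_module alg tmod"
proof (rule right_module.intro[OF ring_alg _ right_module_axioms.intro])
  show "comm_group tmod"
    by (rule comm_group_cong[OF K.comm_group_S]) (simp_all only: tmod_simps)
qed (simp_all only: tmod_simps alg_simps tact_closed hom_mult[OF tact_hom_left]
    hom_mult[OF tact_hom_right] tact_amult tact_aone)

end


text \<open>
  A linear map between direct sums commutes with the idempotents, so it is determined by its
  restrictions to the summands; as it commutes with all generators, these are natural.
\<close>

locale graded_module_pair =
  M: graded_module Ob I H s t ic mc iu un K \<alpha> + N: graded_module Ob I H s t ic mc iu un L \<beta>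
  for Ob :: "'p set" and I :: "'q set" and H :: "'q \<Rightarrow> 'f monoid" and s t :: "'q \<Rightarrow> 'p"
    and ic :: "'q \<Rightarrow> 'q \<Rightarrow> 'q" and mc :: "'q \<Rightarrow> 'f \<Rightarrow> 'q \<Rightarrow> 'f \<Rightarrow> 'f"
    and iu :: "'p \<Rightarrow> 'q" and un :: "'p \<Rightarrow> 'f"
    and K :: "'p \<Rightarrow> 'u monoid" and \<alpha> :: "'q \<Rightarrow> 'f \<Rightarrow> 'u \<Rightarrow> 'u"
    and L :: "'p \<Rightarrow> 'v monoid" and \<beta> :: "'q \<Rightarrow> 'f \<Rightarrow> 'v \<Rightarrow> 'v"
begin

definition natural_family :: "('p \<Rightarrow> 'u \<Rightarrow> 'v) \<Rightarrow> bool" where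
  "natural_family \<phi> \<longleftrightarrow> (\<forall>x\<in>Ob. \<phi> x \<in> hom (K x) (L x)) \<and>
     (\<forall>q\<in>I. \<forall>f\<in>carrier (H q). \<forall>m\<in>carrier (K (t q)). \<phi> (s q) (\<alpha> q f m) = \<beta> q f (\<phi> (t q) m))"

definition sum_map :: "('p \<Rightarrow> 'u \<Rightarrow> 'v) \<Rightarrow> ('p \<Rightarrow> 'u) \<Rightarrow> 'p \<Rightarrow> 'v" where
  "sum_map \<phi> m = (\<lambda>x\<in>Ob. \<phi> x (m x))"

lemma sum_map_closed:
  assumes "natural_family \<phi>" "m \<in> carrier M.K.S"
  shows "sum_map \<phi> m \<in> carrier N.K.S"
  using assms M.K.S_component[OF assms(2)] M.finite_Ob
  by (auto simp: natural_family_def sum_map_def N.K.carrier_S hom_def)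

lemma sum_map_hom:
  assumes \<phi>: "natural_family \<phi>"
  shows "sum_map \<phi> \<in> hom M.K.S N.K.S"
proof (rule homI)
  fix m n assume m: "m \<in> carrier M.K.S" and n: "n \<in> carrier M.K.S"
  show "sum_map \<phi> (m \<otimes>\<^bsub>M.K.S\<^esub> n) = sum_map \<phi> m \<otimes>\<^bsub>N.K.S\<^esub> sum_map \<phi> n"
  proof (rule N.K.S_eqI)
    fix x assume x: "x \<in> Ob"
    then have "\<phi> x \<in> hom (K x) (L x)" using \<phi> by (simp add: natural_family_def)
    from hom_mult[OF this M.K.S_component[OF m x] M.K.S_component[OF n x]]
    show "sum_map \<phi> (m \<otimes>\<^bsub>M.K.S\<^esub> n) x = (sum_map \<phi> m \<otimes>\<^bsub>N.K.S\<^esub> sum_map \<phi> n) x"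
      unfolding N.K.mult_apply[OF x] by (simp add: sum_map_def x)
  qed (rule sum_map_closed[OF \<phi> M.K.S.m_closed[OF m n]]
        N.K.S.m_closed[OF sum_map_closed[OF \<phi> m] sum_map_closed[OF \<phi> n]])+
qed (rule sum_map_closed[OF \<phi>])

lemma sum_map_single:
  assumes \<phi>: "natural_family \<phi>" and x: "x \<in> Ob" and m: "m \<in> carrier (K x)"
  shows "sum_map \<phi> (M.K.single x m) = N.K.single x (\<phi> x m)"
proof
  fix y
  have "\<phi> y \<one>\<^bsub>K y\<^esub> = \<one>\<^bsub>L y\<^esub>" if "y \<in> Ob"
    using \<phi> that by (intro hom_one M.K.summand_group N.K.summand_group)
        (auto simp: natural_family_def)
  then show "sum_map \<phi> (M.K.single x m) y = N.K.single x (\<phi> x m) y"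
    by (simp add: sum_map_def sum_single_def)
qed

lemma rmod_hom_sum_map:
  assumes \<phi>: "natural_family \<phi>"
  shows "rmod_hom M.alg M.tmod N.tmod (sum_map \<phi>)"
proof -
  have "sum_map \<phi> (M.tact m u) = N.tact (sum_map \<phi> m) u"
    if m: "m \<in> carrier M.K.S" and u: "u \<in> carrier M.S" for m u
  proof (rule M.hom_eqI[OF u N.K.S.is_group hom_comp[OF M.tact_hom_right[OF m] sum_map_hom[OF \<phi>]]
        N.tact_hom_right[OF sum_map_closed[OF \<phi> m]]])
    fix q f assume q: "q \<in> I" and f: "f \<in> carrier (H q)"
    note mt = M.K.S_component[OF m M.t_ob[OF q]]
    have nat: "\<phi> (s q) (\<alpha> q f (m (t q))) = \<beta> q f (\<phi> (t q) (m (t q)))"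
      using \<phi> q f mt by (simp add: natural_family_def)
    have t: "sum_map \<phi> m (t q) = \<phi> (t q) (m (t q))"
      by (simp add: sum_map_def M.t_ob[OF q])
    show "sum_map \<phi> (M.tact m (M.single q f)) = N.tact (sum_map \<phi> m) (M.single q f)"
      unfolding M.tact_single[OF m q f] N.tact_single[OF sum_map_closed[OF \<phi> m] q f]
        sum_map_single[OF \<phi> M.s_ob[OF q] M.\<alpha>_closed[OF q f mt]] nat t ..
  qed
  then show ?thesis
    using sum_map_hom[OF \<phi>]
    unfolding rmod_hom_def hom_def M.tmod_simps N.tmod_simps M.alg_simps by blast
qed

text \<open>The diagonal block of \<open>h\<close> at \<open>x\<close>: include the summand, apply
  \<open>h\<close>, project.\<close>

definition family_of :: "(('p \<Rightarrow> 'u) \<Rightarrow> 'p \<Rightarrow> 'v) \<Rightarrow> 'p \<Rightarrow> 'u \<Rightarrow> 'v" where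
  "family_of h x m = h (M.K.single x m) x"

context
  fixes h assumes h: "rmod_hom M.alg M.tmod N.tmod h"
begin

lemma tmod_hom: "h \<in> hom M.K.S N.K.S"
  using h unfolding rmod_hom_def hom_def by (simp only: M.tmod_simps N.tmod_simps)

lemma tmod_hom_tact: "\<lbrakk>m \<in> carrier M.K.S; u \<in> carrier M.S\<rbrakk> \<Longrightarrow> h (M.tact m u) = N.tact (h m) u"
  using h unfolding rmod_hom_def by (simp only: M.tmod_simps N.tmod_simps M.alg_simps)

lemma tmod_hom_closed: "m \<in> carrier M.K.S \<Longrightarrow> h m \<in> carrier N.K.S"
  by (rule hom_in_carrier[OF tmod_hom])

text \<open>A generator of degree \<open>q\<close> moves the summand at \<open>t q\<close> into the
  summand at \<open>s q\<close>. Linearity of \<open>h\<close> for this generator, read at the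
  component \<open>s q\<close>, is naturality.\<close>

lemma natural_family_of: "natural_family (family_of h)"
  unfolding natural_family_def
proof (intro conjI ballI)
  fix x assume x: "x \<in> Ob"
  show "family_of h x \<in> hom (K x) (L x)"
    unfolding family_of_def
    by (rule hom_comp[OF hom_comp[OF M.K.single_hom[OF x] tmod_hom] N.K.component_hom[OF x]])
next
  fix q f m assume q: "q \<in> I" and f: "f \<in> carrier (H q)" and m: "m \<in> carrier (K (t q))"
  note mq = M.K.single_closed[OF M.t_ob[OF q] m]
  have "h (M.K.single (s q) (\<alpha> q f m)) = h (M.tact (M.K.single (t q) m) (M.single q f))"
    unfolding M.tact_single[OF mq q f] sum_single_same[OF M.t_ob[OF q]] ..
  also have "\<dots> = N.K.single (s q) (\<beta> q f (h (M.K.single (t q) m) (t q)))"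
    unfolding tmod_hom_tact[OF mq M.single_closed[OF q f]] by
        (rule N.tact_single[OF tmod_hom_closed[OF mq] q f])
  finally show "family_of h (s q) (\<alpha> q f m) = \<beta> q f (family_of h (t q) m)"
    unfolding family_of_def by (simp only: sum_single_same[OF M.s_ob[OF q]])
qed

lemma sum_map_family_of:
  assumes m: "m \<in> carrier M.K.S"
  shows "sum_map (family_of h) m = h m"
proof (rule N.K.S_eqI[OF sum_map_closed[OF natural_family_of m] tmod_hom_closed[OF m]])
  fix x assume x: "x \<in> Ob"
  \<comment> \<open>The tuple \<open>M.K.single x (m x)\<close> is \<open>m\<close> acted on by
    \<open>idem x\<close>. Linearity carries the idempotent over to \<open>h m\<close>, so the
    off-diagonal blocks of \<open>h\<close> vanish.\<close>
  have "h (M.K.single x (m x)) = N.K.single x (h m x)"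
    unfolding M.tact_idem[OF m x, symmetric] tmod_hom_tact[OF m M.idem_closed[OF x]]
    by (rule N.tact_idem[OF tmod_hom_closed[OF m] x])
  then show "sum_map (family_of h) m x = h m x"
    by (simp add: sum_map_def family_of_def x sum_single_same)
qed

end

lemma family_of_sum_map:
  assumes "natural_family \<phi>" "x \<in> Ob" "m \<in> carrier (K x)"
  shows "family_of (sum_map \<phi>) x m = \<phi> x m"
  unfolding family_of_def sum_map_single[OF assms] by (rule sum_single_same[OF assms(2)])

end

section \<open>Decomposition of a module over the algebra by orthogonal idempotents\<close>

locale graded_algebra_module =
  graded_category Ob I H s t ic mc iu un + right_module alg M
  for Ob :: "'p set" and I :: "'q set" and H :: "'q \<Rightarrow> 'f monoid" and s t :: "'q \<Rightarrow> 'p"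
    and ic :: "'q \<Rightarrow> 'q \<Rightarrow> 'q" and mc :: "'q \<Rightarrow> 'f \<Rightarrow> 'q \<Rightarrow> 'f \<Rightarrow> 'f"
    and iu :: "'p \<Rightarrow> 'q" and un :: "'p \<Rightarrow> 'f" and M :: "('q \<Rightarrow> 'f, 'u) rmod"
begin

text \<open>The image of an idempotent is described by its fixed points. It is a subgroup of
  \<open>M\<close>, so its elements still lie in \<open>'u\<close> and the parts are objects of
  \<open>Ab\<close> without any transport.\<close>

definition part :: "'p \<Rightarrow> 'u monoid" where
  "part x = \<lparr>carrier = {m \<in> carrier M. m \<star>\<^bsub>M\<^esub> idem x = m}, monoid.mult = monoid.mult M, one = \<one>\<^bsub>M\<^esub>\<rparr>"

definition part_act :: "'q \<Rightarrow> 'f \<Rightarrow> 'u \<Rightarrow> 'u" where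
  "part_act q f m = m \<star>\<^bsub>M\<^esub> single q f"

lemma act_hom: "m \<in> carrier M \<Longrightarrow> act M m \<in> hom (sum_group I H) M"
  by (rule homI) (simp_all only: act_closed alg_simps act_add_right[unfolded alg_simps])

lemma act_hom_left: "u \<in> carrier (sum_group I H) \<Longrightarrow> (\<lambda>m. m \<star>\<^bsub>M\<^esub> u) \<in> hom M M"
  by (rule homI) (simp_all only: act_closed alg_simps act_add_left)

lemma act_amult: "\<lbrakk>m \<in> carrier M; v \<in> carrier (sum_group I H); u \<in> carrier (sum_group I H)\<rbrakk>
    \<Longrightarrow> m \<star>\<^bsub>M\<^esub> v \<star>\<^bsub>M\<^esub> u = m \<star>\<^bsub>M\<^esub> amult v u"
  using act_mult[of m v u] by (simp only: alg_simps)

lemma act_zero: "m \<in> carrier M \<Longrightarrow> m \<star>\<^bsub>M\<^esub> \<one>\<^bsub>sum_group I H\<^esub> = \<one>\<^bsub>M\<^esub>"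
  by (rule hom_one[OF act_hom comm_group.axioms(2)[OF comm_group_S] M.is_group])

lemma act_carrier: "\<lbrakk>m \<in> carrier M; u \<in> carrier (sum_group I H)\<rbrakk> \<Longrightarrow> m \<star>\<^bsub>M\<^esub> u \<in> carrier M"
  by (rule hom_in_carrier[OF act_hom])

lemma idem_amult_idem:
  "\<lbrakk>x \<in> Ob; y \<in> Ob\<rbrakk> \<Longrightarrow> amult (idem x) (idem y) = (if x = y then idem y else \<one>\<^bsub>sum_group I H\<^esub>)"
  using idem_amult_single[of x "iu y" "un y"] iu_I[of y] un_H[of y] t_iu[of y]
  by (simp only: idem_def)

lemma part_simps:
  "m \<in> carrier (part x) \<longleftrightarrow> m \<in> carrier M \<and> m \<star>\<^bsub>M\<^esub> idem x = m"
  "monoid.mult (part x) = monoid.mult M" "\<one>\<^bsub>part x\<^esub> = \<one>\<^bsub>M\<^esub>"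
  by (simp_all add: part_def)

lemma act_idem_part: "\<lbrakk>m \<in> carrier M; x \<in> Ob\<rbrakk> \<Longrightarrow> m \<star>\<^bsub>M\<^esub> idem x \<in> carrier (part x)"
  by (simp only: part_simps act_amult idem_closed idem_amult_idem if_True simp_thms act_carrier)

text \<open>Orthogonality of the idempotents: an element fixed by \<open>idem x\<close> is
  annihilated by all others.\<close>

lemma part_act_idem:
  "\<lbrakk>x \<in> Ob; y \<in> Ob; m \<in> carrier (part x)\<rbrakk> \<Longrightarrow> m \<star>\<^bsub>M\<^esub> idem y = (if x = y then m else \<one>\<^bsub>M\<^esub>)"
  using act_amult[of m "idem x" "idem y"] idem_closed[of x] idem_closed[of y]
    idem_amult_idem[of x y] act_zero[of m]
  by (cases "x = y") (simp_all only: part_simps simp_thms if_True if_False)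

lemma comm_group_part:
  assumes x: "x \<in> Ob"
  shows "comm_group (part x)"
proof (rule comm_groupI)
  note h = act_hom_left[OF idem_closed[OF x]]
  fix m assume "m \<in> carrier (part x)"
  then have m: "m \<in> carrier M" "m \<star>\<^bsub>M\<^esub> idem x = m" by (simp_all only: part_simps)
  interpret h: group_hom M M "\<lambda>m. m \<star>\<^bsub>M\<^esub> idem x"
    using h by unfold_locales
  have "(inv\<^bsub>M\<^esub> m) \<star>\<^bsub>M\<^esub> idem x = inv\<^bsub>M\<^esub> m"
    using h.hom_inv[OF m(1)] by (simp only: m(2))
  then show "\<exists>y\<in>carrier (part x). y \<otimes>\<^bsub>part x\<^esub> m = \<one>\<^bsub>part x\<^esub>"
    using m by (intro bexI[of _ "inv\<^bsub>M\<^esub> m"]) (simp_all add: part_simps)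
next
  show "\<one>\<^bsub>part x\<^esub> \<in> carrier (part x)"
    using hom_one[OF act_hom_left[OF idem_closed[OF x]] M.is_group M.is_group]
    by (simp add: part_simps)
qed (use idem_closed[OF x] in \<open>simp_all add: part_simps M.m_ac hom_mult[OF act_hom_left]\<close>)

text \<open>A generator absorbs the idempotent of its source from the right. The element
  \<open>m\<close> is arbitrary here, since only the source of the generator decides where the
  result lies.\<close>

lemma part_act_closed:
  assumes q: "q \<in> I" and f: "f \<in> carrier (H q)" and m: "m \<in> carrier M"
  shows "m \<star>\<^bsub>M\<^esub> single q f \<in> carrier (part (s q))"
  using act_amult[OF m single_closed[OF q f] idem_closed[OF s_ob[OF q]]]
    single_amult_idem[OF s_ob[OF q] q f] act_carrier[OF m single_closed[OF q f]]
  by (simp add: part_simps)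

lemma graded_module_part: "graded_module Ob I H s t ic mc iu un part part_act"
proof (intro graded_module.intro graded_module_axioms.intro graded_category_axioms comm_group_part)
  fix q f assume q: "q \<in> I" and f: "f \<in> carrier (H q)"
  show "part_act q f \<in> hom (part (t q)) (part (s q))"
    unfolding part_act_def using hom_mult[OF act_hom_left[OF single_closed[OF q f]]]
        part_act_closed[OF q f]
    by (intro homI) (simp_all only: part_simps)
next
  fix q m assume q: "q \<in> I" and m: "m \<in> carrier (part (t q))"
  then have m: "m \<in> carrier M" by (simp only: part_simps)
  show "(\<lambda>f. part_act q f m) \<in> hom (H q) (part (s q))"
    unfolding part_act_def using hom_mult[OF hom_comp[OF single_hom[OF q] act_hom[OF m]]]
        part_act_closed[OF q _ m]
    by (intro homI) (simp_all only: part_simps)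
next
  fix q p f g m assume *: "q \<in> I" "p \<in> I" "s q = t p" "g \<in> carrier (H q)" "f \<in> carrier (H p)"
    and m: "m \<in> carrier (part (t q))"
  then have m: "m \<in> carrier M" by (simp only: part_simps)
  show "part_act (ic q p) (mc q g p f) m = part_act p f (part_act q g m)"
    unfolding part_act_def act_amult[OF m single_closed[OF *(1,4)] single_closed[OF *(2,5)]]
      amult_single[OF *(1,4) *(2,5)] elem_mult_def by (simp only: *(3) simp_thms if_True)
next
  fix x m assume "m \<in> carrier (part x)"
  then show "part_act (iu x) (un x) m = m"
    by (simp only: part_simps part_act_def idem_def[symmetric])
qed

end

text \<open>In the application, \<open>K\<close> and \<open>\<alpha>\<close> come from a module over
  the representation built out of the parts. Its action agrees with \<open>part_act\<close> on the
  relevant carriers only, which is why the agreement is stated with side conditions.\<close>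

locale graded_algebra_module_parts =
  A: graded_algebra_module Ob I H s t ic mc iu un M + N: graded_module Ob I H s t ic mc iu un K \<alpha>
  for Ob :: "'p set" and I :: "'q set" and H :: "'q \<Rightarrow> 'f monoid" and s t :: "'q \<Rightarrow> 'p"
    and ic :: "'q \<Rightarrow> 'q \<Rightarrow> 'q" and mc :: "'q \<Rightarrow> 'f \<Rightarrow> 'q \<Rightarrow> 'f \<Rightarrow> 'f"
    and iu :: "'p \<Rightarrow> 'q" and un :: "'p \<Rightarrow> 'f" and M :: "('q \<Rightarrow> 'f, 'u) rmod"
    and K :: "'p \<Rightarrow> 'u monoid" and \<alpha> :: "'q \<Rightarrow> 'f \<Rightarrow> 'u \<Rightarrow> 'u" +
  assumes K_part: "x \<in> Ob \<Longrightarrow> K x = A.part x"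
    and \<alpha>_part: "\<lbrakk>q \<in> I; f \<in> carrier (H q); m \<in> carrier (K (t q))\<rbrakk> \<Longrightarrow> \<alpha> q f m = A.part_act q f m"
begin

definition decompose :: "'u \<Rightarrow> 'p \<Rightarrow> 'u" where
  "decompose m = (\<lambda>x\<in>Ob. m \<star>\<^bsub>M\<^esub> A.idem x)"

lemma decompose_closed: "m \<in> carrier M \<Longrightarrow> decompose m \<in> carrier N.K.S"
  using A.act_idem_part A.finite_Ob by (auto simp: decompose_def N.K.carrier_S K_part)

lemma decompose_hom: "decompose \<in> hom M N.K.S"
proof (rule homI)
  fix m n assume m: "m \<in> carrier M" and n: "n \<in> carrier M"
  note mn = A.M.m_closed[OF m n]
  show "decompose (m \<otimes>\<^bsub>M\<^esub> n) = decompose m \<otimes>\<^bsub>N.K.S\<^esub> decompose n"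
  proof (rule N.K.S_eqI)
    fix x assume x: "x \<in> Ob"
    show "decompose (m \<otimes>\<^bsub>M\<^esub> n) x = (decompose m \<otimes>\<^bsub>N.K.S\<^esub> decompose n) x"
      unfolding N.K.mult_apply[OF x]
      using hom_mult[OF A.act_hom_left[OF A.idem_closed[OF x]] m n]
      by (simp add: decompose_def x K_part A.part_simps)
  qed (rule decompose_closed[OF mn]
        N.K.S.m_closed[OF decompose_closed[OF m] decompose_closed[OF n]])+
qed (rule decompose_closed)

lemma rmod_hom_decompose: "rmod_hom A.alg M N.tmod decompose"
proof -
  have "decompose (m \<star>\<^bsub>M\<^esub> u) = N.tact (decompose m) u"
    if m: "m \<in> carrier M" and u: "u \<in> carrier A.S" for m u
  proof (rule A.hom_eqI[OF u N.K.S.is_group hom_comp[OF A.act_hom[OF m] decompose_hom]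
        N.tact_hom_right[OF decompose_closed[OF m]]])
    fix q f assume q: "q \<in> I" and f: "f \<in> carrier (H q)"
    note qf = A.single_closed[OF q f] and sq = A.s_ob[OF q] and tq = A.t_ob[OF q]
    have mt: "m \<star>\<^bsub>M\<^esub> A.idem (t q) \<in> carrier (K (t q))"
      using A.act_idem_part[OF m tq] by (simp only: K_part[OF tq])
    have "\<alpha> q f (decompose m (t q)) = m \<star>\<^bsub>M\<^esub> A.idem (t q) \<star>\<^bsub>M\<^esub> A.single q f"
      using \<alpha>_part[OF q f mt] tq by (simp add: decompose_def A.part_act_def)
    also have "\<dots> = m \<star>\<^bsub>M\<^esub> A.single q f"
      unfolding A.act_amult[OF m A.idem_closed[OF tq] qf]
      by (simp only: A.idem_amult_single[OF tq q f] simp_thms if_True)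
    finally have R: "N.tact (decompose m) (A.single q f) = N.K.single (s q) (m \<star>\<^bsub>M\<^esub> A.single q f)"
      unfolding N.tact_single[OF decompose_closed[OF m] q f] by (simp only:)
    show "decompose (m \<star>\<^bsub>M\<^esub> A.single q f) = N.tact (decompose m) (A.single q f)"
      unfolding R
    proof
      fix x
      show "decompose (m \<star>\<^bsub>M\<^esub> A.single q f) x = N.K.single (s q) (m \<star>\<^bsub>M\<^esub> A.single q f) x"
        \<comment> \<open>The element acted on by the generator already lies in the part at
          \<open>s q\<close>, so the other idempotents annihilate it and its decomposition is
          concentrated at \<open>s q\<close>.\<close>
        using A.part_act_idem[OF sq _ A.part_act_closed[OF q f m], of x]
        by (auto simp add: decompose_def sum_single_def K_part A.part_simps)
    qed
  qed
  then show ?thesis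
    using decompose_hom unfolding rmod_hom_def hom_def N.tmod_simps A.alg_simps by blast
qed

lemma act_sum_idem:
  assumes m: "m \<in> carrier M"
  shows "finprod M (\<lambda>x. m \<star>\<^bsub>M\<^esub> A.idem x) Ob = m"
proof -
  have "m \<star>\<^bsub>M\<^esub> A.aone = finprod M (\<lambda>x. m \<star>\<^bsub>M\<^esub> A.idem x) Ob"
    unfolding A.aone_def using A.idem_closed
    by (intro hom_finprod[OF A.comm_group_S A.M.comm_group_axioms A.act_hom[OF m] _ A.finite_Ob])
        blast
  then show ?thesis
    using A.act_one[OF m] by (simp only: A.alg_simps)
qed

text \<open>The idempotents sum to the identity element, so an element is the sum of its components;
  this gives injectivity. The preimage of a tuple is the sum of its entries in \<open>M\<close>, and
  orthogonality returns the entries.\<close>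

lemma bij_betw_decompose: "bij_betw decompose (carrier M) (carrier N.tmod)"
  unfolding N.tmod_simps bij_betw_def
proof (intro conjI equalityI subsetI)
  show "inj_on decompose (carrier M)"
  proof (rule inj_onI)
    fix m n assume m: "m \<in> carrier M" and n: "n \<in> carrier M" and eq: "decompose m = decompose n"
    have "m \<star>\<^bsub>M\<^esub> A.idem x = n \<star>\<^bsub>M\<^esub> A.idem x" if "x \<in> Ob" for x
      using fun_cong[OF eq, of x] that by (simp add: decompose_def)
    then have "finprod M (\<lambda>x. m \<star>\<^bsub>M\<^esub> A.idem x) Ob = finprod M (\<lambda>x. n \<star>\<^bsub>M\<^esub> A.idem x) Ob"
      using A.act_carrier[OF n A.idem_closed] by (intro A.M.finprod_cong') auto
    then show "m = n"
      by (simp only: act_sum_idem[OF m] act_sum_idem[OF n])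
  qed
  show "n \<in> carrier N.K.S" if "n \<in> decompose ` carrier M" for n
    using that decompose_closed by blast
  fix n assume n: "n \<in> carrier N.K.S"
  have part: "n x \<in> carrier (A.part x)" if "x \<in> Ob" for x
    using N.K.S_component[OF n that] by (simp only: K_part[OF that])
  then have nM: "n \<in> Ob \<rightarrow> carrier M"
    by (auto simp: A.part_simps)
  define m where "m = finprod M n Ob"
  have m: "m \<in> carrier M"
    unfolding m_def by (rule A.M.finprod_closed[OF nM])
  have "decompose m = n"
  proof (rule N.K.S_eqI[OF decompose_closed[OF m] n])
    fix x assume x: "x \<in> Ob"
    have "m \<star>\<^bsub>M\<^esub> A.idem x = finprod M (\<lambda>y. n y \<star>\<^bsub>M\<^esub> A.idem x) Ob"
      unfolding m_def
      by (rule hom_finprod[OF A.M.comm_group_axioms A.M.comm_group_axioms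
            A.act_hom_left[OF A.idem_closed[OF x]] nM A.finite_Ob])
    also have "\<dots> = finprod M (\<lambda>y. if x = y then n y else \<one>\<^bsub>M\<^esub>) Ob"
      using A.part_act_idem[OF _ x part] nM by (intro A.M.finprod_cong') auto
    also have "\<dots> = n x"
      by (rule A.M.finprod_singleton[OF x A.finite_Ob nM])
    finally show "decompose m x = n x"
      by (simp add: decompose_def x)
  qed
  then show "n \<in> decompose ` carrier M"
    using m by blast
qed

end

section \<open>The Grothendieck construction of a representation\<close>

context category
begin

text \<open>Used to invert the two sides of the coherence laws for \<open>\<mu>\<close> and
  \<open>\<delta>\<close>, which are composites of two arrows each.\<close>

lemma cmp_inverses:
  assumes f: "f \<in> homset C x y" "f' \<in> homset C y x" "f' \<cdot> f = idn C x"
    and g: "g \<in> homset C y z" "g' \<in> homset C z y" "g' \<cdot> g = idn C y"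
  shows "(f' \<cdot> g') \<cdot> (g \<cdot> f) = idn C x"
proof -
  have "(f' \<cdot> g') \<cdot> (g \<cdot> f) = ((f' \<cdot> g') \<cdot> g) \<cdot> f"
    by (rule cmp_assoc[OF f(1) g(1) cmp_homset[OF g(2) f(2)]])
  also have "(f' \<cdot> g') \<cdot> g = f' \<cdot> (g' \<cdot> g)"
    by (rule cmp_assoc[OF g(1,2) f(2), symmetric])
  also have "\<dots> \<cdot> f = idn C x"
    by (simp only: g(3) cmp_idn[OF f(2)] f(3))
  finally show ?thesis .
qed

lemma inverses_eq:
  assumes "e \<in> homset C x y" "g \<in> homset C y x" "h \<in> homset C y x"
    and "g \<cdot> e = idn C x" "e \<cdot> h = idn C y"
  shows "g = h"
proof -
  have "g = g \<cdot> (e \<cdot> h)"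
    by (simp only: assms(5) cmp_idn[OF assms(2)])
  also have "\<dots> = (g \<cdot> e) \<cdot> h"
    by (rule cmp_assoc[OF assms(3,1,2)])
  also have "\<dots> = h"
    by (simp only: assms(4) idn_cmp[OF assms(3)])
  finally show ?thesis .
qed

end

text \<open>Gives naturality of \<open>\<eta>\<close> and \<open>\<theta>\<close>, which are defined
  only componentwise as inverses.\<close>

lemma (in nat_isom) inv_natural:
  assumes f: "f \<in> homset A x y"
  shows "inv_arr B (t y) \<cdot>\<^bsub>B\<^esub> farr G f = farr F f \<cdot>\<^bsub>B\<^esub> inv_arr B (t x)"
proof -
  have x: "x \<in> obj A" and y: "y \<in> obj A"
    using F.A.homset_obj[OF f] by auto
  note tx = F.B.inv_arr[OF component[OF x] component_iso[OF x]]
    and ty = F.B.inv_arr[OF component[OF y] component_iso[OF y]]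
    and Ff = F.farr_homset[OF f] and Gf = G.farr_homset[OF f]
  note Ft = F.B.cmp_homset[OF tx(1) Ff]
  have "inv_arr B (t y) \<cdot>\<^bsub>B\<^esub> farr G f = inv_arr B (t y) \<cdot>\<^bsub>B\<^esub> (farr G f \<cdot>\<^bsub>B\<^esub> (t x \<cdot>\<^bsub>B\<^esub> inv_arr B (t x)))"
    by (simp only: tx(3) F.B.cmp_idn[OF Gf])
  also have "\<dots> = inv_arr B (t y) \<cdot>\<^bsub>B\<^esub> ((farr G f \<cdot>\<^bsub>B\<^esub> t x) \<cdot>\<^bsub>B\<^esub> inv_arr B (t x))"
    by (simp only: F.B.cmp_assoc[OF tx(1) component[OF x] Gf])
  also have "\<dots> = inv_arr B (t y) \<cdot>\<^bsub>B\<^esub> (t y \<cdot>\<^bsub>B\<^esub> (farr F f \<cdot>\<^bsub>B\<^esub> inv_arr B (t x)))"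
    by (simp only: natural[OF f, symmetric] F.B.cmp_assoc[OF tx(1) Ff component[OF y]])
  also have "\<dots> = farr F f \<cdot>\<^bsub>B\<^esub> inv_arr B (t x)"
    by (simp only: F.B.cmp_assoc[OF Ft component[OF y] ty(1)] ty(2) F.B.idn_cmp[OF Ft])
  finally show ?thesis .
qed

section \<open>Laws of the inverse structure maps of a representation\<close>

context representation
begin

lemma rcat_category: "i \<in> obj C \<Longrightarrow> category (rcat R i)"
  by (rule preadditive.axioms(1)[OF rcat_preadditive])

lemma rfun_functor: "a \<in> homset C i j \<Longrightarrow> cat_functor (rcat R i) (rcat R j) (rfun R a)"
  by (rule additive_functor.axioms(3)[OF rfun_additive])

lemmas rfun_obj = cat_functor.fobj_obj[OF rfun_functor]
  and rfun_homset = cat_functor.farr_homset[OF rfun_functor]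
  and rfun_idn = cat_functor.farr_idn[OF rfun_functor]
  and rfun_cmp = cat_functor.farr_cmp[OF rfun_functor]
  and rfun_padd = additive_functor.farr_padd[OF rfun_additive]

lemmas delta_transf = nat_isom.axioms(1)[OF delta_isom]
  and mu_transf = nat_isom.axioms(1)[OF mu_isom]

lemma delta_homset: "\<lbrakk>i \<in> obj C; x \<in> obj (rcat R i)\<rbrakk>
    \<Longrightarrow> delta R i x \<in> homset (rcat R i) x (fobj (rfun R (idn C i)) x)"
  using nat_transf.component[OF delta_transf] by (simp add: id_fctr_def)

lemma mu_homset: "\<lbrakk>a \<in> homset C i j; b \<in> homset C j k; x \<in> obj (rcat R i)\<rbrakk>
    \<Longrightarrow> mu R b a x \<in> homset (rcat R k) (fobj (rfun R b) (fobj (rfun R a) x))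
        (fobj (rfun R (b \<cdot> a)) x)"
  using nat_transf.component[OF mu_transf] by (simp add: comp_fctr_def)

lemma eta_delta:
  assumes "i \<in> obj C" "x \<in> obj (rcat R i)"
  shows "eta R i x \<in> homset (rcat R i) (fobj (rfun R (idn C i)) x) x"
    "eta R i x \<cdot>\<^bsub>rcat R i\<^esub> delta R i x = idn (rcat R i) x"
    "delta R i x \<cdot>\<^bsub>rcat R i\<^esub> eta R i x = idn (rcat R i) (fobj (rfun R (idn C i)) x)"
  unfolding eta_def
  by (rule category.inv_arr[OF rcat_category[OF assms(1)] delta_homset[OF assms]
        nat_isom.component_iso[OF delta_isom[OF assms(1)] assms(2)]])+

lemma eta_natural:
  "\<lbrakk>i \<in> obj C; f \<in> homset (rcat R i) x y\<rbrakk>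
    \<Longrightarrow> eta R i y \<cdot>\<^bsub>rcat R i\<^esub> farr (rfun R (idn C i)) f = f \<cdot>\<^bsub>rcat R i\<^esub> eta R i x"
  unfolding eta_def using nat_isom.inv_natural[OF delta_isom] by (simp add: id_fctr_def)

lemma theta_mu:
  assumes a: "a \<in> homset C i j" and b: "b \<in> homset C j k" and x: "x \<in> obj (rcat R i)"
  shows "theta C R b a x \<in> homset (rcat R k) (fobj (rfun R (b \<cdot> a)) x)
      (fobj (rfun R b) (fobj (rfun R a) x))"
    "theta C R b a x \<cdot>\<^bsub>rcat R k\<^esub> mu R b a x = idn (rcat R k) (fobj (rfun R b) (fobj (rfun R a) x))"
    "mu R b a x \<cdot>\<^bsub>rcat R k\<^esub> theta C R b a x = idn (rcat R k) (fobj (rfun R (b \<cdot> a)) x)"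
  unfolding theta_def homsetD(3)[OF b]
  by (rule category.inv_arr[OF rcat_category[OF homset_obj(2)[OF b]] mu_homset[OF a b x]
        nat_isom.component_iso[OF mu_isom[OF a b] x]])+

lemma theta_natural:
  assumes a: "a \<in> homset C i j" and b: "b \<in> homset C j k" and f: "f \<in> homset (rcat R i) x y"
  shows "theta C R b a y \<cdot>\<^bsub>rcat R k\<^esub> farr (rfun R (b \<cdot> a)) f =
    farr (rfun R b) (farr (rfun R a) f) \<cdot>\<^bsub>rcat R k\<^esub> theta C R b a x"
  using nat_isom.inv_natural[OF mu_isom[OF a b] f]
  by (simp add: theta_def homsetD(3)[OF b] comp_fctr_def)

text \<open>(Rep.1) inverted. The left-hand side is a left inverse of one side of (Rep.1), the
  right-hand side a right inverse of the other side. These being the same arrow, the two inverses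
  agree.\<close>

lemma theta_assoc:
  assumes a: "a \<in> homset C i j" and b: "b \<in> homset C j k" and c: "c \<in> homset C k h"
    and x: "x \<in> obj (rcat R i)"
  shows "farr (rfun R c) (theta C R b a x) \<cdot>\<^bsub>rcat R h\<^esub> theta C R c (b \<cdot> a) x =
    theta C R c b (fobj (rfun R a) x) \<cdot>\<^bsub>rcat R h\<^esub> theta C R (c \<cdot> b) a x"
proof -
  interpret H: category "rcat R h" by (rule rcat_category[OF homset_obj(2)[OF c]])
  note ba = cmp_homset[OF a b] and cb = cmp_homset[OF b c] and ax = rfun_obj[OF a x]
  have cba: "c \<cdot> b \<cdot> a = c \<cdot> (b \<cdot> a)" by (rule cmp_assoc[OF a b c, symmetric])
  note Rmu = rfun_homset[OF c mu_homset[OF a b x]] and Rtheta =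
      rfun_homset[OF c theta_mu(1)[OF a b x]]
  have Rmu_Rtheta: "farr (rfun R c) (theta C R b a x) \<cdot>\<^bsub>rcat R h\<^esub> farr (rfun R c) (mu R b a x) =
      idn (rcat R h) (fobj (rfun R c) (fobj (rfun R b) (fobj (rfun R a) x)))"
    unfolding rfun_cmp[OF c mu_homset[OF a b x] theta_mu(1)[OF a b x], symmetric]
        theta_mu(2)[OF a b x]
    by (rule rfun_idn[OF c rfun_obj[OF b ax]])
  show ?thesis
  proof (rule H.inverses_eq)
    show "mu R c (b \<cdot> a) x \<cdot>\<^bsub>rcat R h\<^esub> farr (rfun R c) (mu R b a x) \<in> homset (rcat R h)
        (fobj (rfun R c) (fobj (rfun R b) (fobj (rfun R a) x))) (fobj (rfun R (c \<cdot> (b \<cdot> a))) x)"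
      by (rule H.cmp_homset[OF Rmu mu_homset[OF ba c x]])
    show "farr (rfun R c) (theta C R b a x) \<cdot>\<^bsub>rcat R h\<^esub> theta C R c (b \<cdot> a) x \<in> homset (rcat R h)
        (fobj (rfun R (c \<cdot> (b \<cdot> a))) x) (fobj (rfun R c) (fobj (rfun R b) (fobj (rfun R a) x)))"
      by (rule H.cmp_homset[OF theta_mu(1)[OF ba c x] Rtheta])
    show "theta C R c b (fobj (rfun R a) x) \<cdot>\<^bsub>rcat R h\<^esub> theta C R (c \<cdot> b) a x \<in> homset (rcat R h)
        (fobj (rfun R (c \<cdot> (b \<cdot> a))) x) (fobj (rfun R c) (fobj (rfun R b) (fobj (rfun R a) x)))"
      using H.cmp_homset[OF theta_mu(1)[OF a cb x] theta_mu(1)[OF b c ax]] by (simp only: cba)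
    show "(farr (rfun R c) (theta C R b a x) \<cdot>\<^bsub>rcat R h\<^esub> theta C R c (b \<cdot> a) x) \<cdot>\<^bsub>rcat R h\<^esub>
        (mu R c (b \<cdot> a) x \<cdot>\<^bsub>rcat R h\<^esub> farr (rfun R c) (mu R b a x)) =
        idn (rcat R h) (fobj (rfun R c) (fobj (rfun R b) (fobj (rfun R a) x)))"
      by (rule H.cmp_inverses[OF Rmu Rtheta Rmu_Rtheta mu_homset[OF ba c x]
          theta_mu(1,2)[OF ba c x]])
    show "(mu R c (b \<cdot> a) x \<cdot>\<^bsub>rcat R h\<^esub> farr (rfun R c) (mu R b a x)) \<cdot>\<^bsub>rcat R h\<^esub>
        (theta C R c b (fobj (rfun R a) x) \<cdot>\<^bsub>rcat R h\<^esub> theta C R (c \<cdot> b) a x) =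
        idn (rcat R h) (fobj (rfun R (c \<cdot> (b \<cdot> a))) x)"
      unfolding mu_assoc[OF a b c x] cba[symmetric]
      by (rule H.cmp_inverses[OF theta_mu(1)[OF a cb x] mu_homset[OF a cb x] theta_mu(3)[OF a cb x]
            theta_mu(1)[OF b c ax] mu_homset[OF b c ax] theta_mu(3)[OF b c ax]])
  qed
qed

text \<open>One half of (Rep.2) inverted: the left-hand side is a left inverse of a composite that
  (Rep.2) says is the identity. \<open>eta_theta_left\<close> is the other half.\<close>

lemma eta_theta_right:
  assumes a: "a \<in> homset C i j" and x: "x \<in> obj (rcat R i)"
  shows "farr (rfun R a) (eta R i x) \<cdot>\<^bsub>rcat R j\<^esub> theta C R a (idn C i) x =
    idn (rcat R j) (fobj (rfun R a) x)"
proof -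
  have i: "i \<in> obj C" and j: "j \<in> obj C" using homset_obj[OF a] by auto
  interpret J: category "rcat R j" by (rule rcat_category[OF j])
  note one = idn_homset[OF i]
  note Rdelta = rfun_homset[OF a delta_homset[OF i x]] and Reta =
      rfun_homset[OF a eta_delta(1)[OF i x]]
  have "farr (rfun R a) (eta R i x) \<cdot>\<^bsub>rcat R j\<^esub> farr (rfun R a) (delta R i x) =
      idn (rcat R j) (fobj (rfun R a) x)"
    unfolding rfun_cmp[OF a delta_homset[OF i x] eta_delta(1)[OF i x], symmetric]
        eta_delta(2)[OF i x]
    by (rule rfun_idn[OF a x])
  from J.cmp_inverses[OF Rdelta Reta this mu_homset[OF one a x] theta_mu(1,2)[OF one a x]]
  show ?thesis
    using J.cmp_idn[OF J.cmp_homset[OF theta_mu(1)[OF one a x] Reta]]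
    by (simp only: mu_delta_right[OF a x] cmp_idn[OF a])
qed

lemma eta_theta_left:
  assumes a: "a \<in> homset C i j" and x: "x \<in> obj (rcat R i)"
  shows "eta R j (fobj (rfun R a) x) \<cdot>\<^bsub>rcat R j\<^esub> theta C R (idn C j) a x =
    idn (rcat R j) (fobj (rfun R a) x)"
proof -
  have j: "j \<in> obj C" using homset_obj[OF a] by auto
  interpret J: category "rcat R j" by (rule rcat_category[OF j])
  note one = idn_homset[OF j] and ax = rfun_obj[OF a x]
  from J.cmp_inverses[OF delta_homset[OF j ax] eta_delta(1,2)[OF j ax] mu_homset[OF a one x]
      theta_mu(1,2)[OF a one x]]
  show ?thesis
    using J.cmp_idn[OF J.cmp_homset[OF theta_mu(1)[OF a one x] eta_delta(1)[OF j ax]]]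
    by (simp only: mu_delta_left[OF a x] idn_cmp[OF a])
qed

section \<open>Composition in the Grothendieck construction\<close>

definition gcmp :: "'c \<Rightarrow> 'f \<Rightarrow> 'c \<Rightarrow> 'x \<Rightarrow> 'f \<Rightarrow> 'f" where
  "gcmp b g a x f =
    g \<cdot>\<^bsub>rcat R (tgt C b)\<^esub> farr (rfun R b) f \<cdot>\<^bsub>rcat R (tgt C b)\<^esub> theta C R b a x"

context
  fixes a b i j k x y z g f
  assumes a: "a \<in> homset C i j" and b: "b \<in> homset C j k" and x: "x \<in> obj (rcat R i)"
    and f: "f \<in> homset (rcat R j) (fobj (rfun R a) x) y"
    and g: "g \<in> homset (rcat R k) (fobj (rfun R b) y) z"
begin

interpretation K: category "rcat R k" by (rule rcat_category[OF homset_obj(2)[OF b]])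

lemma gcmp_eq: "gcmp b g a x f = g \<cdot>\<^bsub>rcat R k\<^esub> (farr (rfun R b) f \<cdot>\<^bsub>rcat R k\<^esub> theta C R b a x)"
  unfolding gcmp_def homsetD(3)[OF b]
  by (rule K.cmp_assoc[OF theta_mu(1)[OF a b x] rfun_homset[OF b f] g, symmetric])

lemma gcmp_homset: "gcmp b g a x f \<in> homset (rcat R k) (fobj (rfun R (b \<cdot> a)) x) z"
  unfolding gcmp_eq
  by (rule K.cmp_homset[OF K.cmp_homset[OF theta_mu(1)[OF a b x] rfun_homset[OF b f]] g])

text \<open>After expansion by functoriality of \<open>R(c)\<close>, both sides differ only in how
  \<open>R(cba)x\<close> is taken apart and in where \<open>f\<close> is inserted. The first is
  \<open>theta_assoc\<close>, the second naturality of \<open>\<theta>\<close> for \<open>c\<close>,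
  \<open>b\<close> at \<open>f\<close>.\<close>

lemma gcmp_assoc:
  assumes c: "c \<in> homset C k l" and h: "h \<in> homset (rcat R l) (fobj (rfun R c) z) w"
  shows "gcmp c h (b \<cdot> a) x (gcmp b g a x f) = gcmp (c \<cdot> b) (gcmp c h b y g) a x f"
proof -
  interpret L: category "rcat R l" by (rule rcat_category[OF homset_obj(2)[OF c]])
  interpret J: category "rcat R j" by (rule rcat_category[OF homset_obj(2)[OF a]])
  note ba = cmp_homset[OF a b] and cb = cmp_homset[OF b c] and y = J.homset_obj(2)[OF f]
  note th = theta_mu(1)[OF a b x] and Rf = rfun_homset[OF b f]
  let ?c = "farr (rfun R c)"
  note T1 = theta_mu(1)[OF ba c x] and T2 = theta_mu(1)[OF a cb x] and T3 = theta_mu(1)[OF b c y]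
    and T4 = theta_mu(1)[OF b c rfun_obj[OF a x]]
  have cth: "?c (theta C R b a x) \<in> homset (rcat R l) (fobj (rfun R c) (fobj (rfun R (b \<cdot> a)) x))
      (fobj (rfun R c) (fobj (rfun R b) (fobj (rfun R a) x)))" by (rule rfun_homset[OF c th])
  have cRf: "?c (farr (rfun R b) f) \<in> homset (rcat R l)
      (fobj (rfun R c) (fobj (rfun R b) (fobj (rfun R a) x)))
      (fobj (rfun R c) (fobj (rfun R b) y))" by (rule rfun_homset[OF c Rf])
  have cg: "?c g \<in> homset (rcat R l) (fobj (rfun R c) (fobj (rfun R b) y)) (fobj (rfun R c) z)"
    by (rule rfun_homset[OF c g])
  have cbf: "farr (rfun R (c \<cdot> b)) f \<in> homset (rcat R l) (fobj (rfun R (c \<cdot> b)) (fobj (rfun R a) x))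
      (fobj (rfun R (c \<cdot> b)) y)" by (rule rfun_homset[OF cb f])
  have assoc: "c \<cdot> (b \<cdot> a) = c \<cdot> b \<cdot> a" by (rule cmp_assoc[OF a b c])
  let ?m = "(\<cdot>\<^bsub>rcat R l\<^esub>)"
  have "gcmp c h (b \<cdot> a) x (gcmp b g a x f) =
      ?m h (?m (?m (?c g) (?m (?c (farr (rfun R b) f)) (?c (theta C R b a x))))
          (theta C R c (b \<cdot> a) x))"
  proof -
    have "?c (gcmp b g a x f) = ?m (?c g) (?m (?c (farr (rfun R b) f)) (?c (theta C R b a x)))"
      unfolding gcmp_eq
      by (simp only: rfun_cmp[OF c K.cmp_homset[OF th Rf] g] rfun_cmp[OF c th Rf])
    then show ?thesis
      unfolding gcmp_def[of c] homsetD(3)[OF c]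
      using L.cmp_assoc[OF T1 rfun_homset[OF c gcmp_homset] h] by simp
  qed
  also have "\<dots> = ?m h (?m (?c g) (?m (?c (farr (rfun R b) f))
      (?m (?c (theta C R b a x)) (theta C R c (b \<cdot> a) x))))"
    using L.cmp_assoc[OF T1 L.cmp_homset[OF cth cRf] cg] L.cmp_assoc[OF T1 cth cRf] by simp
  also have "?m (?c (theta C R b a x)) (theta C R c (b \<cdot> a) x) =
      ?m (theta C R c b (fobj (rfun R a) x)) (theta C R (c \<cdot> b) a x)"
    by (rule theta_assoc[OF a b c x])
  \<comment> \<open>Naturality of \<open>\<theta>\<close> moves \<open>f\<close> across, turning
    \<open>R(c)R(b)f\<close> into \<open>R(cb)f\<close>, as the other bracketing requires.\<close>
  also have "?m (?c (farr (rfun R b) f)) (?m (theta C R c b (fobj (rfun R a) x))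
      (theta C R (c \<cdot> b) a x)) =
      ?m (theta C R c b y) (?m (farr (rfun R (c \<cdot> b)) f) (theta C R (c \<cdot> b) a x))"
    unfolding L.cmp_assoc[OF T2 T4 cRf] theta_natural[OF b c f, symmetric]
    by (rule L.cmp_assoc[OF T2 cbf T3, symmetric])
  also have "?m h (?m (?c g) (?m (theta C R c b y)
      (?m (farr (rfun R (c \<cdot> b)) f) (theta C R (c \<cdot> b) a x)))) =
      ?m (?m h (?m (?c g) (theta C R c b y)))
          (?m (farr (rfun R (c \<cdot> b)) f) (theta C R (c \<cdot> b) a x))"
    using L.cmp_assoc[OF L.cmp_homset[OF T2 cbf] L.cmp_homset[OF T3 cg] h]
      L.cmp_assoc[OF L.cmp_homset[OF T2 cbf] T3 cg] by simp
  also have "\<dots> = gcmp (c \<cdot> b) (gcmp c h b y g) a x f"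
  proof -
    have hb: "gcmp c h b y g = ?m h (?m (?c g) (theta C R c b y))"
      unfolding gcmp_def homsetD(3)[OF c] by (rule L.cmp_assoc[OF T3 cg h, symmetric])
    have "gcmp c h b y g \<in> homset (rcat R l) (fobj (rfun R (c \<cdot> b)) y) w"
      unfolding hb by (rule L.cmp_homset[OF L.cmp_homset[OF T3 cg] h])
    from L.cmp_assoc[OF T2 cbf this] show ?thesis
      unfolding hb gcmp_def[of "c \<cdot> b"] homsetD(3)[OF cb] .
  qed
  finally show ?thesis .
qed

end

text \<open>An arrow \<open>g\<close> of \<open>R(j)\<close>, put into degree
  \<open>1\<^sub>j\<close> as \<open>g \<circ> \<eta>\<close>, acts by plain composition on the
  left: naturality moves \<open>\<eta>\<close> past \<open>R(1\<^sub>j)f\<close>, where it cancels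
  \<open>\<theta>\<close>. For \<open>f\<close> an identity this is the factorization of a generator
  into its two special kinds.\<close>

lemma gcmp_eta_left:
  assumes a: "a \<in> homset C i j" and x: "x \<in> obj (rcat R i)"
    and f: "f \<in> homset (rcat R j) (fobj (rfun R a) x) y" and g: "g \<in> homset (rcat R j) y z"
  shows "gcmp (idn C j) (g \<cdot>\<^bsub>rcat R j\<^esub> eta R j y) a x f = g \<cdot>\<^bsub>rcat R j\<^esub> f"
proof -
  have j: "j \<in> obj C" using homset_obj[OF a] by auto
  interpret J: category "rcat R j" by (rule rcat_category[OF j])
  note one = idn_homset[OF j] and ax = rfun_obj[OF a x]
  have y: "y \<in> obj (rcat R j)" by (rule J.homset_obj(2)[OF f])
  note eta = eta_delta(1)[OF j y] and Rf = rfun_homset[OF one f] and th = theta_mu(1)[OF a one x]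
  have "gcmp (idn C j) (g \<cdot>\<^bsub>rcat R j\<^esub> eta R j y) a x f =
      (g \<cdot>\<^bsub>rcat R j\<^esub> (eta R j y \<cdot>\<^bsub>rcat R j\<^esub> farr (rfun R (idn C j)) f)) \<cdot>\<^bsub>rcat R j\<^esub> theta C R (idn C j) a
          x"
    unfolding gcmp_def homsetD(3)[OF one] by (simp only: J.cmp_assoc[OF Rf eta g])
  also have "\<dots> = (g \<cdot>\<^bsub>rcat R j\<^esub> f) \<cdot>\<^bsub>rcat R j\<^esub>
      (eta R j (fobj (rfun R a) x) \<cdot>\<^bsub>rcat R j\<^esub> theta C R (idn C j) a x)"
    by (simp only: eta_natural[OF j f] J.cmp_assoc[OF eta_delta(1)[OF j ax] f g]
        J.cmp_assoc[OF th eta_delta(1)[OF j ax] J.cmp_homset[OF f g]])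
  also have "\<dots> = g \<cdot>\<^bsub>rcat R j\<^esub> f"
    by (simp only: eta_theta_left[OF a x] J.cmp_idn[OF J.cmp_homset[OF f g]])
  finally show ?thesis .
qed

text \<open>On the right, an embedded arrow \<open>g\<close> of \<open>R(i)\<close> acts through
  \<open>R(a)g\<close>, because \<open>R(a)\<eta>\<close> cancels \<open>\<theta>\<close>. This
  later gives naturality of \<open>M(a)\<close>.\<close>

lemma gcmp_eta_right:
  assumes a: "a \<in> homset C i j" and f: "f \<in> homset (rcat R j) (fobj (rfun R a) x) y"
    and g: "g \<in> homset (rcat R i) w x"
  shows "gcmp a f (idn C i) w (g \<cdot>\<^bsub>rcat R i\<^esub> eta R i w) = f \<cdot>\<^bsub>rcat R j\<^esub> farr (rfun R a) g"
proof -
  have i: "i \<in> obj C" and j: "j \<in> obj C" using homset_obj[OF a] by auto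
  interpret I: category "rcat R i" by (rule rcat_category[OF i])
  interpret J: category "rcat R j" by (rule rcat_category[OF j])
  have w: "w \<in> obj (rcat R i)" by (rule I.homset_obj(1)[OF g])
  note one = idn_homset[OF i]
  note eta = eta_delta(1)[OF i w] and th = theta_mu(1)[OF one a w]
    and Rg = rfun_homset[OF a g] and Reta = rfun_homset[OF a eta_delta(1)[OF i w]]
  have "gcmp a f (idn C i) w (g \<cdot>\<^bsub>rcat R i\<^esub> eta R i w) = f \<cdot>\<^bsub>rcat R j\<^esub>
      ((farr (rfun R a) g \<cdot>\<^bsub>rcat R j\<^esub> farr (rfun R a) (eta R i w)) \<cdot>\<^bsub>rcat R j\<^esub> theta C R a (idn C i) w)"
    unfolding gcmp_eq[OF one a w I.cmp_homset[OF eta g] f] by (simp only: rfun_cmp[OF a eta g])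
  also have "\<dots> = f \<cdot>\<^bsub>rcat R j\<^esub> farr (rfun R a) g"
    by (simp only: J.cmp_assoc[OF th Reta Rg, symmetric] eta_theta_right[OF a w] J.cmp_idn[OF Rg])
  finally show ?thesis .
qed

lemma gcmp_unit_left:
  assumes a: "a \<in> homset C i j" and x: "x \<in> obj (rcat R i)"
    and f: "f \<in> homset (rcat R j) (fobj (rfun R a) x) y"
  shows "gcmp (idn C j) (eta R j y) a x f = f"
proof -
  have j: "j \<in> obj C" using homset_obj[OF a] by auto
  interpret J: category "rcat R j" by (rule rcat_category[OF j])
  have y: "y \<in> obj (rcat R j)" by (rule J.homset_obj(2)[OF f])
  show ?thesis
    using gcmp_eta_left[OF a x f J.idn_homset[OF y]]
    by (simp only: J.idn_cmp[OF eta_delta(1)[OF j y]] J.idn_cmp[OF f])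
qed

lemma gcmp_unit_right:
  assumes a: "a \<in> homset C i j" and x: "x \<in> obj (rcat R i)"
    and f: "f \<in> homset (rcat R j) (fobj (rfun R a) x) y"
  shows "gcmp a f (idn C i) x (eta R i x) = f"
proof -
  have i: "i \<in> obj C" and j: "j \<in> obj C" using homset_obj[OF a] by auto
  interpret I: category "rcat R i" by (rule rcat_category[OF i])
  interpret J: category "rcat R j" by (rule rcat_category[OF j])
  show ?thesis
    using gcmp_eta_right[OF a f I.idn_homset[OF x]]
    by (simp only: I.idn_cmp[OF eta_delta(1)[OF i x]] rfun_idn[OF a x] J.cmp_idn[OF f])
qed

text \<open>Isolates how \<open>\<theta>\<close> enters a product. With \<open>g\<close> an identity
  too, it computes the product of the identities in degrees \<open>b\<close> and \<open>a\<close>,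
  which is needed for (Mod.1).\<close>

lemma gcmp_idn_right:
  assumes a: "a \<in> homset C i j" and b: "b \<in> homset C j k" and x: "x \<in> obj (rcat R i)"
    and g: "g \<in> homset (rcat R k) (fobj (rfun R b) (fobj (rfun R a) x)) z"
  shows "gcmp b g a x (idn (rcat R j) (fobj (rfun R a) x)) = g \<cdot>\<^bsub>rcat R k\<^esub> theta C R b a x"
proof -
  interpret K: category "rcat R k" by (rule rcat_category[OF homset_obj(2)[OF b]])
  show ?thesis
    unfolding gcmp_def homsetD(3)[OF b]
    by (simp only: rfun_idn[OF b rfun_obj[OF a x]] K.cmp_idn[OF g])
qed

text \<open>Additivity of \<open>R(b)\<close> is needed for this argument, as \<open>f\<close>
  enters the composite through \<open>R(b)\<close>.\<close>

lemma gcmp_padd_right: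
  assumes a: "a \<in> homset C i j" and b: "b \<in> homset C j k" and x: "x \<in> obj (rcat R i)"
    and f: "f \<in> homset (rcat R j) (fobj (rfun R a) x) y" "f' \<in> homset (rcat R j) (fobj (rfun R a) x)
        y"
    and g: "g \<in> homset (rcat R k) (fobj (rfun R b) y) z"
  shows "gcmp b g a x (padd (rcat R j) f f') = padd (rcat R k) (gcmp b g a x f) (gcmp b g a x f')"
proof -
  interpret K: preadditive "rcat R k" by (rule rcat_preadditive[OF homset_obj(2)[OF b]])
  note Rf = rfun_homset[OF b f(1)] rfun_homset[OF b f(2)]
  show ?thesis
    unfolding gcmp_def homsetD(3)[OF b]
    by (simp only: rfun_padd[OF b f] K.cmp_padd_right[OF Rf g]
        K.cmp_padd_left[OF theta_mu(1)[OF a b x] K.cmp_homset[OF Rf(1) g] K.cmp_homset[OF Rf(2) g]])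
qed

lemma gcmp_padd_left:
  assumes a: "a \<in> homset C i j" and b: "b \<in> homset C j k" and x: "x \<in> obj (rcat R i)"
    and f: "f \<in> homset (rcat R j) (fobj (rfun R a) x) y"
    and g: "g \<in> homset (rcat R k) (fobj (rfun R b) y) z" "g' \<in> homset (rcat R k) (fobj (rfun R b) y)
        z"
  shows "gcmp b (padd (rcat R k) g g') a x f = padd (rcat R k) (gcmp b g a x f) (gcmp b g' a x f)"
proof -
  interpret K: preadditive "rcat R k" by (rule rcat_preadditive[OF homset_obj(2)[OF b]])
  note Rf = rfun_homset[OF b f]
  show ?thesis
    unfolding gcmp_def homsetD(3)[OF b]
    by (simp only: K.cmp_padd_left[OF Rf g]
        K.cmp_padd_left[OF theta_mu(1)[OF a b x] K.cmp_homset[OF Rf g(1)] K.cmp_homset[OF Rf g(2)]])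
qed

end

section \<open>The pseudoskew category algebra as the algebra of the Grothendieck
  construction\<close>

locale finite_representation = representation C R
  for C :: "('i, 'c) cat" (structure) and R :: "('i, 'c, 'x, 'f) rep" +
  assumes finite_obj: "finite (obj C)"
    and finite_rcat_obj: "i \<in> obj C \<Longrightarrow> finite (obj (rcat R i))"
begin

definition skew_ob :: "('i \<times> 'x) set" where
  "skew_ob = (SIGMA i:obj C. obj (rcat R i))"

definition skew_src :: "'c \<times> 'x \<times> 'x \<Rightarrow> 'i \<times> 'x" where
  "skew_src = (\<lambda>(a, x, y). (src C a, x))"

definition skew_tgt :: "'c \<times> 'x \<times> 'x \<Rightarrow> 'i \<times> 'x" where
  "skew_tgt = (\<lambda>(a, x, y). (tgt C a, y))"

definition skew_ic :: "'c \<times> 'x \<times> 'x \<Rightarrow> 'c \<times> 'x \<times> 'x \<Rightarrow> 'c \<times> 'x \<times> 'x" where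
  "skew_ic = (\<lambda>(b, y', z) (a, x, y). (b \<cdot> a, x, z))"

definition skew_mc :: "'c \<times> 'x \<times> 'x \<Rightarrow> 'f \<Rightarrow> 'c \<times> 'x \<times> 'x \<Rightarrow> 'f \<Rightarrow> 'f" where
  "skew_mc = (\<lambda>(b, y', z) g (a, x, y) f. gcmp b g a x f)"

definition skew_iu :: "'i \<times> 'x \<Rightarrow> 'c \<times> 'x \<times> 'x" where
  "skew_iu = (\<lambda>(i, x). (idn C i, x, x))"

definition skew_un :: "'i \<times> 'x \<Rightarrow> 'f" where
  "skew_un = (\<lambda>(i, x). eta R i x)"

lemmas skew_simps = skew_src_def skew_tgt_def skew_ic_def skew_mc_def skew_iu_def skew_un_def

lemma skew_hom_simps:
  "carrier (skew_hom C R (a, x, y)) = homset (rcat R (tgt C a)) (fobj (rfun R a) x) y"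
  "monoid.mult (skew_hom C R (a, x, y)) = padd (rcat R (tgt C a))"
  by (simp_all add: skew_hom_def hom_group_def)

lemma skew_indexD:
  assumes "(a, x, y) \<in> skew_index C R"
  shows "a \<in> homset C (src C a) (tgt C a)" "x \<in> obj (rcat R (src C a))" "y \<in> obj (rcat R (tgt C a))"
  using assms by (auto simp: skew_index_def homset_def)

lemma skew_indexI: "\<lbrakk>a \<in> homset C i j; x \<in> obj (rcat R i); y \<in> obj (rcat R j)\<rbrakk> \<Longrightarrow> (a, x, y) \<in>
    skew_index C R"
  by (auto simp: skew_index_def homset_def)

lemma skew_obI: "\<lbrakk>i \<in> obj C; x \<in> obj (rcat R i)\<rbrakk> \<Longrightarrow> (i, x) \<in> skew_ob"
  by (simp add: skew_ob_def)

lemma skew_composable: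
  assumes "(b, y', z) \<in> skew_index C R" "(a, x, y) \<in> skew_index C R"
    and "skew_src (b, y', z) = skew_tgt (a, x, y)"
  shows "b \<in> homset C (tgt C a) (tgt C b)" "y' = y" "src C b = tgt C a"
  using assms skew_indexD(1)[OF assms(1)] by (simp_all add: skew_src_def skew_tgt_def)

text \<open>Associativity and the unit laws are those of \<open>gcmp\<close>, and additivity comes
  from \<open>gcmp_padd_left\<close> and \<open>gcmp_padd_right\<close>. What remains is to match
  sources and targets, where composability identifies the middle object.\<close>

lemma graded_category_skew:
  "graded_category skew_ob (skew_index C R) (skew_hom C R) skew_src skew_tgt skew_ic skew_mc skew_iu
      skew_un"
proof (rule graded_category.intro)
  show "finite skew_ob"
    unfolding skew_ob_def using finite_obj finite_rcat_obj by blast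
next
  fix q assume "q \<in> skew_index C R"
  moreover obtain a x y where q: "q = (a, x, y)" by (cases q)
  ultimately have q': "(a, x, y) \<in> skew_index C R" by simp
  note a = skew_indexD[OF q']
  have i: "src C a \<in> obj C" and j: "tgt C a \<in> obj C"
    using homset_obj[OF a(1)] by auto
  show "skew_src q \<in> skew_ob" "skew_tgt q \<in> skew_ob"
    using a i j by (simp_all add: q skew_src_def skew_tgt_def skew_obI)
  show "comm_group (skew_hom C R q)"
    unfolding q skew_hom_def prod.case
    by (rule preadditive.hom_comm_group[OF rcat_preadditive[OF j] rfun_obj[OF a(1,2)] a(3)])
  show "skew_ic (skew_iu (skew_tgt q)) q = q" "skew_ic q (skew_iu (skew_src q)) = q"
    using idn_cmp[OF a(1)] cmp_idn[OF a(1)] by (simp_all add: q skew_simps)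
  fix f assume "f \<in> carrier (skew_hom C R q)"
  then have f: "f \<in> homset (rcat R (tgt C a)) (fobj (rfun R a) x) y"
    by (simp add: q skew_hom_simps)
  show "skew_mc (skew_iu (skew_tgt q)) (skew_un (skew_tgt q)) q f = f"
    "skew_mc q f (skew_iu (skew_src q)) (skew_un (skew_src q)) = f"
    using gcmp_unit_left[OF a(1,2) f] gcmp_unit_right[OF a(1,2) f] by (simp_all add: q skew_simps)
next
  fix o' assume "o' \<in> skew_ob"
  then obtain i x where o': "o' = (i, x)" and i: "i \<in> obj C" and x: "x \<in> obj (rcat R i)"
    by (auto simp: skew_ob_def)
  note one = idn_homset[OF i]
  show "skew_iu o' \<in> skew_index C R"
    using skew_indexI[OF one x x] by (simp add: o' skew_iu_def)
  show "skew_src (skew_iu o') = o'" "skew_tgt (skew_iu o') = o'"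
    using homsetD[OF one] by (simp_all add: o' skew_simps)
  show "skew_un o' \<in> carrier (skew_hom C R (skew_iu o'))"
    using eta_delta(1)[OF i x] homsetD[OF one] by
        (simp add: o' skew_iu_def skew_un_def skew_hom_simps)
next
  fix q p assume "q \<in> skew_index C R" "p \<in> skew_index C R" and comp: "skew_src q = skew_tgt p"
  moreover obtain b y' z a x y where q: "q = (b, y', z)" and p: "p = (a, x, y)" by
      (cases q, cases p)
  ultimately have q': "(b, y', z) \<in> skew_index C R" and p': "(a, x, y) \<in> skew_index C R"
    and comp': "skew_src (b, y', z) = skew_tgt (a, x, y)" by simp_all
  note a = skew_indexD[OF p'] and b = skew_composable[OF q' p' comp']
  note ba = cmp_homset[OF a(1) b(1)]
  have z: "z \<in> obj (rcat R (tgt C b))" by (rule skew_indexD(3)[OF q'])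
  have tba: "tgt C (b \<cdot> a) = tgt C b" "src C (b \<cdot> a) = src C a"
    using homsetD[OF ba] by simp_all
  show "skew_ic q p \<in> skew_index C R"
    using skew_indexI[OF ba a(2) z] by (simp add: q p skew_ic_def)
  show "skew_src (skew_ic q p) = skew_src p" "skew_tgt (skew_ic q p) = skew_tgt q"
    by (simp_all add: q p skew_simps tba)
  have H: "carrier (skew_hom C R (skew_ic q p)) = homset (rcat R (tgt C b))
      (fobj (rfun R (b \<cdot> a)) x) z"
    "monoid.mult (skew_hom C R (skew_ic q p)) = padd (rcat R (tgt C b))"
    by (simp_all add: q p skew_ic_def skew_hom_simps tba)
  have carr: "carrier (skew_hom C R q) = homset (rcat R (tgt C b)) (fobj (rfun R b) y) z"
    "carrier (skew_hom C R p) = homset (rcat R (tgt C a)) (fobj (rfun R a) x) y"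
    by (simp_all add: q p skew_hom_simps b(2))
  {
    fix g assume g: "g \<in> carrier (skew_hom C R q)"
    show "skew_mc q g p \<in> hom (skew_hom C R p) (skew_hom C R (skew_ic q p))"
      using gcmp_homset[OF a(1) b(1) a(2) _ g[unfolded carr]]
        gcmp_padd_right[OF a(1) b(1) a(2) _ _ g[unfolded carr]]
      by (intro homI) (simp_all add: H carr, simp_all add: q p skew_mc_def skew_hom_simps)
  next
    fix f assume f: "f \<in> carrier (skew_hom C R p)"
    show "(\<lambda>g. skew_mc q g p f) \<in> hom (skew_hom C R q) (skew_hom C R (skew_ic q p))"
      using gcmp_homset[OF a(1) b(1) a(2) f[unfolded carr]]
        gcmp_padd_left[OF a(1) b(1) a(2) f[unfolded carr]]
      by (intro homI) (simp_all add: H carr, simp_all add: q p skew_mc_def skew_hom_simps)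
  }
  fix r assume r: "r \<in> skew_index C R" and comp2: "skew_src r = skew_tgt q"
  obtain c z' w where r': "r = (c, z', w)" by (cases r)
  note c = skew_composable[OF r[unfolded r'] q' comp2[unfolded r' q]]
  show "skew_ic r (skew_ic q p) = skew_ic (skew_ic r q) p"
    using cmp_assoc[OF a(1) b(1) c(1)] by (simp add: r' q p skew_ic_def)
  fix h g f assume h: "h \<in> carrier (skew_hom C R r)" and g: "g \<in> carrier (skew_hom C R q)"
    and f: "f \<in> carrier (skew_hom C R p)"
  have "h \<in> homset (rcat R (tgt C c)) (fobj (rfun R c) z) w"
    using h by (simp add: r' skew_hom_simps c(2))
  from gcmp_assoc[OF a(1) b(1) a(2) f[unfolded carr] g[unfolded carr] c(1) this]
  show "skew_mc r h (skew_ic q p) (skew_mc q g p f) = skew_mc (skew_ic r q) (skew_mc r h q g) p f"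
    by (simp add: r' q p skew_ic_def skew_mc_def b(2))
qed

sublocale G: graded_category skew_ob "skew_index C R" "skew_hom C R" skew_src skew_tgt skew_ic
    skew_mc
  skew_iu skew_un
  by (rule graded_category_skew)

lemma skew_elem_single: "skew_elem C R = G.single"
  by (intro ext) (simp add: skew_elem_def sum_single_def)

lemma skew_elem_mult_G: "skew_elem_mult C R = G.elem_mult"
proof (intro ext)
  fix q :: "'c \<times> 'x \<times> 'x" and g :: 'f and p :: "'c \<times> 'x \<times> 'x" and f :: 'f and r
  obtain b y' z a x y where q: "q = (b, y', z)" and p: "p = (a, x, y)" by (cases q, cases p)
  show "skew_elem_mult C R q g p f r = G.elem_mult q g p f r"
    unfolding q p skew_elem_mult_def G.elem_mult_def skew_elem_single skew_group_def
    by (simp add: skew_simps gcmp_def del: one_sum_group)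
qed

text \<open>Both products are the same finite sum over pairs of supports, and both units the same
  sum of idempotents. Since this is an equality, the statement about \<open>R[C]\<close> follows by
  rewriting.\<close>

lemma skew_algebra_alg: "skew_algebra C R = G.alg"
proof -
  have "(\<lambda>v u. finprod (skew_group C R) (\<lambda>(q, p). skew_elem_mult C R q (v q) p (u p))
      (skew_supp C R v \<times> skew_supp C R u)) = G.amult"
    by (intro ext) (simp only: skew_elem_mult_G skew_supp_def skew_group_def G.amult_def
        G.biext_def)
  moreover have "(\<lambda>(i, x). skew_elem C R (idn C i, x, x) (eta R i x)) = G.idem"
    by (auto simp: fun_eq_iff skew_elem_single G.idem_def) (simp_all add: skew_iu_def skew_un_def)
  ultimately show ?thesis
    unfolding skew_algebra_def G.alg_def G.aone_def skew_group_def skew_ob_def[symmetric]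
    by (simp only:)
qed

end

section \<open>Abelian groups and opposite categories\<close>

lemma homset_Ab: "f \<in> homset Ab G H \<longleftrightarrow> asrc f = G \<and> atgt f = H \<and> comm_group G \<and> comm_group H \<and>
    amap f \<in> hom G H \<and> amap f \<in> extensional (carrier G)"
  by (cases f) (auto simp: homset_def Ab_def)

lemma Ab_homD:
  assumes "f \<in> homset Ab G H"
  shows "amap f \<in> hom G H" "m \<in> carrier G \<Longrightarrow> amap f m \<in> carrier H" "comm_group G" "comm_group H"
  using assms by (auto simp: homset_Ab hom_def)

lemma Ab_eqI:
  assumes "f \<in> homset Ab G H" "g \<in> homset Ab G H" "\<And>m. m \<in> carrier G \<Longrightarrow> amap f m = amap g m"
  shows "f = g"
  using assms by (intro arrow.expand conjI) (auto simp: homset_Ab intro: extensionalityI)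

definition ab_arrow :: "'u monoid \<Rightarrow> 'u monoid \<Rightarrow> ('u \<Rightarrow> 'u) \<Rightarrow> 'u ab_arrow" where
  "ab_arrow G H h = Arrow G H (restrict h (carrier G))"

lemma ab_arrow_homset: "\<lbrakk>comm_group G; comm_group H; h \<in> hom G H\<rbrakk> \<Longrightarrow> ab_arrow G H h \<in> homset Ab G H"
  using monoid.m_closed[OF group.is_monoid[OF comm_group.axioms(2)], of G]
  by (auto simp: homset_Ab ab_arrow_def hom_def)

lemma amap_ab_arrow: "m \<in> carrier G \<Longrightarrow> amap (ab_arrow G H h) m = h m"
  by (simp add: ab_arrow_def)

lemma amap_cmp_Ab: "\<lbrakk>f \<in> homset Ab G H; m \<in> carrier G\<rbrakk> \<Longrightarrow> amap (g \<cdot>\<^bsub>Ab\<^esub> f) m = amap g (amap f m)"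
  unfolding homset_Ab by (auto simp: Ab_def compose_def)

lemma cmp_Ab_homset:
  assumes f: "f \<in> homset Ab G H" and g: "g \<in> homset Ab H K"
  shows "g \<cdot>\<^bsub>Ab\<^esub> f \<in> homset Ab G K"
proof -
  have "g \<cdot>\<^bsub>Ab\<^esub> f = ab_arrow G K (\<lambda>m. amap g (amap f m))"
    using f g unfolding homset_Ab by (auto simp: Ab_def ab_arrow_def compose_def)
  then show ?thesis
    using ab_arrow_homset[OF Ab_homD(3)[OF f] Ab_homD(4)[OF g]
        hom_comp[OF Ab_homD(1)[OF f] Ab_homD(1)[OF g]]]
    by (simp only:)
qed

lemma idn_Ab: "idn Ab G = ab_arrow G G (\<lambda>m. m)"
  by (simp add: Ab_def ab_arrow_def)

lemma idn_Ab_homset: "comm_group G \<Longrightarrow> idn Ab G \<in> homset Ab G G"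
  unfolding idn_Ab by (rule ab_arrow_homset) (auto simp: hom_def)

lemma amap_idn_Ab: "m \<in> carrier G \<Longrightarrow> amap (idn Ab G) m = m"
  unfolding idn_Ab by (rule amap_ab_arrow)

lemma obj_Ab: "obj Ab = {G. comm_group G}"
  by (simp add: Ab_def)

lemma category_Ab: "category Ab"
proof
  fix f :: "'u ab_arrow" assume "f \<in> arr Ab"
  then have "f \<in> homset Ab (src Ab f) (tgt Ab f)" by (simp add: homset_def)
  then show "src Ab f \<in> obj Ab" "tgt Ab f \<in> obj Ab"
    by (auto simp: obj_Ab dest: Ab_homD)
next
  fix G :: "'u monoid" assume "G \<in> obj Ab"
  then show "idn Ab G \<in> homset Ab G G" by (simp add: obj_Ab idn_Ab_homset)
next
  fix f g :: "'u ab_arrow" and G H K assume "f \<in> homset Ab G H" "g \<in> homset Ab H K"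
  then show "g \<cdot>\<^bsub>Ab\<^esub> f \<in> homset Ab G K" by (rule cmp_Ab_homset)
next
  fix f :: "'u ab_arrow" and G H assume f: "f \<in> homset Ab G H"
  note G = idn_Ab_homset[OF Ab_homD(3)[OF f]] and H = idn_Ab_homset[OF Ab_homD(4)[OF f]]
  show "f \<cdot>\<^bsub>Ab\<^esub> idn Ab G = f"
    by (rule Ab_eqI[OF cmp_Ab_homset[OF G f] f]) (simp add: amap_cmp_Ab[OF G] amap_idn_Ab)
  show "idn Ab H \<cdot>\<^bsub>Ab\<^esub> f = f"
    by (rule Ab_eqI[OF cmp_Ab_homset[OF f H] f])
        (simp add: amap_cmp_Ab[OF f] amap_idn_Ab Ab_homD(2)[OF f])
next
  fix f g h :: "'u ab_arrow" and G H K L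
  assume f: "f \<in> homset Ab G H" and g: "g \<in> homset Ab H K" and h: "h \<in> homset Ab K L"
  note gf = cmp_Ab_homset[OF f g] and hg = cmp_Ab_homset[OF g h]
  show "h \<cdot>\<^bsub>Ab\<^esub> (g \<cdot>\<^bsub>Ab\<^esub> f) = h \<cdot>\<^bsub>Ab\<^esub> g \<cdot>\<^bsub>Ab\<^esub> f"
    by (rule Ab_eqI[OF cmp_Ab_homset[OF gf h] cmp_Ab_homset[OF f hg]])
      (simp add: amap_cmp_Ab[OF gf] amap_cmp_Ab[OF f] amap_cmp_Ab[OF g] Ab_homD(2)[OF f])
qed

lemma padd_Ab:
  assumes "f \<in> homset Ab G H"
  shows "padd Ab f f' = ab_arrow G H (\<lambda>m. amap f m \<otimes>\<^bsub>H\<^esub> amap f' m)"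
  using assms by (simp add: Ab_def homset_def ab_arrow_def)

lemma pzero_Ab: "pzero Ab G H = ab_arrow G H (\<lambda>m. \<one>\<^bsub>H\<^esub>)"
  by (simp add: Ab_def ab_arrow_def)

lemma padd_Ab_homset:
  assumes f: "f \<in> homset Ab G H" and g: "g \<in> homset Ab G H"
  shows "padd Ab f g \<in> homset Ab G H"
  unfolding padd_Ab[OF f]
  by (rule ab_arrow_homset[OF Ab_homD(3,4)[OF f]
      hom_mult_pointwise[OF Ab_homD(4)[OF f] Ab_homD(1)[OF f] Ab_homD(1)[OF g]]])

lemma amap_padd_Ab:
  "\<lbrakk>f \<in> homset Ab G H; m \<in> carrier G\<rbrakk> \<Longrightarrow> amap (padd Ab f g) m = amap f m \<otimes>\<^bsub>H\<^esub> amap g m"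
  by (simp add: padd_Ab amap_ab_arrow)

lemma comm_group_hom_group_Ab:
  assumes "comm_group G" "comm_group H"
  shows "comm_group (hom_group Ab G H)"
proof -
  interpret G: comm_group G by fact
  interpret H: comm_group H by fact
  have zero: "pzero Ab G H \<in> homset Ab G H"
    unfolding pzero_Ab by (rule ab_arrow_homset[OF assms hom_const_one[OF H.is_group]])
  have amap_zero: "m \<in> carrier G \<Longrightarrow> amap (pzero Ab G H) m = \<one>\<^bsub>H\<^esub>" for m
    by (simp add: pzero_Ab amap_ab_arrow)
  note closed = Ab_homD(2)
  show ?thesis
  proof (rule comm_groupI)
    fix f g assume "f \<in> carrier (hom_group Ab G H)" "g \<in> carrier (hom_group Ab G H)"
    then have f: "f \<in> homset Ab G H" and g: "g \<in> homset Ab G H" by (simp_all add: hom_group_def)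
    then show "f \<otimes>\<^bsub>hom_group Ab G H\<^esub> g \<in> carrier (hom_group Ab G H)"
      by (simp add: hom_group_def padd_Ab_homset)
    have "padd Ab f g = padd Ab g f"
      by (rule Ab_eqI[OF padd_Ab_homset[OF f g] padd_Ab_homset[OF g f]])
        (simp add: amap_padd_Ab[OF f] amap_padd_Ab[OF g] closed[OF f] closed[OF g] H.m_comm)
    then show "f \<otimes>\<^bsub>hom_group Ab G H\<^esub> g = g \<otimes>\<^bsub>hom_group Ab G H\<^esub> f"
      by (simp add: hom_group_def)
  next
    show "\<one>\<^bsub>hom_group Ab G H\<^esub> \<in> carrier (hom_group Ab G H)"
      using zero by (simp add: hom_group_def)
  next
    fix f g h assume "f \<in> carrier (hom_group Ab G H)" "g \<in> carrier (hom_group Ab G H)" "h \<in> carrier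
        (hom_group Ab G H)"
    then have f: "f \<in> homset Ab G H" and g: "g \<in> homset Ab G H" and h: "h \<in> homset Ab G H"
      by (simp_all add: hom_group_def)
    note fg = padd_Ab_homset[OF f g] and gh = padd_Ab_homset[OF g h]
    have "padd Ab (padd Ab f g) h = padd Ab f (padd Ab g h)"
      by (rule Ab_eqI[OF padd_Ab_homset[OF fg h] padd_Ab_homset[OF f gh]])
        (simp add: amap_padd_Ab[OF f] amap_padd_Ab[OF g] amap_padd_Ab[OF fg] closed[OF f]
            closed[OF g]
          closed[OF h] H.m_assoc)
    then show "f \<otimes>\<^bsub>hom_group Ab G H\<^esub> g \<otimes>\<^bsub>hom_group Ab G H\<^esub> h =
        f \<otimes>\<^bsub>hom_group Ab G H\<^esub> (g \<otimes>\<^bsub>hom_group Ab G H\<^esub> h)"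
      by (simp add: hom_group_def)
  next
    fix f assume "f \<in> carrier (hom_group Ab G H)"
    then have f: "f \<in> homset Ab G H" by (simp add: hom_group_def)
    have "padd Ab (pzero Ab G H) f = f"
      by (rule Ab_eqI[OF padd_Ab_homset[OF zero f] f])
        (simp add: amap_padd_Ab[OF zero] amap_zero closed[OF f])
    then show "\<one>\<^bsub>hom_group Ab G H\<^esub> \<otimes>\<^bsub>hom_group Ab G H\<^esub> f = f"
      by (simp add: hom_group_def)
    \<comment> \<open>Inverting values pointwise yields a homomorphism because \<open>H\<close> is
      commutative.\<close>
    define g where "g = ab_arrow G H (\<lambda>m. inv\<^bsub>H\<^esub> amap f m)"
    have "(\<lambda>m. inv\<^bsub>H\<^esub> amap f m) \<in> hom G H"
      using closed[OF f] hom_mult[OF Ab_homD(1)[OF f]] by (intro homI) (simp_all add: H.inv_mult)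
    then have g: "g \<in> homset Ab G H"
      unfolding g_def by (rule ab_arrow_homset[OF assms])
    have "padd Ab g f = pzero Ab G H"
      by (rule Ab_eqI[OF padd_Ab_homset[OF g f] zero])
        (simp add: amap_padd_Ab[OF g] amap_zero closed[OF f], simp add: g_def amap_ab_arrow
            closed[OF f])
    then show "\<exists>g\<in>carrier (hom_group Ab G H). g \<otimes>\<^bsub>hom_group Ab G H\<^esub> f = \<one>\<^bsub>hom_group Ab G H\<^esub>"
      using g by (auto simp: hom_group_def)
  qed
qed

text \<open>The locale \<open>additive_functor\<close> includes that its codomain is preadditive, so
  this is part of showing that a constructed family of functors is a module.\<close>

lemma preadditive_Ab: "preadditive Ab"
proof (intro preadditive.intro preadditive_axioms.intro category_Ab)
  fix G H :: "'u monoid" assume "G \<in> obj Ab" "H \<in> obj Ab"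
  then show "comm_group (hom_group Ab G H)" by (simp add: obj_Ab comm_group_hom_group_Ab)
next
  fix f f' g :: "'u ab_arrow" and G H K
  assume f: "f \<in> homset Ab G H" and f': "f' \<in> homset Ab G H" and g: "g \<in> homset Ab H K"
  show "g \<cdot>\<^bsub>Ab\<^esub> padd Ab f f' = padd Ab (g \<cdot>\<^bsub>Ab\<^esub> f) (g \<cdot>\<^bsub>Ab\<^esub> f')"
    using hom_mult[OF Ab_homD(1)[OF g]]
    by (intro Ab_eqI[OF cmp_Ab_homset[OF padd_Ab_homset[OF f f'] g]
          padd_Ab_homset[OF cmp_Ab_homset[OF f g] cmp_Ab_homset[OF f' g]]])
      (simp add: amap_cmp_Ab[OF padd_Ab_homset[OF f f']] amap_padd_Ab[OF f]
        amap_padd_Ab[OF cmp_Ab_homset[OF f g]] amap_cmp_Ab[OF f] amap_cmp_Ab[OF f'] Ab_homD(2)[OF f]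
            Ab_homD(2)[OF f'])
next
  fix f g g' :: "'u ab_arrow" and G H K
  assume f: "f \<in> homset Ab G H" and g: "g \<in> homset Ab H K" and g': "g' \<in> homset Ab H K"
  show "padd Ab g g' \<cdot>\<^bsub>Ab\<^esub> f = padd Ab (g \<cdot>\<^bsub>Ab\<^esub> f) (g' \<cdot>\<^bsub>Ab\<^esub> f)"
    by (intro Ab_eqI[OF cmp_Ab_homset[OF f padd_Ab_homset[OF g g']]
          padd_Ab_homset[OF cmp_Ab_homset[OF f g] cmp_Ab_homset[OF f g']]])
      (simp add: amap_cmp_Ab[OF f] amap_padd_Ab[OF g] amap_padd_Ab[OF cmp_Ab_homset[OF f g]]
          Ab_homD(2)[OF f])
qed

section \<open>Opposite categories and functors between them\<close>

lemma opp_simps: "obj (opp A) = obj A" "homset (opp A) x y = homset A y x" "idn (opp A) = idn A"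
  "g \<cdot>\<^bsub>opp A\<^esub> f = f \<cdot>\<^bsub>A\<^esub> g" "padd (opp A) = padd A"
  by (auto simp: opp_def homset_def)

lemma preadditive_opp:
  assumes "preadditive A"
  shows "preadditive (opp A)"
proof -
  interpret A: preadditive A by fact
  have "category (opp A)"
  proof
    fix f assume "f \<in> arr (opp A)"
    then show "src (opp A) f \<in> obj (opp A)" "tgt (opp A) f \<in> obj (opp A)"
      by (simp_all add: opp_def A.src_obj A.tgt_obj)
  qed (simp_all add: opp_simps A.idn_homset A.cmp_homset A.cmp_idn A.idn_cmp A.cmp_assoc)
  moreover have "comm_group (hom_group (opp A) x y)" if "x \<in> obj A" "y \<in> obj A" for x y
  proof -
    have "hom_group (opp A) x y = hom_group A y x"
      by (simp add: hom_group_def opp_simps) (simp add: opp_def)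
    then show ?thesis using A.hom_comm_group[OF that(2,1)] by simp
  qed
  ultimately show ?thesis
    by (intro preadditive.intro preadditive_axioms.intro)
      (simp_all add: opp_simps A.cmp_padd_left A.cmp_padd_right)
qed

text \<open>Allows \<open>R(a)\<close> to be composed with the contravariant
  \<open>M\<^sub>j\<close>, so that the restriction \<open>a\<^sup>*M\<^sub>j\<close> is seen to be
  a functor on the opposite of \<open>R(i)\<close>.\<close>

lemma cat_functor_opp:
  assumes A: "preadditive A" and B: "preadditive B" and F: "cat_functor A B F"
  shows "cat_functor (opp A) (opp B) F"
proof -
  interpret F: cat_functor A B F by fact
  show ?thesis
    using preadditive.axioms(1)[OF preadditive_opp[OF A]]
        preadditive.axioms(1)[OF preadditive_opp[OF B]]
    by (intro cat_functor.intro cat_functor_axioms.intro)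
      (simp_all add: opp_simps F.fobj_obj F.farr_homset F.farr_idn F.farr_cmp)
qed

section \<open>Right modules over a representation as graded modules\<close>

text \<open>The groups of a module indexed by the objects of the Grothendieck construction.\<close>

definition fiber :: "('i, 'c, 'x, 'f, 'u) rep_mod \<Rightarrow> 'i \<times> 'x \<Rightarrow> 'u monoid" where
  "fiber N = (\<lambda>(i, x). fobj (mfun N i) x)"

context representation
begin

definition skew_act :: "('i, 'c, 'x, 'f, 'u) rep_mod \<Rightarrow> 'c \<times> 'x \<times> 'x \<Rightarrow> 'f \<Rightarrow> 'u \<Rightarrow> 'u" where
  "skew_act N = (\<lambda>(a, x, y) f m. amap (mtr N a x) (amap (farr (mfun N (tgt C a)) f) m))"

context
  fixes N :: "('i, 'c, 'x, 'f, 'u) rep_mod"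
  assumes N: "right_rep_module C R N"
begin

interpretation N: right_rep_module C R N by (rule N)

lemma mfun_functor: "i \<in> obj C \<Longrightarrow> cat_functor (opp (rcat R i)) Ab (mfun N i)"
  by (rule additive_functor.axioms(3)[OF N.mfun_additive])

lemma comm_group_fiber: "\<lbrakk>i \<in> obj C; x \<in> obj (rcat R i)\<rbrakk> \<Longrightarrow> comm_group (fobj (mfun N i) x)"
  using cat_functor.fobj_obj[OF mfun_functor] by (simp add: opp_simps obj_Ab)

lemma mfun_homset: "\<lbrakk>i \<in> obj C; f \<in> homset (rcat R i) x y\<rbrakk>
    \<Longrightarrow> farr (mfun N i) f \<in> homset Ab (fobj (mfun N i) y) (fobj (mfun N i) x)"
  using cat_functor.farr_homset[OF mfun_functor] by (simp add: opp_simps)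

lemma mfun_cmp:
  assumes i: "i \<in> obj C" and f: "f \<in> homset (rcat R i) x y" and g: "g \<in> homset (rcat R i) y z"
    and m: "m \<in> carrier (fobj (mfun N i) z)"
  shows "amap (farr (mfun N i) (g \<cdot>\<^bsub>rcat R i\<^esub> f)) m = amap (farr (mfun N i) f)
      (amap (farr (mfun N i) g) m)"
  using cat_functor.farr_cmp[OF mfun_functor[OF i], unfolded opp_simps, OF g f]
    amap_cmp_Ab[OF mfun_homset[OF i g] m] by simp

lemma mfun_idn:
  assumes i: "i \<in> obj C" and x: "x \<in> obj (rcat R i)" and m: "m \<in> carrier (fobj (mfun N i) x)"
  shows "amap (farr (mfun N i) (idn (rcat R i) x)) m = m"
  using cat_functor.farr_idn[OF mfun_functor[OF i], unfolded opp_simps, OF x] amap_idn_Ab[OF m] by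
      simp

lemma mfun_padd:
  assumes i: "i \<in> obj C" and f: "f \<in> homset (rcat R i) x y" and g: "g \<in> homset (rcat R i) x y"
    and m: "m \<in> carrier (fobj (mfun N i) y)"
  shows "amap (farr (mfun N i) (padd (rcat R i) f g)) m =
    amap (farr (mfun N i) f) m \<otimes>\<^bsub>fobj (mfun N i) x\<^esub> amap (farr (mfun N i) g) m"
  using additive_functor.farr_padd[OF N.mfun_additive[OF i], unfolded opp_simps, OF f g]
    amap_padd_Ab[OF mfun_homset[OF i f] m] by simp

lemma mtr_homset: "\<lbrakk>a \<in> homset C i j; x \<in> obj (rcat R i)\<rbrakk>
    \<Longrightarrow> mtr N a x \<in> homset Ab (fobj (mfun N j) (fobj (rfun R a) x)) (fobj (mfun N i) x)"
  using nat_transf.component[OF N.mtr_nat_transf] by (simp add: opp_simps comp_fctr_def)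

lemma mtr_natural:
  assumes a: "a \<in> homset C i j" and f: "f \<in> homset (rcat R i) x y"
    and m: "m \<in> carrier (fobj (mfun N j) (fobj (rfun R a) y))"
  shows "amap (mtr N a x) (amap (farr (mfun N j) (farr (rfun R a) f)) m) =
    amap (farr (mfun N i) f) (amap (mtr N a y) m)"
proof -
  have y: "y \<in> obj (rcat R i)"
    by (rule category.homset_obj(2)[OF rcat_category[OF homset_obj(1)[OF a]] f])
  show ?thesis
    using nat_transf.natural[OF N.mtr_nat_transf[OF a], unfolded opp_simps, OF f]
      amap_cmp_Ab[OF mfun_homset[OF homset_obj(2)[OF a] rfun_homset[OF a f]] m, of "mtr N a x"]
      amap_cmp_Ab[OF mtr_homset[OF a y] m, of "farr (mfun N i) f"]
    by (simp add: comp_fctr_def)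
qed

lemma skew_act_hom:
  assumes a: "a \<in> homset C i j" and x: "x \<in> obj (rcat R i)"
    and f: "f \<in> homset (rcat R j) (fobj (rfun R a) x) y"
  shows "skew_act N (a, x, y) f \<in> hom (fobj (mfun N j) y) (fobj (mfun N i) x)"
  unfolding skew_act_def prod.case homsetD(3)[OF a]
  by (rule hom_comp[OF Ab_homD(1)[OF mfun_homset[OF homset_obj(2)[OF a] f]]
      Ab_homD(1)[OF mtr_homset[OF a x]]])

lemma skew_act_padd:
  assumes a: "a \<in> homset C i j" and x: "x \<in> obj (rcat R i)"
    and f: "f \<in> homset (rcat R j) (fobj (rfun R a) x) y" "f' \<in> homset (rcat R j) (fobj (rfun R a) x)
        y"
    and m: "m \<in> carrier (fobj (mfun N j) y)"
  shows "skew_act N (a, x, y) (padd (rcat R j) f f') m =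
    skew_act N (a, x, y) f m \<otimes>\<^bsub>fobj (mfun N i) x\<^esub> skew_act N (a, x, y) f' m"
proof -
  note j = homset_obj(2)[OF a]
  show ?thesis
    unfolding skew_act_def prod.case homsetD(3)[OF a] mfun_padd[OF j f m]
    by (rule hom_mult[OF Ab_homD(1)[OF mtr_homset[OF a x]] Ab_homD(2)[OF mfun_homset[OF j f(1)] m]
          Ab_homD(2)[OF mfun_homset[OF j f(2)] m]])
qed

text \<open>\<open>M\<^sub>k\<close> splits the composite of \<open>g\<close>, \<open>R(b)f\<close>
  and \<open>\<theta>\<close> into three maps. (Mod.1) absorbs \<open>\<theta>\<close> and breaks
  \<open>M(ba)\<close> into \<open>M(b)\<close> followed by \<open>M(a)\<close>; naturality of
  \<open>M(b)\<close> at \<open>f\<close> then moves \<open>f\<close> between the two.\<close>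

lemma skew_act_gcmp:
  assumes a: "a \<in> homset C i j" and b: "b \<in> homset C j k" and x: "x \<in> obj (rcat R i)"
    and f: "f \<in> homset (rcat R j) (fobj (rfun R a) x) y"
    and g: "g \<in> homset (rcat R k) (fobj (rfun R b) y) z"
    and m: "m \<in> carrier (fobj (mfun N k) z)"
  shows "skew_act N (b \<cdot> a, x, z) (gcmp b g a x f) m = skew_act N (a, x, y) f
      (skew_act N (b, y, z) g m)"
proof -
  interpret K: category "rcat R k" by (rule rcat_category[OF homset_obj(2)[OF b]])
  interpret J: category "rcat R j" by (rule rcat_category[OF homset_obj(2)[OF a]])
  note k = homset_obj(2)[OF b] and j = homset_obj(2)[OF a]
  note th = theta_mu(1)[OF a b x] and Rf = rfun_homset[OF b f]
  define n where "n = amap (farr (mfun N k) (farr (rfun R b) f)) (amap (farr (mfun N k) g) m)"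
  note gm = Ab_homD(2)[OF mfun_homset[OF k g] m]
  have n: "n \<in> carrier (fobj (mfun N k) (fobj (rfun R b) (fobj (rfun R a) x)))"
    unfolding n_def by (rule Ab_homD(2)[OF mfun_homset[OF k Rf] gm])
  have "amap (farr (mfun N k) (gcmp b g a x f)) m = amap (farr (mfun N k) (theta C R b a x)) n"
    unfolding gcmp_eq[OF a b x f g] n_def
    by (simp only: mfun_cmp[OF k K.cmp_homset[OF th Rf] g m] mfun_cmp[OF k th Rf gm])
  moreover have "amap (mtr N (b \<cdot> a) x) (amap (farr (mfun N k) (theta C R b a x)) n) =
      amap (mtr N a x) (amap (mtr N b (fobj (rfun R a) x)) n)"
    using N.mtr_cmp[OF a b x] amap_cmp_Ab[OF mfun_homset[OF k th] n, of "mtr N (b \<cdot> a) x"]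
      amap_cmp_Ab[OF mtr_homset[OF b rfun_obj[OF a x]] n, of "mtr N a x"] by simp
  moreover have "amap (mtr N b (fobj (rfun R a) x)) n =
      amap (farr (mfun N j) f) (amap (mtr N b y) (amap (farr (mfun N k) g) m))"
    unfolding n_def by (rule mtr_natural[OF b f gm])
  ultimately show ?thesis
    unfolding skew_act_def prod.case homsetD(3)[OF a] homsetD(3)[OF b]
        homsetD(3)[OF cmp_homset[OF a b]]
    by (simp only:)
qed

text \<open>The map \<open>M\<^sub>i(\<eta>\<^sub>i x)\<close> produced by the embedding is
  cancelled by \<open>M(1\<^sub>i)\<close>, by (Mod.2). Together with \<open>skew_act_mtr\<close>
  this recovers all data of a module from the action of generators.\<close>

lemma skew_act_arrow:
  assumes i: "i \<in> obj C" and f: "f \<in> homset (rcat R i) x y" and m: "m \<in> carrier (fobj (mfun N i) y)"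
  shows "skew_act N (idn C i, x, y) (f \<cdot>\<^bsub>rcat R i\<^esub> eta R i x) m = amap (farr (mfun N i) f) m"
proof -
  interpret I: category "rcat R i" by (rule rcat_category[OF i])
  have x: "x \<in> obj (rcat R i)" by (rule I.homset_obj(1)[OF f])
  note eta = eta_delta(1)[OF i x] and fm = Ab_homD(2)[OF mfun_homset[OF i f] m]
  show ?thesis
    unfolding skew_act_def prod.case homsetD(3)[OF idn_homset[OF i]] mfun_cmp[OF i eta f m]
    using amap_cmp_Ab[OF mfun_homset[OF i eta] fm, of "mtr N (idn C i) x"] N.mtr_idn[OF i x]
      amap_idn_Ab[OF fm] by simp
qed

lemma skew_act_eta:
  assumes i: "i \<in> obj C" and x: "x \<in> obj (rcat R i)" and m: "m \<in> carrier (fobj (mfun N i) x)"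
  shows "skew_act N (idn C i, x, x) (eta R i x) m = m"
proof -
  interpret I: category "rcat R i" by (rule rcat_category[OF i])
  show ?thesis
    using skew_act_arrow[OF i I.idn_homset[OF x] m]
    by (simp only: I.idn_cmp[OF eta_delta(1)[OF i x]] mfun_idn[OF i x m])
qed

lemma skew_act_mtr:
  assumes a: "a \<in> homset C i j" and x: "x \<in> obj (rcat R i)"
    and m: "m \<in> carrier (fobj (mfun N j) (fobj (rfun R a) x))"
  shows "skew_act N (a, x, fobj (rfun R a) x) (idn (rcat R j) (fobj (rfun R a) x)) m = amap
      (mtr N a x) m"
  unfolding skew_act_def prod.case homsetD(3)[OF a]
  by (simp only: mfun_idn[OF homset_obj(2)[OF a] rfun_obj[OF a x] m])

end

end

context finite_representation
begin

lemma graded_module_rep: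
  assumes N: "right_rep_module C R N"
  shows "graded_module skew_ob (skew_index C R) (skew_hom C R) skew_src skew_tgt skew_ic skew_mc
    skew_iu skew_un (fiber N) (skew_act N)"
proof (intro graded_module.intro graded_module_axioms.intro graded_category_skew)
  fix p assume "p \<in> skew_ob"
  then obtain i x where p: "p = (i, x)" and i: "i \<in> obj C" and x: "x \<in> obj (rcat R i)"
    by (auto simp: skew_ob_def)
  show "comm_group (fiber N p)"
    using comm_group_fiber[OF N i x] by (simp add: p fiber_def)
  show "skew_act N (skew_iu p) (skew_un p) m = m" if "m \<in> carrier (fiber N p)" for m
    using skew_act_eta[OF N i x] that by (simp add: p fiber_def skew_iu_def skew_un_def)
next
  fix q assume "q \<in> skew_index C R"
  moreover obtain a x y where q: "q = (a, x, y)" by (cases q)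
  ultimately have q': "(a, x, y) \<in> skew_index C R" by simp
  note a = skew_indexD[OF q']
  have fib: "fiber N (skew_tgt q) = fobj (mfun N (tgt C a)) y" "fiber N (skew_src q) = fobj
      (mfun N (src C a)) x"
    by (simp_all add: q skew_src_def skew_tgt_def fiber_def)
  have H: "carrier (skew_hom C R q) = homset (rcat R (tgt C a)) (fobj (rfun R a) x) y"
    by (simp add: q skew_hom_simps)
  show hom: "skew_act N q f \<in> hom (fiber N (skew_tgt q)) (fiber N (skew_src q))" if "f \<in> carrier
      (skew_hom C R q)" for f
    unfolding fib unfolding q using skew_act_hom[OF N a(1,2)] that by (simp add: H)
  show "(\<lambda>f. skew_act N q f m) \<in> hom (skew_hom C R q) (fiber N (skew_src q))"
    if m: "m \<in> carrier (fiber N (skew_tgt q))" for m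
  proof (rule homI)
    fix f g assume f: "f \<in> carrier (skew_hom C R q)" and g: "g \<in> carrier (skew_hom C R q)"
    show "skew_act N q (f \<otimes>\<^bsub>skew_hom C R q\<^esub> g) m = skew_act N q f m \<otimes>\<^bsub>fiber N (skew_src q)\<^esub> skew_act N q
        g m"
      unfolding fib unfolding q skew_hom_simps
      by (rule skew_act_padd[OF N a(1,2) f[unfolded H] g[unfolded H] m[unfolded fib]])
  qed (rule hom_in_carrier[OF hom m])
next
  fix q p g f m assume "q \<in> skew_index C R" "p \<in> skew_index C R" "skew_src q = skew_tgt p"
    and g: "g \<in> carrier (skew_hom C R q)" and f: "f \<in> carrier (skew_hom C R p)"
    and m: "m \<in> carrier (fiber N (skew_tgt q))"
  moreover obtain b y' z a x y where q: "q = (b, y', z)" and p: "p = (a, x, y)" by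
      (cases q, cases p)
  ultimately have q': "(b, y', z) \<in> skew_index C R" and p': "(a, x, y) \<in> skew_index C R"
    and comp: "skew_src (b, y', z) = skew_tgt (a, x, y)" by simp_all
  note a = skew_indexD[OF p'] and b = skew_composable[OF q' p' comp]
  show "skew_act N (skew_ic q p) (skew_mc q g p f) m = skew_act N p f (skew_act N q g m)"
    using skew_act_gcmp[OF N a(1) b(1) a(2), of f y g z m] f g m
    by (simp add: q p skew_ic_def skew_mc_def skew_hom_simps skew_tgt_def fiber_def b(2))
qed

section \<open>From graded modules back to right modules over the representation\<close>

definition rep_of :: "('i \<times> 'x \<Rightarrow> 'u monoid) \<Rightarrow> ('c \<times> 'x \<times> 'x \<Rightarrow> 'f \<Rightarrow> 'u \<Rightarrow> 'u) \<Rightarrow> ('i, 'c, 'x, 'f, 'u)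
    rep_mod" where
  "rep_of K \<alpha> = \<lparr>
     mfun = (\<lambda>i. \<lparr>fobj = (\<lambda>x. K (i, x)),
       farr = (\<lambda>f. let x = src (rcat R i) f; y = tgt (rcat R i) f in
         ab_arrow (K (i, y)) (K (i, x)) (\<alpha> (idn C i, x, y) (f \<cdot>\<^bsub>rcat R i\<^esub> eta R i x)))\<rparr>),
     mtr = (\<lambda>a x. let y = fobj (rfun R a) x in
       ab_arrow (K (tgt C a, y)) (K (src C a, x)) (\<alpha> (a, x, y) (idn (rcat R (tgt C a)) y)))\<rparr>"

lemma fiber_rep_of: "fiber (rep_of K \<alpha>) = K"
  by (auto simp: fiber_def rep_of_def)

context
  fixes K :: "'i \<times> 'x \<Rightarrow> 'u monoid" and \<alpha>
  assumes K: "graded_module skew_ob (skew_index C R) (skew_hom C R) skew_src skew_tgt skew_ic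
      skew_mc
    skew_iu skew_un K \<alpha>"
begin

interpretation K: graded_module skew_ob "skew_index C R" "skew_hom C R" skew_src skew_tgt skew_ic
    skew_mc
    skew_iu skew_un K \<alpha> by (rule K)

lemma alpha_hom:
  assumes a: "a \<in> homset C i j" and x: "x \<in> obj (rcat R i)"
    and f: "f \<in> homset (rcat R j) (fobj (rfun R a) x) y"
  shows "\<alpha> (a, x, y) f \<in> hom (K (j, y)) (K (i, x))"
  using K.\<alpha>_hom[OF skew_indexI[OF a x category.homset_obj(2)[OF
      rcat_category[OF homset_obj(2)[OF a]] f]]] f
  by (simp add: skew_hom_simps skew_src_def skew_tgt_def homsetD[OF a])

lemma alpha_gcmp:
  assumes a: "a \<in> homset C i j" and b: "b \<in> homset C j k" and x: "x \<in> obj (rcat R i)"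
    and f: "f \<in> homset (rcat R j) (fobj (rfun R a) x) y"
    and g: "g \<in> homset (rcat R k) (fobj (rfun R b) y) z"
    and m: "m \<in> carrier (K (k, z))"
  shows "\<alpha> (b \<cdot> a, x, z) (gcmp b g a x f) m = \<alpha> (a, x, y) f (\<alpha> (b, y, z) g m)"
proof -
  have y: "y \<in> obj (rcat R j)" and z: "z \<in> obj (rcat R k)"
    using category.homset_obj(2)[OF rcat_category[OF homset_obj(2)[OF a]] f]
      category.homset_obj(2)[OF rcat_category[OF homset_obj(2)[OF b]] g] by auto
  show ?thesis
    using K.\<alpha>_comp[OF skew_indexI[OF b y z] skew_indexI[OF a x y], of g f m] f g m
    by (simp add: skew_simps skew_hom_simps homsetD[OF a] homsetD[OF b])
qed

lemma K_comm_group: "\<lbrakk>i \<in> obj C; x \<in> obj (rcat R i)\<rbrakk> \<Longrightarrow> comm_group (K (i, x))"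
  by (rule K.K_comm[OF skew_obI])

lemma farr_rep_of:
  assumes i: "i \<in> obj C" and f: "f \<in> homset (rcat R i) x y"
  shows "farr (mfun (rep_of K \<alpha>) i) f \<in> homset Ab (K (i, y)) (K (i, x))"
    "m \<in> carrier (K (i, y)) \<Longrightarrow> amap (farr (mfun (rep_of K \<alpha>) i) f) m = \<alpha> (idn C i, x, y)
        (f \<cdot>\<^bsub>rcat R i\<^esub> eta R i x) m"
proof -
  interpret I: category "rcat R i" by (rule rcat_category[OF i])
  have x: "x \<in> obj (rcat R i)" and y: "y \<in> obj (rcat R i)" using I.homset_obj[OF f] by auto
  have eq: "farr (mfun (rep_of K \<alpha>) i) f =
      ab_arrow (K (i, y)) (K (i, x)) (\<alpha> (idn C i, x, y) (f \<cdot>\<^bsub>rcat R i\<^esub> eta R i x))"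
    using homsetD[OF f] by (simp add: rep_of_def Let_def)
  show "farr (mfun (rep_of K \<alpha>) i) f \<in> homset Ab (K (i, y)) (K (i, x))"
    unfolding eq by (rule ab_arrow_homset[OF K_comm_group[OF i y] K_comm_group[OF i x]
          alpha_hom[OF idn_homset[OF i] x I.cmp_homset[OF eta_delta(1)[OF i x] f]]])
  show "m \<in> carrier (K (i, y)) \<Longrightarrow> amap (farr (mfun (rep_of K \<alpha>) i) f) m = \<alpha> (idn C i, x, y)
      (f \<cdot>\<^bsub>rcat R i\<^esub> eta R i x) m"
    unfolding eq by (rule amap_ab_arrow)
qed

lemma mtr_rep_of:
  assumes a: "a \<in> homset C i j" and x: "x \<in> obj (rcat R i)"
  shows "mtr (rep_of K \<alpha>) a x \<in> homset Ab (K (j, fobj (rfun R a) x)) (K (i, x))"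
    "m \<in> carrier (K (j, fobj (rfun R a) x)) \<Longrightarrow> amap (mtr (rep_of K \<alpha>) a x) m =
      \<alpha> (a, x, fobj (rfun R a) x) (idn (rcat R j) (fobj (rfun R a) x)) m"
proof -
  interpret J: category "rcat R j" by (rule rcat_category[OF homset_obj(2)[OF a]])
  note ax = rfun_obj[OF a x]
  have eq: "mtr (rep_of K \<alpha>) a x = ab_arrow (K (j, fobj (rfun R a) x)) (K (i, x))
      (\<alpha> (a, x, fobj (rfun R a) x) (idn (rcat R j) (fobj (rfun R a) x)))"
    using homsetD[OF a] by (simp add: rep_of_def Let_def)
  show "mtr (rep_of K \<alpha>) a x \<in> homset Ab (K (j, fobj (rfun R a) x)) (K (i, x))"
    unfolding eq by (rule ab_arrow_homset[OF K_comm_group[OF homset_obj(2)[OF a] ax]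
          K_comm_group[OF homset_obj(1)[OF a] x] alpha_hom[OF a x J.idn_homset[OF ax]]])
  show "m \<in> carrier (K (j, fobj (rfun R a) x)) \<Longrightarrow> amap (mtr (rep_of K \<alpha>) a x) m =
      \<alpha> (a, x, fobj (rfun R a) x) (idn (rcat R j) (fobj (rfun R a) x)) m"
    unfolding eq by (rule amap_ab_arrow)
qed

text \<open>In the graded category, the embedded arrow \<open>g\<close> times \<open>f\<close> is
  the plain composite, by \<open>gcmp_eta_left\<close>. Since the new \<open>M\<^sub>j(g)\<close> is
  the action of the embedded arrow, this one rule covers most computations with
  \<open>rep_of\<close>.\<close>

lemma alpha_post:
  assumes a: "a \<in> homset C i j" and x: "x \<in> obj (rcat R i)"
    and f: "f \<in> homset (rcat R j) (fobj (rfun R a) x) y" and g: "g \<in> homset (rcat R j) y z"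
    and m: "m \<in> carrier (K (j, z))"
  shows "\<alpha> (a, x, y) f (amap (farr (mfun (rep_of K \<alpha>) j) g) m) = \<alpha> (a, x, z) (g \<cdot>\<^bsub>rcat R j\<^esub> f) m"
proof -
  have j: "j \<in> obj C" by (rule homset_obj(2)[OF a])
  interpret J: category "rcat R j" by (rule rcat_category[OF j])
  have y: "y \<in> obj (rcat R j)" by (rule J.homset_obj(2)[OF f])
  have ge: "g \<cdot>\<^bsub>rcat R j\<^esub> eta R j y \<in> homset (rcat R j) (fobj (rfun R (idn C j)) y) z"
    by (rule J.cmp_homset[OF eta_delta(1)[OF j y] g])
  show ?thesis
    unfolding farr_rep_of(2)[OF j g m] alpha_gcmp[OF a idn_homset[OF j] x f ge m, symmetric]
      gcmp_eta_left[OF a x f g] idn_cmp[OF a] ..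
qed

lemma additive_functor_rep_of:
  assumes i: "i \<in> obj C"
  shows "additive_functor (opp (rcat R i)) Ab (mfun (rep_of K \<alpha>) i)"
proof -
  interpret I: preadditive "rcat R i" by (rule rcat_preadditive[OF i])
  have fobj: "fobj (mfun (rep_of K \<alpha>) i) x = K (i, x)" for x
    by (simp add: rep_of_def)
  let ?F = "farr (mfun (rep_of K \<alpha>) i)"
  note one = idn_homset[OF i]
  have "cat_functor (opp (rcat R i)) Ab (mfun (rep_of K \<alpha>) i)"
  proof (intro cat_functor.intro cat_functor_axioms.intro category_Ab
      preadditive.axioms(1)[OF preadditive_opp[OF rcat_preadditive[OF i]]], unfold opp_simps fobj)
    fix x assume x: "x \<in> obj (rcat R i)"
    show "K (i, x) \<in> obj Ab"
      using K_comm_group[OF i x] by (simp add: obj_Ab)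
    note G = idn_Ab_homset[OF K_comm_group[OF i x]] and id = I.idn_homset[OF x]
    show "?F (idn (rcat R i) x) = idn Ab (K (i, x))"
    proof (rule Ab_eqI[OF farr_rep_of(1)[OF i id] G])
      fix m assume m: "m \<in> carrier (K (i, x))"
      show "amap (?F (idn (rcat R i) x)) m = amap (idn Ab (K (i, x))) m"
        using K.\<alpha>_one[OF skew_obI[OF i x] m]
        by (simp add: farr_rep_of(2)[OF i id m] I.idn_cmp[OF eta_delta(1)[OF i x]] amap_idn_Ab[OF m]
            skew_iu_def skew_un_def)
    qed
  next
    fix f x y assume "f \<in> homset (rcat R i) y x"
    then show "?F f \<in> homset Ab (K (i, x)) (K (i, y))" by (rule farr_rep_of(1)[OF i])
  next
    fix f g x y z assume f: "f \<in> homset (rcat R i) y x" and g: "g \<in> homset (rcat R i) z y"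
    have z: "z \<in> obj (rcat R i)" by (rule I.homset_obj(1)[OF g])
    note ge = I.cmp_homset[OF eta_delta(1)[OF i z] g] and fg = I.cmp_homset[OF g f]
    show "?F (f \<cdot>\<^bsub>rcat R i\<^esub> g) = ?F g \<cdot>\<^bsub>Ab\<^esub> ?F f"
    proof (rule Ab_eqI[OF farr_rep_of(1)[OF i fg]
        cmp_Ab_homset[OF farr_rep_of(1)[OF i f] farr_rep_of(1)[OF i g]]])
      fix m assume m: "m \<in> carrier (K (i, x))"
      have "amap (?F g \<cdot>\<^bsub>Ab\<^esub> ?F f) m = \<alpha> (idn C i, z, y) (g \<cdot>\<^bsub>rcat R i\<^esub> eta R i z) (amap (?F f) m)"
        unfolding amap_cmp_Ab[OF farr_rep_of(1)[OF i f] m]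
        by (rule farr_rep_of(2)[OF i g Ab_homD(2)[OF farr_rep_of(1)[OF i f] m]])
      \<comment> \<open>\<open>alpha_post\<close> applied to the embedded arrow
        \<open>g \<circ> \<eta>\<close> yields \<open>f \<circ> (g \<circ> \<eta>)\<close>, which is
        the embedding of \<open>f \<circ> g\<close>.\<close>
      also have "\<dots> = amap (?F (f \<cdot>\<^bsub>rcat R i\<^esub> g)) m"
        unfolding alpha_post[OF one z ge f m] farr_rep_of(2)[OF i fg m]
          I.cmp_assoc[OF eta_delta(1)[OF i z] g f] ..
      finally show "amap (?F (f \<cdot>\<^bsub>rcat R i\<^esub> g)) m = amap (?F g \<cdot>\<^bsub>Ab\<^esub> ?F f) m" ..
    qed
  qed
  moreover have "?F (padd (rcat R i) f g) = padd Ab (?F f) (?F g)"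
    if f: "f \<in> homset (rcat R i) y x" and g: "g \<in> homset (rcat R i) y x" for f g x y
  proof -
    have x: "x \<in> obj (rcat R i)" and y: "y \<in> obj (rcat R i)" using I.homset_obj[OF f] by auto
    have fg: "padd (rcat R i) f g \<in> homset (rcat R i) y x"
      using comm_groupE(1)[OF I.hom_comm_group[OF y x]] f g by (simp add: hom_group_def)
    note eta = eta_delta(1)[OF i y]
    show ?thesis
    proof (rule Ab_eqI[OF farr_rep_of(1)[OF i fg]
        padd_Ab_homset[OF farr_rep_of(1)[OF i f] farr_rep_of(1)[OF i g]]])
      fix m assume m: "m \<in> carrier (K (i, x))"
      \<comment> \<open>Embedding is precomposition with \<open>\<eta>\<close> and hence additive,
        so additivity of the functor comes from additivity of \<open>\<alpha>\<close> in degree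
        \<open>1\<^sub>i\<close>.\<close>
      have "(\<lambda>f. \<alpha> (idn C i, y, x) f m) \<in> hom (skew_hom C R (idn C i, y, x)) (K (i, y))"
        using K.\<alpha>_add[OF skew_indexI[OF one y x], of m] m homsetD[OF one] by (simp add: skew_simps)
      from hom_mult[OF this, of "f \<cdot>\<^bsub>rcat R i\<^esub> eta R i y" "g \<cdot>\<^bsub>rcat R i\<^esub> eta R i y"]
      have "\<alpha> (idn C i, y, x) (padd (rcat R i) (f \<cdot>\<^bsub>rcat R i\<^esub> eta R i y) (g \<cdot>\<^bsub>rcat R i\<^esub> eta R i y)) m =
          \<alpha> (idn C i, y, x) (f \<cdot>\<^bsub>rcat R i\<^esub> eta R i y) m \<otimes>\<^bsub>K (i, y)\<^esub> \<alpha> (idn C i, y, x)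
              (g \<cdot>\<^bsub>rcat R i\<^esub> eta R i y) m"
        using I.cmp_homset[OF eta f] I.cmp_homset[OF eta g] homsetD[OF one] by
            (simp add: skew_hom_simps)
      then show "amap (?F (padd (rcat R i) f g)) m = amap (padd Ab (?F f) (?F g)) m"
        by (simp only: farr_rep_of(2)[OF i fg m] amap_padd_Ab[OF farr_rep_of(1)[OF i f] m]
            farr_rep_of(2)[OF i f m] farr_rep_of(2)[OF i g m] I.cmp_padd_left[OF eta f g])
    qed
  qed
  ultimately show ?thesis
    by (intro additive_functor.intro additive_functor_axioms.intro preadditive_Ab
        preadditive_opp[OF rcat_preadditive[OF i]]) (simp_all add: opp_simps)
qed

text \<open>In each law both sides turn out to be the action of the same arrow in a single degree:
  \<open>R(a)f\<close> in degree \<open>a\<close> for naturality, \<open>\<theta>\<close> in degree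
  \<open>ba\<close> for (Mod.1), and \<open>\<eta>\<close> in degree \<open>1\<^sub>i\<close> for
  (Mod.2), where it is a unit and acts as the identity.\<close>

lemma right_rep_module_rep_of: "right_rep_module C R (rep_of K \<alpha>)"
proof (intro right_rep_module.intro right_rep_module_axioms.intro representation_axioms
    additive_functor_rep_of)
  have fobj: "fobj (mfun (rep_of K \<alpha>) i) x = K (i, x)" for i x
    by (simp add: rep_of_def)
  let ?F = "\<lambda>i. farr (mfun (rep_of K \<alpha>) i)" and ?T = "mtr (rep_of K \<alpha>)"
  {
    fix a i j assume a: "a \<in> homset C i j"
    have i: "i \<in> obj C" and j: "j \<in> obj C" using homset_obj[OF a] by auto
    interpret I: category "rcat R i" by (rule rcat_category[OF i])
    interpret J: category "rcat R j" by (rule rcat_category[OF j])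
    have Fi: "cat_functor (opp (rcat R i)) Ab (mfun (rep_of K \<alpha>) i)"
      and Fj: "cat_functor (opp (rcat R j)) Ab (mfun (rep_of K \<alpha>) j)"
      using additive_functor.axioms(3)[OF additive_functor_rep_of] i j by blast+
    have "cat_functor (opp (rcat R i)) (opp (rcat R j)) (rfun R a)"
      by (rule cat_functor_opp[OF rcat_preadditive[OF i] rcat_preadditive[OF j] rfun_functor[OF a]])
    from cat_functor_comp[OF this Fj] Fi
    show "nat_transf (opp (rcat R i)) Ab (mfun (rep_of K \<alpha>) j \<circ>\<^sub>F rfun R a) (mfun (rep_of K \<alpha>) i)
        (?T a)"
    proof (intro nat_transf.intro nat_transf_axioms.intro, unfold opp_simps)
      fix x assume x: "x \<in> obj (rcat R i)"
      show "?T a x \<in> homset Ab (fobj (mfun (rep_of K \<alpha>) j \<circ>\<^sub>F rfun R a) x)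
          (fobj (mfun (rep_of K \<alpha>) i) x)"
        using mtr_rep_of(1)[OF a x] by (simp add: comp_fctr_def fobj)
    next
      fix f x y assume f: "f \<in> homset (rcat R i) y x"
      have x: "x \<in> obj (rcat R i)" and y: "y \<in> obj (rcat R i)" using I.homset_obj[OF f] by auto
      note Rf = rfun_homset[OF a f] and ax = rfun_obj[OF a x] and ay = rfun_obj[OF a y]
      note FRf = farr_rep_of(1)[OF j Rf] and Tx = mtr_rep_of(1)[OF a x] and Ty =
          mtr_rep_of(1)[OF a y]
        and Ff = farr_rep_of(1)[OF i f]
      have "?T a y \<cdot>\<^bsub>Ab\<^esub> ?F j (farr (rfun R a) f) = ?F i f \<cdot>\<^bsub>Ab\<^esub> ?T a x"
      proof (rule Ab_eqI[OF cmp_Ab_homset[OF FRf Ty] cmp_Ab_homset[OF Tx Ff]])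
        fix m assume m: "m \<in> carrier (K (j, fobj (rfun R a) x))"
        have "amap (?T a y \<cdot>\<^bsub>Ab\<^esub> ?F j (farr (rfun R a) f)) m = \<alpha> (a, y, fobj (rfun R a) x)
            (farr (rfun R a) f) m"
          unfolding amap_cmp_Ab[OF FRf m] mtr_rep_of(2)[OF a y Ab_homD(2)[OF FRf m]]
            alpha_post[OF a y J.idn_homset[OF ay] Rf m] J.cmp_idn[OF Rf] ..
        also have "\<dots> = amap (?F i f \<cdot>\<^bsub>Ab\<^esub> ?T a x) m"
          unfolding amap_cmp_Ab[OF Tx m] farr_rep_of(2)[OF i f Ab_homD(2)[OF Tx m]]
          unfolding mtr_rep_of(2)[OF a x m]
            alpha_gcmp[OF idn_homset[OF i] a y I.cmp_homset[OF eta_delta(1)[OF i y] f]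
                J.idn_homset[OF ax] m, symmetric]
            gcmp_eta_right[OF a J.idn_homset[OF ax] f] J.idn_cmp[OF Rf] cmp_idn[OF a] ..
        finally show "amap (?T a y \<cdot>\<^bsub>Ab\<^esub> ?F j (farr (rfun R a) f)) m = amap (?F i f \<cdot>\<^bsub>Ab\<^esub> ?T a x) m" .
      qed
      then show "?T a y \<cdot>\<^bsub>Ab\<^esub> farr (mfun (rep_of K \<alpha>) j \<circ>\<^sub>F rfun R a) f = ?F i f \<cdot>\<^bsub>Ab\<^esub> ?T a x"
        by (simp add: comp_fctr_def)
    qed
    fix b k x assume b: "b \<in> homset C j k" and x: "x \<in> obj (rcat R i)"
    have k: "k \<in> obj C" by (rule homset_obj(2)[OF b])
    interpret K: category "rcat R k" by (rule rcat_category[OF k])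
    note ba = cmp_homset[OF a b] and ax = rfun_obj[OF a x] and th = theta_mu(1)[OF a b x]
    note bax = rfun_obj[OF b ax] and bax' = rfun_obj[OF ba x]
    note Ta = mtr_rep_of(1)[OF a x] and Tb = mtr_rep_of(1)[OF b ax] and Tba = mtr_rep_of(1)[OF ba x]
      and Fth = farr_rep_of(1)[OF k th]
    show "?T a x \<cdot>\<^bsub>Ab\<^esub> ?T b (fobj (rfun R a) x) = ?T (b \<cdot> a) x \<cdot>\<^bsub>Ab\<^esub> ?F k (theta C R b a x)"
    proof (rule Ab_eqI[OF cmp_Ab_homset[OF Tb Ta] cmp_Ab_homset[OF Fth Tba]])
      fix m assume m: "m \<in> carrier (K (k, fobj (rfun R b) (fobj (rfun R a) x)))"
      have "amap (?T a x \<cdot>\<^bsub>Ab\<^esub> ?T b (fobj (rfun R a) x)) m =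
          \<alpha> (b \<cdot> a, x, fobj (rfun R b) (fobj (rfun R a) x)) (theta C R b a x) m"
        unfolding amap_cmp_Ab[OF Tb m] mtr_rep_of(2)[OF a x Ab_homD(2)[OF Tb m]]
          unfolding mtr_rep_of(2)[OF b ax m]
          alpha_gcmp[OF a b x J.idn_homset[OF ax] K.idn_homset[OF bax] m, symmetric]
          gcmp_idn_right[OF a b x K.idn_homset[OF bax]] K.idn_cmp[OF th] ..
      also have "\<dots> = amap (?T (b \<cdot> a) x \<cdot>\<^bsub>Ab\<^esub> ?F k (theta C R b a x)) m"
        unfolding amap_cmp_Ab[OF Fth m] mtr_rep_of(2)[OF ba x Ab_homD(2)[OF Fth m]]
          alpha_post[OF ba x K.idn_homset[OF bax'] th m] K.cmp_idn[OF th] ..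
      finally show "amap (?T a x \<cdot>\<^bsub>Ab\<^esub> ?T b (fobj (rfun R a) x)) m =
          amap (?T (b \<cdot> a) x \<cdot>\<^bsub>Ab\<^esub> ?F k (theta C R b a x)) m" .
    qed
  }
  fix i x assume i: "i \<in> obj C" and x: "x \<in> obj (rcat R i)"
  interpret I: category "rcat R i" by (rule rcat_category[OF i])
  note one = idn_homset[OF i]
  note ox = rfun_obj[OF one x] and eta = eta_delta(1)[OF i x]
  note T = mtr_rep_of(1)[OF one x] and Fe = farr_rep_of(1)[OF i eta]
  show "?T (idn C i) x \<cdot>\<^bsub>Ab\<^esub> ?F i (eta R i x) = idn Ab (fobj (mfun (rep_of K \<alpha>) i) x)"
    unfolding fobj
  proof (rule Ab_eqI[OF cmp_Ab_homset[OF Fe T] idn_Ab_homset[OF K_comm_group[OF i x]]])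
    fix m assume m: "m \<in> carrier (K (i, x))"
    have "amap (?T (idn C i) x \<cdot>\<^bsub>Ab\<^esub> ?F i (eta R i x)) m = \<alpha> (idn C i, x, x) (eta R i x) m"
      unfolding amap_cmp_Ab[OF Fe m] mtr_rep_of(2)[OF one x Ab_homD(2)[OF Fe m]]
        alpha_post[OF one x I.idn_homset[OF ox] eta m] I.cmp_idn[OF eta] ..
    also have "\<dots> = amap (idn Ab (K (i, x))) m"
      using K.\<alpha>_one[OF skew_obI[OF i x] m] by (simp add: skew_iu_def skew_un_def amap_idn_Ab[OF m])
    finally show "amap (?T (idn C i) x \<cdot>\<^bsub>Ab\<^esub> ?F i (eta R i x)) m = amap (idn Ab (K (i, x))) m" .
  qed
qed

text \<open>The round trip: a generator factors into its two special kinds, whose actions define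
  \<open>rep_of\<close>, and \<open>alpha_post\<close> multiplies them together again.\<close>

lemma skew_act_rep_of:
  assumes q: "q \<in> skew_index C R" and f: "f \<in> carrier (skew_hom C R q)" and m: "m \<in> carrier
      (K (skew_tgt q))"
  shows "skew_act (rep_of K \<alpha>) q f m = \<alpha> q f m"
proof -
  obtain a x y where q': "q = (a, x, y)" by (cases q)
  note a = skew_indexD[OF q[unfolded q']]
  have j: "tgt C a \<in> obj C" by (rule homset_obj(2)[OF a(1)])
  interpret J: category "rcat R (tgt C a)" by (rule rcat_category[OF j])
  have f: "f \<in> homset (rcat R (tgt C a)) (fobj (rfun R a) x) y" and m: "m \<in> carrier
      (K (tgt C a, y))"
    using f m by (simp_all add: q' skew_hom_simps skew_tgt_def)
  show ?thesis
    unfolding q' skew_act_def prod.case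
      mtr_rep_of(2)[OF a(1,2) Ab_homD(2)[OF farr_rep_of(1)[OF j f] m]]
      alpha_post[OF a(1,2) J.idn_homset[OF rfun_obj[OF a(1,2)]] f m] J.cmp_idn[OF f] ..
qed

end

end

section \<open>The categories of modules\<close>

lemma homset_Mod_ring: "f \<in> homset (Mod_ring A) M N \<longleftrightarrow> asrc f = M \<and> atgt f = N \<and>
    right_module A M \<and> right_module A N \<and> rmod_hom A M N (amap f) \<and> amap f \<in> extensional
        (carrier M)"
  by (cases f) (auto simp: homset_def Mod_ring_def rmod_hom_def)

lemma Mod_ring_eqI:
  assumes "f \<in> homset (Mod_ring A) M N" "g \<in> homset (Mod_ring A) M N"
    and "\<And>m. m \<in> carrier M \<Longrightarrow> amap f m = amap g m"
  shows "f = g"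
  using assms by (intro arrow.expand conjI) (auto simp: homset_Mod_ring intro: extensionalityI)

lemma Mod_ring_arrow:
  assumes M: "right_module A M" and N: "right_module A N" and h: "rmod_hom A M N h"
  shows "Arrow M N (restrict h (carrier M)) \<in> homset (Mod_ring A) M N"
  using assms rmod_hom_cong[OF M h, of "restrict h (carrier M)"] by (simp add: homset_Mod_ring)

lemma cmp_Mod_ring:
  assumes f: "f \<in> homset (Mod_ring A) L M" and g: "g \<in> homset (Mod_ring A) M N"
  shows "g \<cdot>\<^bsub>Mod_ring A\<^esub> f \<in> homset (Mod_ring A) L N"
    "m \<in> carrier L \<Longrightarrow> amap (g \<cdot>\<^bsub>Mod_ring A\<^esub> f) m = amap g (amap f m)"
proof -
  have f': "right_module A L" "rmod_hom A L M (amap f)" "asrc f = L"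
    and g': "right_module A N" "rmod_hom A M N (amap g)" "atgt g = N"
    using f g unfolding homset_Mod_ring by blast+
  have eq: "g \<cdot>\<^bsub>Mod_ring A\<^esub> f = Arrow L N (restrict (\<lambda>m. amap g (amap f m)) (carrier L))"
    using f'(3) g'(3) by (simp add: Mod_ring_def compose_def)
  show "g \<cdot>\<^bsub>Mod_ring A\<^esub> f \<in> homset (Mod_ring A) L N"
    unfolding eq by (rule Mod_ring_arrow[OF f'(1) g'(1) rmod_hom_comp[OF f'(2) g'(2)]])
  show "m \<in> carrier L \<Longrightarrow> amap (g \<cdot>\<^bsub>Mod_ring A\<^esub> f) m = amap g (amap f m)"
    by (simp add: eq)
qed

lemma idn_Mod_ring:
  assumes M: "right_module A M"
  shows "idn (Mod_ring A) M \<in> homset (Mod_ring A) M M"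
    "m \<in> carrier M \<Longrightarrow> amap (idn (Mod_ring A) M) m = m"
proof -
  have eq: "idn (Mod_ring A) M = Arrow M M (restrict (\<lambda>m. m) (carrier M))"
    by (simp add: Mod_ring_def)
  show "idn (Mod_ring A) M \<in> homset (Mod_ring A) M M"
    unfolding eq by (rule Mod_ring_arrow[OF M M]) (auto simp: rmod_hom_def hom_def)
  show "m \<in> carrier M \<Longrightarrow> amap (idn (Mod_ring A) M) m = m"
    by (simp add: eq)
qed

lemma Mod_ring_amap_closed: "\<lbrakk>f \<in> homset (Mod_ring A) M N; m \<in> carrier M\<rbrakk> \<Longrightarrow> amap f m \<in> carrier N"
  unfolding homset_Mod_ring by (blast intro: rmod_homD(3))

lemma category_Mod_ring: "category (Mod_ring A)"
proof
  fix f assume "f \<in> arr (Mod_ring A)"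
  then have "f \<in> homset (Mod_ring A) (src (Mod_ring A) f) (tgt (Mod_ring A) f)"
    by (simp add: homset_def)
  then show "src (Mod_ring A) f \<in> obj (Mod_ring A)" "tgt (Mod_ring A) f \<in> obj (Mod_ring A)"
    unfolding homset_Mod_ring by (simp_all add: Mod_ring_def)
next
  fix M assume "M \<in> obj (Mod_ring A)"
  then show "idn (Mod_ring A) M \<in> homset (Mod_ring A) M M"
    by (intro idn_Mod_ring) (simp add: Mod_ring_def)
next
  fix f g L M N assume "f \<in> homset (Mod_ring A) L M" "g \<in> homset (Mod_ring A) M N"
  then show "g \<cdot>\<^bsub>Mod_ring A\<^esub> f \<in> homset (Mod_ring A) L N" by (rule cmp_Mod_ring)
next
  fix f M N assume f: "f \<in> homset (Mod_ring A) M N"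
  then have "right_module A M" "right_module A N" unfolding homset_Mod_ring by blast+
  note M = idn_Mod_ring[OF this(1)] and N = idn_Mod_ring[OF this(2)]
  show "f \<cdot>\<^bsub>Mod_ring A\<^esub> idn (Mod_ring A) M = f"
    by (rule Mod_ring_eqI[OF cmp_Mod_ring(1)[OF M(1) f] f])
        (simp add: cmp_Mod_ring(2)[OF M(1) f] M(2))
  show "idn (Mod_ring A) N \<cdot>\<^bsub>Mod_ring A\<^esub> f = f"
    by (rule Mod_ring_eqI[OF cmp_Mod_ring(1)[OF f N(1)] f])
      (simp add: cmp_Mod_ring(2)[OF f N(1)] N(2) Mod_ring_amap_closed[OF f])
next
  fix f g h K L M N
  assume f: "f \<in> homset (Mod_ring A) K L" and g: "g \<in> homset (Mod_ring A) L M"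
    and h: "h \<in> homset (Mod_ring A) M N"
  note gf = cmp_Mod_ring[OF f g] and hg = cmp_Mod_ring[OF g h]
  show "h \<cdot>\<^bsub>Mod_ring A\<^esub> (g \<cdot>\<^bsub>Mod_ring A\<^esub> f) = h \<cdot>\<^bsub>Mod_ring A\<^esub> g \<cdot>\<^bsub>Mod_ring A\<^esub> f"
    by (rule Mod_ring_eqI[OF cmp_Mod_ring(1)[OF gf(1) h] cmp_Mod_ring(1)[OF f hg(1)]])
      (simp add: cmp_Mod_ring(2)[OF gf(1) h] cmp_Mod_ring(2)[OF f hg(1)] gf(2) hg(2)
        Mod_ring_amap_closed[OF f])
qed

lemma is_iso_Mod_ring:
  assumes M: "right_module A M" and N: "right_module A N" and h: "rmod_hom A M N h"
    and bij: "bij_betw h (carrier M) (carrier N)"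
  shows "is_iso (Mod_ring A) (Arrow M N (restrict h (carrier M)))" (is "is_iso _ ?f")
proof -
  interpret category "Mod_ring A" by (rule category_Mod_ring)
  define k where "k = inv_into (carrier M) h"
  define g where "g = Arrow N M (restrict k (carrier N))"
  have f: "?f \<in> homset (Mod_ring A) M N" by (rule Mod_ring_arrow[OF M N h])
  have g: "g \<in> homset (Mod_ring A) N M"
    unfolding g_def k_def by (rule Mod_ring_arrow[OF N M rmod_hom_inv[OF M h bij]])
  have hk: "n \<in> carrier N \<Longrightarrow> k n \<in> carrier M" "n \<in> carrier N \<Longrightarrow> h (k n) = n"
    "m \<in> carrier M \<Longrightarrow> h m \<in> carrier N" "m \<in> carrier M \<Longrightarrow> k (h m) = m" for m n
    using bij by (auto simp: k_def bij_betw_def f_inv_into_f inv_into_into)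
  show ?thesis
  proof (rule is_isoI[OF f g])
    show "g \<cdot>\<^bsub>Mod_ring A\<^esub> ?f = idn (Mod_ring A) M"
      by (rule Mod_ring_eqI[OF cmp_Mod_ring(1)[OF f g] idn_Mod_ring(1)[OF M]])
        (simp add: cmp_Mod_ring(2)[OF f g] idn_Mod_ring(2)[OF M], simp add: g_def hk)
    show "?f \<cdot>\<^bsub>Mod_ring A\<^esub> g = idn (Mod_ring A) N"
      by (rule Mod_ring_eqI[OF cmp_Mod_ring(1)[OF g f] idn_Mod_ring(1)[OF N]])
        (simp add: cmp_Mod_ring(2)[OF g f] idn_Mod_ring(2)[OF N], simp add: g_def hk)
  qed
qed

text \<open>The family \<open>r\<close> only has to agree with the composite on objects, so that it
  may be a restricted family, as arrows of \<open>Mod_rep\<close> demand.\<close>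

lemma nat_transf_vcomp:
  assumes s: "nat_transf A B F G s" and t: "nat_transf A B G H t"
    and r: "\<And>x. x \<in> obj A \<Longrightarrow> r x = t x \<cdot>\<^bsub>B\<^esub> s x"
  shows "nat_transf A B F H r"
proof -
  interpret s: nat_transf A B F G s by fact
  interpret t: nat_transf A B G H t by fact
  show ?thesis
  proof
    fix x assume x: "x \<in> obj A"
    show "r x \<in> homset B (fobj F x) (fobj H x)"
      unfolding r[OF x] by (rule s.F.B.cmp_homset[OF s.component[OF x] t.component[OF x]])
  next
    fix f x y assume f: "f \<in> homset A x y"
    have x: "x \<in> obj A" and y: "y \<in> obj A" using s.F.A.homset_obj[OF f] by auto
    note Ff = s.F.farr_homset[OF f] and Gf = s.G.farr_homset[OF f] and Hf = t.G.farr_homset[OF f]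
      and sx = s.component[OF x] and sy = s.component[OF y] and tx = t.component[OF x] and ty =
          t.component[OF y]
    have "t y \<cdot>\<^bsub>B\<^esub> s y \<cdot>\<^bsub>B\<^esub> farr F f = t y \<cdot>\<^bsub>B\<^esub> (s y \<cdot>\<^bsub>B\<^esub> farr F f)"
      by (rule s.F.B.cmp_assoc[OF Ff sy ty, symmetric])
    also have "\<dots> = (t y \<cdot>\<^bsub>B\<^esub> farr G f) \<cdot>\<^bsub>B\<^esub> s x"
      unfolding s.natural[OF f] by (rule s.F.B.cmp_assoc[OF sx Gf ty])
    also have "\<dots> = farr H f \<cdot>\<^bsub>B\<^esub> (t x \<cdot>\<^bsub>B\<^esub> s x)"
      unfolding t.natural[OF f] by (rule s.F.B.cmp_assoc[OF sx tx Hf, symmetric])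
    finally show "r y \<cdot>\<^bsub>B\<^esub> farr F f = farr H f \<cdot>\<^bsub>B\<^esub> r x"
      unfolding r[OF x] r[OF y] .
  qed
qed

lemma nat_transf_idn:
  assumes F: "cat_functor A B F" and r: "\<And>x. x \<in> obj A \<Longrightarrow> r x = idn B (fobj F x)"
  shows "nat_transf A B F F r"
proof -
  interpret F: cat_functor A B F by fact
  show ?thesis
  proof
    fix x assume x: "x \<in> obj A"
    show "r x \<in> homset B (fobj F x) (fobj F x)"
      unfolding r[OF x] by (rule F.B.idn_homset[OF F.fobj_obj[OF x]])
  next
    fix f x y assume f: "f \<in> homset A x y"
    have x: "x \<in> obj A" and y: "y \<in> obj A" using F.A.homset_obj[OF f] by auto
    show "r y \<cdot>\<^bsub>B\<^esub> farr F f = farr F f \<cdot>\<^bsub>B\<^esub> r x"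
      unfolding r[OF x] r[OF y] F.B.cmp_idn[OF F.farr_homset[OF f]]
          F.B.idn_cmp[OF F.farr_homset[OF f]] ..
  qed
qed

section \<open>The category of right modules over a representation\<close>

context representation
begin

lemma homset_Mod_rep: "f \<in> homset (Mod_rep C R) M N \<longleftrightarrow> asrc f = M \<and> atgt f = N \<and>
    right_rep_module C R M \<and> right_rep_module C R N \<and> rep_mod_hom C R M N (amap f) \<and>
    amap f \<in> extensional (obj C) \<and> (\<forall>i\<in>obj C. amap f i \<in> extensional (obj (rcat R i)))"
  by (cases f) (auto simp: homset_def Mod_rep_def)

lemma Mod_rep_eqI:
  assumes f: "f \<in> homset (Mod_rep C R) M N" and g: "g \<in> homset (Mod_rep C R) M N"
    and eq: "\<And>i x. \<lbrakk>i \<in> obj C; x \<in> obj (rcat R i)\<rbrakk> \<Longrightarrow> amap f i x = amap g i x"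
  shows "f = g"
proof (rule arrow.expand, intro conjI)
  show "asrc f = asrc g" "atgt f = atgt g"
    using f g unfolding homset_Mod_rep by auto
  show "amap f = amap g"
  proof (rule extensionalityI[where A = "obj C"])
    show "amap f \<in> extensional (obj C)" "amap g \<in> extensional (obj C)"
      using f g unfolding homset_Mod_rep by auto
    fix i assume i: "i \<in> obj C"
    show "amap f i = amap g i"
      by (rule extensionalityI[where A = "obj (rcat R i)"])
          (use f g i eq in \<open>auto simp: homset_Mod_rep\<close>)
  qed
qed

lemma Mod_rep_component:
  "\<lbrakk>f \<in> homset (Mod_rep C R) M N; i \<in> obj C; x \<in> obj (rcat R i)\<rbrakk>
    \<Longrightarrow> amap f i x \<in> homset Ab (fobj (mfun M i) x) (fobj (mfun N i) x)"
  using nat_transf.component[of "opp (rcat R i)" Ab "mfun M i" "mfun N i" "amap f i"]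
  by (auto simp: homset_Mod_rep rep_mod_hom_def opp_simps)

text \<open>The compatibility square of the composite for \<open>a\<close> is pasted from the
  squares of \<open>\<phi>\<close> and \<open>\<psi>\<close>.\<close>

lemma rep_mod_hom_cmp:
  assumes L: "right_rep_module C R L" and M: "right_rep_module C R M" and N: "right_rep_module C R
      N"
    and f: "rep_mod_hom C R L M \<phi>" and g: "rep_mod_hom C R M N \<psi>"
    and eq: "\<And>i x. \<lbrakk>i \<in> obj C; x \<in> obj (rcat R i)\<rbrakk> \<Longrightarrow> \<chi> i x = \<psi> i x \<cdot>\<^bsub>Ab\<^esub> \<phi> i x"
  shows "rep_mod_hom C R L N \<chi>"
  unfolding rep_mod_hom_def
proof (intro conjI ballI allI)
  have \<phi>: "nat_transf (opp (rcat R i)) Ab (mfun L i) (mfun M i) (\<phi> i)"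
    and \<psi>: "nat_transf (opp (rcat R i)) Ab (mfun M i) (mfun N i) (\<psi> i)" if "i \<in> obj C" for i
    using f g that unfolding rep_mod_hom_def by blast+
  show "nat_transf (opp (rcat R i)) Ab (mfun L i) (mfun N i) (\<chi> i)" if i: "i \<in> obj C" for i
    by (rule nat_transf_vcomp[OF \<phi>[OF i] \<psi>[OF i]]) (simp add: opp_simps eq i)
  interpret Ab: category Ab by (rule category_Ab)
  fix i j a x assume a: "a \<in> homset C i j" and x: "x \<in> obj (rcat R i)"
  have i: "i \<in> obj C" and j: "j \<in> obj C" using homset_obj[OF a] by auto
  note ax = rfun_obj[OF a x]
  note \<phi>x = nat_transf.component[OF \<phi>[OF i], unfolded opp_simps, OF x]
    and \<psi>x = nat_transf.component[OF \<psi>[OF i], unfolded opp_simps, OF x]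
    and \<phi>ax = nat_transf.component[OF \<phi>[OF j], unfolded opp_simps, OF ax]
    and \<psi>ax = nat_transf.component[OF \<psi>[OF j], unfolded opp_simps, OF ax]
  note La = mtr_homset[OF L a x] and Ma = mtr_homset[OF M a x] and Na = mtr_homset[OF N a x]
  have 1: "\<phi> i x \<cdot>\<^bsub>Ab\<^esub> mtr L a x = mtr M a x \<cdot>\<^bsub>Ab\<^esub> \<phi> j (fobj (rfun R a) x)"
    and 2: "\<psi> i x \<cdot>\<^bsub>Ab\<^esub> mtr M a x = mtr N a x \<cdot>\<^bsub>Ab\<^esub> \<psi> j (fobj (rfun R a) x)"
    using f g a x unfolding rep_mod_hom_def by blast+
  have "\<psi> i x \<cdot>\<^bsub>Ab\<^esub> \<phi> i x \<cdot>\<^bsub>Ab\<^esub> mtr L a x = \<psi> i x \<cdot>\<^bsub>Ab\<^esub> mtr M a x \<cdot>\<^bsub>Ab\<^esub> \<phi> j (fobj (rfun R a) x)"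
    unfolding Ab.cmp_assoc[OF La \<phi>x \<psi>x, symmetric] 1 by (rule Ab.cmp_assoc[OF \<phi>ax Ma \<psi>x])
  also have "\<dots> = mtr N a x \<cdot>\<^bsub>Ab\<^esub> (\<psi> j (fobj (rfun R a) x) \<cdot>\<^bsub>Ab\<^esub> \<phi> j (fobj (rfun R a) x))"
    unfolding 2 by (rule Ab.cmp_assoc[OF \<phi>ax \<psi>ax Na, symmetric])
  finally show "\<chi> i x \<cdot>\<^bsub>Ab\<^esub> mtr L a x = mtr N a x \<cdot>\<^bsub>Ab\<^esub> \<chi> j (fobj (rfun R a) x)"
    unfolding eq[OF i x] eq[OF j ax] .
qed

lemma cmp_Mod_rep:
  assumes f: "f \<in> homset (Mod_rep C R) L M" and g: "g \<in> homset (Mod_rep C R) M N"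
  shows "g \<cdot>\<^bsub>Mod_rep C R\<^esub> f \<in> homset (Mod_rep C R) L N"
    "\<lbrakk>i \<in> obj C; x \<in> obj (rcat R i)\<rbrakk> \<Longrightarrow> amap (g \<cdot>\<^bsub>Mod_rep C R\<^esub> f) i x = amap g i x \<cdot>\<^bsub>Ab\<^esub> amap f i x"
proof -
  have f': "right_rep_module C R L" "right_rep_module C R M" "rep_mod_hom C R L M (amap f)" "asrc f
      = L"
    and g': "right_rep_module C R N" "rep_mod_hom C R M N (amap g)" "atgt g = N"
    using f g unfolding homset_Mod_rep by blast+
  have eq: "g \<cdot>\<^bsub>Mod_rep C R\<^esub> f =
      Arrow L N (\<lambda>i\<in>obj C. \<lambda>x\<in>obj (rcat R i). amap g i x \<cdot>\<^bsub>Ab\<^esub> amap f i x)"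
    using f'(4) g'(3) by (simp add: Mod_rep_def)
  have "rep_mod_hom C R L N (\<lambda>i\<in>obj C. \<lambda>x\<in>obj (rcat R i). amap g i x \<cdot>\<^bsub>Ab\<^esub> amap f i x)"
    by (rule rep_mod_hom_cmp[OF f'(1,2) g'(1) f'(3) g'(2)]) simp
  then show "g \<cdot>\<^bsub>Mod_rep C R\<^esub> f \<in> homset (Mod_rep C R) L N"
    using f'(1) g'(1) by (simp add: homset_Mod_rep eq)
  show "\<lbrakk>i \<in> obj C; x \<in> obj (rcat R i)\<rbrakk> \<Longrightarrow> amap (g \<cdot>\<^bsub>Mod_rep C R\<^esub> f) i x = amap g i x \<cdot>\<^bsub>Ab\<^esub> amap f i x"
    by (simp add: eq)
qed

lemma idn_Mod_rep:
  assumes M: "right_rep_module C R M"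
  shows "idn (Mod_rep C R) M \<in> homset (Mod_rep C R) M M"
    "\<lbrakk>i \<in> obj C; x \<in> obj (rcat R i)\<rbrakk> \<Longrightarrow> amap (idn (Mod_rep C R) M) i x = idn Ab (fobj (mfun M i) x)"
proof -
  let ?\<phi> = "\<lambda>i\<in>obj C. \<lambda>x\<in>obj (rcat R i). idn Ab (fobj (mfun M i) x)"
  have eq: "idn (Mod_rep C R) M = Arrow M M ?\<phi>"
    by (simp add: Mod_rep_def)
  interpret Ab: category Ab by (rule category_Ab)
  have "rep_mod_hom C R M M ?\<phi>"
    unfolding rep_mod_hom_def
  proof (intro conjI ballI allI)
    show "nat_transf (opp (rcat R i)) Ab (mfun M i) (mfun M i) (?\<phi> i)" if i: "i \<in> obj C" for i
      by (rule nat_transf_idn[OF mfun_functor[OF M i]]) (simp add: opp_simps i)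
    fix i j a x assume a: "a \<in> homset C i j" and x: "x \<in> obj (rcat R i)"
    show "?\<phi> i x \<cdot>\<^bsub>Ab\<^esub> mtr M a x = mtr M a x \<cdot>\<^bsub>Ab\<^esub> ?\<phi> j (fobj (rfun R a) x)"
      using Ab.cmp_idn[OF mtr_homset[OF M a x]] Ab.idn_cmp[OF mtr_homset[OF M a x]] homset_obj[OF a]
        rfun_obj[OF a x] x by simp
  qed
  then show "idn (Mod_rep C R) M \<in> homset (Mod_rep C R) M M"
    using M by (simp add: homset_Mod_rep eq)
  show "\<lbrakk>i \<in> obj C; x \<in> obj (rcat R i)\<rbrakk> \<Longrightarrow> amap (idn (Mod_rep C R) M) i x = idn Ab
      (fobj (mfun M i) x)"
    by (simp add: eq)
qed

lemma category_Mod_rep: "category (Mod_rep C R)"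
proof
  fix f assume "f \<in> arr (Mod_rep C R)"
  then have "f \<in> homset (Mod_rep C R) (src (Mod_rep C R) f) (tgt (Mod_rep C R) f)"
    by (simp add: homset_def)
  then show "src (Mod_rep C R) f \<in> obj (Mod_rep C R)" "tgt (Mod_rep C R) f \<in> obj (Mod_rep C R)"
    unfolding homset_Mod_rep by (simp_all add: Mod_rep_def)
next
  fix M assume "M \<in> obj (Mod_rep C R)"
  then show "idn (Mod_rep C R) M \<in> homset (Mod_rep C R) M M"
    by (intro idn_Mod_rep) (simp add: Mod_rep_def)
next
  fix f g L M N assume "f \<in> homset (Mod_rep C R) L M" "g \<in> homset (Mod_rep C R) M N"
  then show "g \<cdot>\<^bsub>Mod_rep C R\<^esub> f \<in> homset (Mod_rep C R) L N" by (rule cmp_Mod_rep)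
next
  interpret Ab: category Ab by (rule category_Ab)
  fix f M N assume f: "f \<in> homset (Mod_rep C R) M N"
  then have "right_rep_module C R M" "right_rep_module C R N" unfolding homset_Mod_rep by blast+
  note M = idn_Mod_rep[OF this(1)] and N = idn_Mod_rep[OF this(2)]
  show "f \<cdot>\<^bsub>Mod_rep C R\<^esub> idn (Mod_rep C R) M = f"
    by (rule Mod_rep_eqI[OF cmp_Mod_rep(1)[OF M(1) f] f])
      (simp add: cmp_Mod_rep(2)[OF M(1) f] M(2) Ab.cmp_idn[OF Mod_rep_component[OF f]])
  show "idn (Mod_rep C R) N \<cdot>\<^bsub>Mod_rep C R\<^esub> f = f"
    by (rule Mod_rep_eqI[OF cmp_Mod_rep(1)[OF f N(1)] f])
      (simp add: cmp_Mod_rep(2)[OF f N(1)] N(2) Ab.idn_cmp[OF Mod_rep_component[OF f]])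
next
  interpret Ab: category Ab by (rule category_Ab)
  fix f g h K L M N
  assume f: "f \<in> homset (Mod_rep C R) K L" and g: "g \<in> homset (Mod_rep C R) L M"
    and h: "h \<in> homset (Mod_rep C R) M N"
  note gf = cmp_Mod_rep[OF f g] and hg = cmp_Mod_rep[OF g h]
  show "h \<cdot>\<^bsub>Mod_rep C R\<^esub> (g \<cdot>\<^bsub>Mod_rep C R\<^esub> f) = h \<cdot>\<^bsub>Mod_rep C R\<^esub> g \<cdot>\<^bsub>Mod_rep C R\<^esub> f"
  proof (rule Mod_rep_eqI[OF cmp_Mod_rep(1)[OF gf(1) h] cmp_Mod_rep(1)[OF f hg(1)]])
    fix i x assume i: "i \<in> obj C" and x: "x \<in> obj (rcat R i)"
    show "amap (h \<cdot>\<^bsub>Mod_rep C R\<^esub> (g \<cdot>\<^bsub>Mod_rep C R\<^esub> f)) i x = amap (h \<cdot>\<^bsub>Mod_rep C R\<^esub> g \<cdot>\<^bsub>Mod_rep C R\<^esub> f) i x"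
      unfolding cmp_Mod_rep(2)[OF gf(1) h i x] cmp_Mod_rep(2)[OF f hg(1) i x] gf(2)[OF i x]
          hg(2)[OF i x]
      by (rule Ab.cmp_assoc[OF Mod_rep_component[OF f i x] Mod_rep_component[OF g i x]
          Mod_rep_component[OF h i x]])
  qed
qed

end

section \<open>The equivalence\<close>

text \<open>Finite powers of an infinite set embed into it: a tuple on \<open>insert p P\<close> is
  the pair of its entry at \<open>p\<close> and its restriction to \<open>P\<close>. On the empty
  index set there is only one extensional function.\<close>

lemma ex_inj_on_extensional:
  assumes inf: "infinite (UNIV :: 'u set)" and P: "finite P"
  shows "\<exists>e :: ('p \<Rightarrow> 'u) \<Rightarrow> 'u. inj_on e (extensional P)"
  using P
proof (induction P rule: finite_induct)
  case empty
  show ?case by (intro exI[of _ "\<lambda>_. undefined"]) (simp add: extensional_empty)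
next
  case (insert p P)
  then obtain e :: "('p \<Rightarrow> 'u) \<Rightarrow> 'u" where e: "inj_on e (extensional P)" by blast
  \<comment> \<open>An infinite set is equinumerous with its square; this is the only use of
    infinity.\<close>
  obtain c :: "'u \<times> 'u \<Rightarrow> 'u" where c: "inj c"
    using card_of_Times_same_infinite[OF inf] card_of_ordIso[of "UNIV \<times> UNIV" "UNIV :: 'u set"]
    unfolding bij_betw_def UNIV_Times_UNIV by blast
  have "inj_on (\<lambda>f. c (f p, e (restrict f P))) (extensional (insert p P))"
  proof (rule inj_onI)
    fix f g :: "'p \<Rightarrow> 'u" assume f: "f \<in> extensional (insert p P)" and g: "g \<in> extensional
        (insert p P)"
      and eq: "c (f p, e (restrict f P)) = c (g p, e (restrict g P))"
    from eq c have p: "f p = g p" and "e (restrict f P) = e (restrict g P)"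
      by (auto dest: injD)
    then have "restrict f P = restrict g P"
      using e by (auto dest: inj_onD)
    then have "f x = g x" if "x \<in> insert p P" for x
      using that p by (metis insertE restrict_apply')
    then show "f = g"
      by (rule extensionalityI[OF f g])
  qed
  then show ?case by blast
qed

context finite_representation
begin

abbreviation sum_mod :: "('i, 'c, 'x, 'f, 'u) rep_mod \<Rightarrow> ('c \<times> 'x \<times> 'x \<Rightarrow> 'f, 'i \<times> 'x \<Rightarrow> 'u) rmod"
    where
  "sum_mod N \<equiv> graded_module.tmod skew_ob (skew_index C R) skew_src skew_tgt (fiber N) (skew_act N)"

definition family :: "('i \<Rightarrow> 'x \<Rightarrow> 'u ab_arrow) \<Rightarrow> 'i \<times> 'x \<Rightarrow> 'u \<Rightarrow> 'u" where
  "family \<phi> = (\<lambda>(i, x). amap (\<phi> i x))"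

abbreviation family_sum :: "('i \<Rightarrow> 'x \<Rightarrow> 'u ab_arrow) \<Rightarrow> ('i \<times> 'x \<Rightarrow> 'u) \<Rightarrow> 'i \<times> 'x \<Rightarrow> 'u" where
  "family_sum \<phi> \<equiv> graded_module_pair.sum_map skew_ob (family \<phi>)"

lemma right_module_sum_mod: "right_rep_module C R N \<Longrightarrow> right_module G.alg (sum_mod N)"
  by (rule graded_module.right_module_tmod[OF graded_module_rep])

lemma carrier_sum_mod:
  assumes "right_rep_module C R N"
  shows "carrier (sum_mod N) = carrier (sum_group skew_ob (fiber N))"
  by (rule graded_module.tmod_simps(1)[OF graded_module_rep[OF assms]])

lemma sum_mod_component:
  assumes N: "right_rep_module C R N" and "m \<in> carrier (sum_mod N)" "i \<in> obj C" "x \<in> obj (rcat R i)"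
  shows "m (i, x) \<in> carrier (fobj (mfun N i) x)"
proof -
  interpret N: graded_module skew_ob "skew_index C R" "skew_hom C R" skew_src skew_tgt skew_ic
      skew_mc
    skew_iu skew_un "fiber N" "skew_act N" by (rule graded_module_rep[OF N])
  have "m \<in> carrier N.K.S"
    using assms(2) by (simp only: N.tmod_simps)
  from N.K.S_component[OF this skew_obI[OF assms(3,4)]] show ?thesis
    by (simp add: fiber_def)
qed

lemma graded_module_pair_rep:
  assumes "right_rep_module C R M" "right_rep_module C R N"
  shows "graded_module_pair skew_ob (skew_index C R) (skew_hom C R) skew_src skew_tgt skew_ic
      skew_mc
    skew_iu skew_un (fiber M) (skew_act M) (fiber N) (skew_act N)"
  using assms by (intro graded_module_pair.intro graded_module_rep)

section \<open>Module homomorphisms and linear maps of direct sums\<close>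

context
  fixes M N :: "('i, 'c, 'x, 'f, 'u) rep_mod"
  assumes M: "right_rep_module C R M" and N: "right_rep_module C R N"
begin

interpretation P: graded_module_pair skew_ob "skew_index C R" "skew_hom C R" skew_src skew_tgt
    skew_ic skew_mc
    skew_iu skew_un "fiber M" "skew_act M" "fiber N" "skew_act N"
  by (rule graded_module_pair_rep[OF M N])

text \<open>A generator acts as \<open>M(a)\<^sub>x \<circ> M\<^sub>j(f)\<close>. The family passes
  the first factor by compatibility with \<open>a\<close>, and the second by naturality of its
  component over \<open>j\<close>.\<close>

lemma natural_family_if_rep_mod_hom:
  assumes \<phi>: "rep_mod_hom C R M N \<phi>"
  shows "P.natural_family (family \<phi>)"
  unfolding P.natural_family_def
proof (intro conjI ballI)
  have nat: "nat_transf (opp (rcat R i)) Ab (mfun M i) (mfun N i) (\<phi> i)" if "i \<in> obj C" for i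
    using \<phi> that unfolding rep_mod_hom_def by blast
  note component = nat_transf.component[OF nat, unfolded opp_simps]
  show "family \<phi> p \<in> hom (fiber M p) (fiber N p)" if "p \<in> skew_ob" for p
    using that Ab_homD(1)[OF component] by (auto simp: skew_ob_def family_def fiber_def)
  fix q f m assume "q \<in> skew_index C R" "f \<in> carrier (skew_hom C R q)" "m \<in> carrier
      (fiber M (skew_tgt q))"
  moreover obtain a x y where q: "q = (a, x, y)" by (cases q)
  ultimately have q': "(a, x, y) \<in> skew_index C R"
    and f: "f \<in> homset (rcat R (tgt C a)) (fobj (rfun R a) x) y"
    and m: "m \<in> carrier (fobj (mfun M (tgt C a)) y)"
    by (simp_all add: skew_hom_simps skew_tgt_def fiber_def)
  note a = skew_indexD[OF q']
  have i: "src C a \<in> obj C" and j: "tgt C a \<in> obj C" using homset_obj[OF a(1)] by auto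
  let ?x = "fobj (rfun R a) x"
  note ax = rfun_obj[OF a(1,2)] and Mf = mfun_homset[OF M j f] and Nf = mfun_homset[OF N j f]
  note Mfm = Ab_homD(2)[OF Mf m]
  have 1: "\<phi> (src C a) x \<cdot>\<^bsub>Ab\<^esub> mtr M a x = mtr N a x \<cdot>\<^bsub>Ab\<^esub> \<phi> (tgt C a) ?x"
    using \<phi> a unfolding rep_mod_hom_def by blast
  have 2: "\<phi> (tgt C a) ?x \<cdot>\<^bsub>Ab\<^esub> farr (mfun M (tgt C a)) f = farr (mfun N (tgt C a)) f \<cdot>\<^bsub>Ab\<^esub> \<phi> (tgt C a)
      y"
    by (rule nat_transf.natural[OF nat[OF j], unfolded opp_simps, OF f])
  have "amap (\<phi> (src C a) x) (amap (mtr M a x) (amap (farr (mfun M (tgt C a)) f) m)) =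
      amap (mtr N a x) (amap (\<phi> (tgt C a) ?x) (amap (farr (mfun M (tgt C a)) f) m))"
    unfolding amap_cmp_Ab[OF mtr_homset[OF M a(1,2)] Mfm, symmetric] 1
    by (rule amap_cmp_Ab[OF component[OF j ax] Mfm])
  also have "\<dots> = amap (mtr N a x) (amap (farr (mfun N (tgt C a)) f) (amap (\<phi> (tgt C a) y) m))"
    unfolding amap_cmp_Ab[OF Mf m, symmetric] 2 amap_cmp_Ab[OF component[OF j a(3)] m] ..
  finally show "family \<phi> (skew_src q) (skew_act M q f m) = skew_act N q f (family \<phi> (skew_tgt q) m)"
    by (simp add: q skew_act_def family_def skew_src_def skew_tgt_def)
qed

text \<open>Adds the source and target groups to the bare maps and restricts in both arguments, so
  that the result is the underlying map of an arrow in \<open>Mod_rep\<close>.\<close>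

definition arrow_family :: "('i \<times> 'x \<Rightarrow> 'u \<Rightarrow> 'u) \<Rightarrow> 'i \<Rightarrow> 'x \<Rightarrow> 'u ab_arrow" where
  "arrow_family \<psi> = (\<lambda>i\<in>obj C. \<lambda>x\<in>obj (rcat R i). ab_arrow (fobj (mfun M i) x) (fobj (mfun N i) x)
      (\<psi> (i, x)))"

lemma family_arrow_family:
  "\<lbrakk>i \<in> obj C; x \<in> obj (rcat R i); m \<in> carrier (fobj (mfun M i) x)\<rbrakk>
    \<Longrightarrow> family (arrow_family \<psi>) (i, x) m = \<psi> (i, x) m"
  by (simp add: family_def arrow_family_def amap_ab_arrow)

text \<open>Naturality is tested on the two special kinds of generators: embedded arrows of
  \<open>R(i)\<close> give naturality over \<open>i\<close>, and identities in degree
  \<open>a\<close> give compatibility with \<open>M(a)\<close> and \<open>N(a)\<close>.\<close>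

lemma rep_mod_hom_if_natural_family:
  assumes \<psi>: "P.natural_family \<psi>"
  shows "rep_mod_hom C R M N (arrow_family \<psi>)"
proof -
  let ?\<phi> = "arrow_family \<psi>"
  have nat: "\<psi> (i, x) (skew_act M (a, x, y) f m) = skew_act N (a, x, y) f (\<psi> (j, y) m)"
    if a: "a \<in> homset C i j" and x: "x \<in> obj (rcat R i)" and y: "y \<in> obj (rcat R j)"
      and f: "f \<in> homset (rcat R j) (fobj (rfun R a) x) y" and m: "m \<in> carrier (fobj (mfun M j) y)"
    for a i j x y f m
    using \<psi> skew_indexI[OF a x y] f m unfolding P.natural_family_def
    by (force simp: skew_hom_simps skew_src_def skew_tgt_def fiber_def homsetD[OF a])
  have comp: "?\<phi> i x \<in> homset Ab (fobj (mfun M i) x) (fobj (mfun N i) x)"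
    and amap: "m \<in> carrier (fobj (mfun M i) x) \<Longrightarrow> amap (?\<phi> i x) m = \<psi> (i, x) m"
    if i: "i \<in> obj C" and x: "x \<in> obj (rcat R i)" for i x m
  proof -
    have "\<psi> (i, x) \<in> hom (fobj (mfun M i) x) (fobj (mfun N i) x)"
      using \<psi> skew_obI[OF i x] unfolding P.natural_family_def by (force simp: fiber_def)
    then show "?\<phi> i x \<in> homset Ab (fobj (mfun M i) x) (fobj (mfun N i) x)"
      using i x by (simp add: arrow_family_def
          ab_arrow_homset[OF comm_group_fiber[OF M i x] comm_group_fiber[OF N i x]])
    show "m \<in> carrier (fobj (mfun M i) x) \<Longrightarrow> amap (?\<phi> i x) m = \<psi> (i, x) m"
      using i x by (simp add: arrow_family_def amap_ab_arrow)
  qed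
  show ?thesis
    unfolding rep_mod_hom_def
  proof (intro conjI ballI allI)
    fix i assume i: "i \<in> obj C"
    interpret I: category "rcat R i" by (rule rcat_category[OF i])
    show "nat_transf (opp (rcat R i)) Ab (mfun M i) (mfun N i) (?\<phi> i)"
    proof (intro nat_transf.intro nat_transf_axioms.intro mfun_functor[OF M i] mfun_functor[OF N i],
        unfold opp_simps)
      show "?\<phi> i x \<in> homset Ab (fobj (mfun M i) x) (fobj (mfun N i) x)" if "x \<in> obj (rcat R i)" for
          x
        by (rule comp[OF i that])
      fix f x y assume f: "f \<in> homset (rcat R i) y x"
      have x: "x \<in> obj (rcat R i)" and y: "y \<in> obj (rcat R i)" using I.homset_obj[OF f] by auto
      note Mf = mfun_homset[OF M i f] and Nf = mfun_homset[OF N i f]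
      note fe = I.cmp_homset[OF eta_delta(1)[OF i y] f]
      show "?\<phi> i y \<cdot>\<^bsub>Ab\<^esub> farr (mfun M i) f = farr (mfun N i) f \<cdot>\<^bsub>Ab\<^esub> ?\<phi> i x"
      proof (rule Ab_eqI[OF cmp_Ab_homset[OF Mf comp[OF i y]] cmp_Ab_homset[OF comp[OF i x] Nf]])
        fix m assume m: "m \<in> carrier (fobj (mfun M i) x)"
        note \<phi>m = Ab_homD(2)[OF comp[OF i x] m]
        have "amap (?\<phi> i y) (amap (farr (mfun M i) f) m) = \<psi> (i, y) (amap (farr (mfun M i) f) m)"
          by (rule amap[OF i y Ab_homD(2)[OF Mf m]])
        also have "\<dots> = amap (farr (mfun N i) f) (\<psi> (i, x) m)"
          unfolding skew_act_arrow[OF M i f m, symmetric] nat[OF idn_homset[OF i] y x fe m]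
          by (rule skew_act_arrow[OF N i f \<phi>m[unfolded amap[OF i x m]]])
        finally show "amap (?\<phi> i y \<cdot>\<^bsub>Ab\<^esub> farr (mfun M i) f) m = amap (farr (mfun N i) f \<cdot>\<^bsub>Ab\<^esub> ?\<phi> i x) m"
          unfolding amap_cmp_Ab[OF Mf m] amap_cmp_Ab[OF comp[OF i x] m] amap[OF i x m] .
      qed
    qed
  next
    fix i j a x assume a: "a \<in> homset C i j" and x: "x \<in> obj (rcat R i)"
    have i: "i \<in> obj C" and j: "j \<in> obj C" using homset_obj[OF a] by auto
    interpret J: category "rcat R j" by (rule rcat_category[OF j])
    let ?x = "fobj (rfun R a) x"
    note ax = rfun_obj[OF a x] and Ma = mtr_homset[OF M a x] and Na = mtr_homset[OF N a x]
    show "?\<phi> i x \<cdot>\<^bsub>Ab\<^esub> mtr M a x = mtr N a x \<cdot>\<^bsub>Ab\<^esub> ?\<phi> j ?x"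
    proof (rule Ab_eqI[OF cmp_Ab_homset[OF Ma comp[OF i x]] cmp_Ab_homset[OF comp[OF j ax] Na]])
      fix m assume m: "m \<in> carrier (fobj (mfun M j) ?x)"
      note \<phi>m = Ab_homD(2)[OF comp[OF j ax] m]
      have "amap (?\<phi> i x) (amap (mtr M a x) m) = \<psi> (i, x) (amap (mtr M a x) m)"
        by (rule amap[OF i x Ab_homD(2)[OF Ma m]])
      also have "\<dots> = amap (mtr N a x) (\<psi> (j, ?x) m)"
        unfolding skew_act_mtr[OF M a x m, symmetric] nat[OF a x ax J.idn_homset[OF ax] m]
        by (rule skew_act_mtr[OF N a x \<phi>m[unfolded amap[OF j ax m]]])
      finally show "amap (?\<phi> i x \<cdot>\<^bsub>Ab\<^esub> mtr M a x) m = amap (mtr N a x \<cdot>\<^bsub>Ab\<^esub> ?\<phi> j ?x) m"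
        unfolding amap_cmp_Ab[OF Ma m] amap_cmp_Ab[OF comp[OF j ax] m] amap[OF j ax m] .
    qed
  qed
qed

lemma rmod_hom_family_sum:
  "rep_mod_hom C R M N \<phi> \<Longrightarrow> rmod_hom G.alg (sum_mod M) (sum_mod N) (family_sum \<phi>)"
  by (rule P.rmod_hom_sum_map[OF natural_family_if_rep_mod_hom])

text \<open>Evaluating on a tuple concentrated at \<open>(i, x)\<close> recovers the component of
  the family there.\<close>

lemma family_sum_faithful:
  assumes \<phi>: "rep_mod_hom C R M N \<phi>" and \<psi>: "rep_mod_hom C R M N \<psi>"
    and eq: "\<And>m. m \<in> carrier (sum_mod M) \<Longrightarrow> family_sum \<phi> m = family_sum \<psi> m"
    and i: "i \<in> obj C" and x: "x \<in> obj (rcat R i)" and m: "m \<in> carrier (fobj (mfun M i) x)"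
  shows "amap (\<phi> i x) m = amap (\<psi> i x) m"
proof -
  have p: "(i, x) \<in> skew_ob" and m': "m \<in> carrier (fiber M (i, x))"
    using m by (simp_all add: skew_obI[OF i x] fiber_def)
  note single = P.M.K.single_closed[OF p m', folded carrier_sum_mod[OF M]]
  have "family \<phi> (i, x) m = family \<psi> (i, x) m"
    using P.family_of_sum_map[OF natural_family_if_rep_mod_hom[OF \<phi>] p m']
      P.family_of_sum_map[OF natural_family_if_rep_mod_hom[OF \<psi>] p m'] eq[OF single]
    by (simp add: P.family_of_def)
  then show ?thesis
    by (simp add: family_def)
qed

text \<open>The preimage consists of the diagonal blocks of \<open>h\<close>, which determine
  \<open>h\<close> by \<open>sum_map_family_of\<close>.\<close>

lemma family_sum_full:
  assumes h: "rmod_hom G.alg (sum_mod M) (sum_mod N) h"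
  shows "\<exists>\<phi>. rep_mod_hom C R M N \<phi> \<and> \<phi> \<in> extensional (obj C) \<and>
    (\<forall>i\<in>obj C. \<phi> i \<in> extensional (obj (rcat R i))) \<and> (\<forall>m\<in>carrier (sum_mod M). family_sum \<phi> m = h m)"
proof (intro exI[of _ "arrow_family (P.family_of h)"] conjI ballI)
  show "rep_mod_hom C R M N (arrow_family (P.family_of h))"
    by (rule rep_mod_hom_if_natural_family[OF P.natural_family_of[OF h]])
  fix m assume m: "m \<in> carrier (sum_mod M)"
  have "family_sum (arrow_family (P.family_of h)) m = P.sum_map (P.family_of h) m"
    unfolding P.sum_map_def
  proof (rule restrict_ext)
    fix p assume "p \<in> skew_ob"
    then obtain i x where p: "p = (i, x)" and i: "i \<in> obj C" and x: "x \<in> obj (rcat R i)"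
      by (auto simp: skew_ob_def)
    show "family (arrow_family (P.family_of h)) p (m p) = P.family_of h p (m p)"
      unfolding p by (rule family_arrow_family[OF i x sum_mod_component[OF M m i x]])
  qed
  also have "\<dots> = h m"
    by (rule P.sum_map_family_of[OF h m[unfolded carrier_sum_mod[OF M]]])
  finally show "family_sum (arrow_family (P.family_of h)) m = h m" .
qed (simp_all add: arrow_family_def)

end

text \<open>The images of the idempotents form a graded module, which \<open>rep_of\<close> turns
  into \<open>N\<close>. The isomorphism onto the direct sum sends an element to its
  components.\<close>

lemma ex_rep_mod_decomposition:
  fixes M :: "('c \<times> 'x \<times> 'x \<Rightarrow> 'f, 'u) rmod"
  assumes M: "right_module G.alg M"
  shows "\<exists>(N :: ('i, 'c, 'x, 'f, 'u) rep_mod) h. right_rep_module C R N \<and> rmod_hom G.alg M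
      (sum_mod N) h \<and>
    bij_betw h (carrier M) (carrier (sum_mod N))"
proof -
  interpret A: graded_algebra_module skew_ob "skew_index C R" "skew_hom C R" skew_src skew_tgt
      skew_ic skew_mc
    skew_iu skew_un M
    by (intro graded_algebra_module.intro graded_category_skew M)
  note part = A.graded_module_part
  define N where "N = rep_of A.part A.part_act"
  have N: "right_rep_module C R N"
    unfolding N_def by (rule right_rep_module_rep_of[OF part])
  interpret P: graded_algebra_module_parts skew_ob "skew_index C R" "skew_hom C R" skew_src skew_tgt
      skew_ic
    skew_mc skew_iu skew_un M "fiber N" "skew_act N"
  proof (intro graded_algebra_module_parts.intro graded_algebra_module_parts_axioms.intro
      A.graded_algebra_module_axioms graded_module_rep[OF N])
    show "fiber N p = A.part p" for p
      by (simp add: N_def fiber_rep_of)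
    show "skew_act N q f m = A.part_act q f m"
      if "q \<in> skew_index C R" "f \<in> carrier (skew_hom C R q)" "m \<in> carrier (fiber N (skew_tgt q))"
          for q f m
      using skew_act_rep_of[OF part that(1,2)] that(3) by (simp add: N_def fiber_rep_of)
  qed
  show ?thesis
    using N P.rmod_hom_decompose P.bij_betw_decompose by blast
qed

section \<open>Direct sums moved into the universe\<close>

context
  fixes e :: "('i \<times> 'x \<Rightarrow> 'u) \<Rightarrow> 'u"
  assumes e: "inj_on e (extensional skew_ob)"
begin

text \<open>Every direct sum consists of tuples extensional on the same finite index set, so a
  single \<open>e\<close> serves all modules at once. This makes the transport functorial.\<close>

lemma inj_on_sum_mod:
  assumes N: "right_rep_module C R N"
  shows "inj_on e (carrier (sum_mod N))"
proof -
  interpret N: graded_module skew_ob "skew_index C R" "skew_hom C R" skew_src skew_tgt skew_ic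
      skew_mc
    skew_iu skew_un "fiber N" "skew_act N" by (rule graded_module_rep[OF N])
  show ?thesis
    by (rule inj_on_subset[OF e]) (auto simp: N.tmod_simps N.K.carrier_S PiE_iff)
qed

text \<open>On arrows, the linear map of direct sums is conjugated by the transport: return to
  tuples along \<open>e\<close>, apply the family in each component, and move forward again.\<close>

definition sum_fctr where
  "sum_fctr = \<lparr>fobj = (\<lambda>N. transport e (sum_mod N)),
     farr = (\<lambda>f. Arrow (transport e (sum_mod (asrc f))) (transport e (sum_mod (atgt f)))
       (restrict (\<lambda>u. e (family_sum (amap f) (inv_into (carrier (sum_mod (asrc f))) e u)))
         (carrier (transport e (sum_mod (asrc f))))))\<rparr>"

lemma right_module_fobj: "right_rep_module C R N \<Longrightarrow> right_module G.alg (fobj sum_fctr N)"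
  unfolding sum_fctr_def
  by (simp add: right_module_transport[OF right_module_sum_mod inj_on_sum_mod])

lemma carrier_fobj: "right_rep_module C R N \<Longrightarrow> carrier (fobj sum_fctr N) = e ` carrier (sum_mod N)"
  unfolding sum_fctr_def by (simp add: transport_simps(1)[OF inj_on_sum_mod])

lemma farr_sum_fctr:
  assumes f: "f \<in> homset (Mod_rep C R) M N"
  shows "farr sum_fctr f \<in> homset (Mod_ring G.alg) (fobj sum_fctr M) (fobj sum_fctr N)"
    "m \<in> carrier (sum_mod M) \<Longrightarrow> amap (farr sum_fctr f) (e m) = e (family_sum (amap f) m)"
proof -
  have M: "right_rep_module C R M" and N: "right_rep_module C R N" and \<phi>: "rep_mod_hom C R M N
      (amap f)"
    and st: "asrc f = M" "atgt f = N"
    using f unfolding homset_Mod_rep by blast+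
  note eM = inj_on_sum_mod[OF M] and eN = inj_on_sum_mod[OF N]
  have h: "rmod_hom G.alg (transport e (sum_mod M)) (transport e (sum_mod N))
      (\<lambda>u. e (family_sum (amap f) (inv_into (carrier (sum_mod M)) e u)))"
    by (rule rmod_hom_comp[OF rmod_hom_comp[OF rmod_hom_inv[OF right_module_sum_mod[OF M]
            rmod_hom_transport[OF eM] bij_betw_transport[OF eM]] rmod_hom_family_sum[OF M N \<phi>]]
          rmod_hom_transport[OF eN]])
  show "farr sum_fctr f \<in> homset (Mod_ring G.alg) (fobj sum_fctr M) (fobj sum_fctr N)"
    using Mod_ring_arrow[OF right_module_fobj[OF M] right_module_fobj[OF N]] h
    by (simp add: sum_fctr_def st)
  show "amap (farr sum_fctr f) (e m) = e (family_sum (amap f) m)" if "m \<in> carrier (sum_mod M)"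
    using that eM by (simp add: sum_fctr_def st transport_simps(1))
qed

lemma family_sum_closed:
  assumes f: "f \<in> homset (Mod_rep C R) M N" and m: "m \<in> carrier (sum_mod M)"
  shows "family_sum (amap f) m \<in> carrier (sum_mod N)"
  using rmod_homD(3)[OF rmod_hom_family_sum m] f unfolding homset_Mod_rep by blast

lemma family_sum_apply:
  fixes M N :: "('i, 'c, 'x, 'f, 'u) rep_mod" and \<phi> :: "'i \<Rightarrow> 'x \<Rightarrow> 'u ab_arrow"
  assumes "right_rep_module C R M" "right_rep_module C R N"
  shows "family_sum \<phi> m = (\<lambda>(i, x)\<in>skew_ob. amap (\<phi> i x) (m (i, x)))"
  unfolding graded_module_pair.sum_map_def[OF graded_module_pair_rep[OF assms]] family_def
  by (auto simp: restrict_def)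

text \<open>Conjugation by \<open>e\<close> is removed by evaluating at elements of the form
  \<open>e m\<close>. Identities and composites are then compared one component of the tuple at a
  time.\<close>

lemma cat_functor_sum_fctr: "cat_functor (Mod_rep C R) (Mod_ring G.alg) sum_fctr"
proof (intro cat_functor.intro cat_functor_axioms.intro category_Mod_rep category_Mod_ring)
  fix N :: "('i, 'c, 'x, 'f, 'u) rep_mod" assume "N \<in> obj (Mod_rep C R)"
  then have N: "right_rep_module C R N" by (simp add: Mod_rep_def)
  show "fobj sum_fctr N \<in> obj (Mod_ring G.alg)"
    using right_module_fobj[OF N] by (simp add: Mod_ring_def)
  note id = idn_Mod_rep[OF N] and Fid = idn_Mod_ring[OF right_module_fobj[OF N]]
  show "farr sum_fctr (idn (Mod_rep C R) N) = idn (Mod_ring G.alg) (fobj sum_fctr N)"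
  proof (rule Mod_ring_eqI[OF farr_sum_fctr(1)[OF id(1)] Fid(1)])
    fix u assume u: "u \<in> carrier (fobj sum_fctr N)"
    then obtain m where m: "m \<in> carrier (sum_mod N)" "u = e m"
      by (auto simp: carrier_fobj[OF N])
    interpret N: graded_module skew_ob "skew_index C R" "skew_hom C R" skew_src skew_tgt skew_ic
        skew_mc
      skew_iu skew_un "fiber N" "skew_act N" by (rule graded_module_rep[OF N])
    have "family_sum (amap (idn (Mod_rep C R) N)) m = m"
    proof (rule N.K.S_eqI)
      show "family_sum (amap (idn (Mod_rep C R) N)) m \<in> carrier N.K.S" "m \<in> carrier N.K.S"
        using family_sum_closed[OF id(1) m(1)] m(1) by (simp_all add: N.tmod_simps)
      fix p assume "p \<in> skew_ob"
      then obtain i x where p: "p = (i, x)" and i: "i \<in> obj C" and x: "x \<in> obj (rcat R i)"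
        by (auto simp: skew_ob_def)
      show "family_sum (amap (idn (Mod_rep C R) N)) m p = m p"
        using amap_idn_Ab[OF sum_mod_component[OF N m(1) i x]]
        by (simp add: family_sum_apply[OF N N] p skew_obI[OF i x] id(2)[OF i x])
    qed
    then show "amap (farr sum_fctr (idn (Mod_rep C R) N)) u = amap
        (idn (Mod_ring G.alg) (fobj sum_fctr N)) u"
      by (simp add: Fid(2)[OF u]) (simp add: m(2) farr_sum_fctr(2)[OF id(1) m(1)])
  qed
next
  fix f :: "('i, 'c, 'x, 'f, 'u) rep_mod_arrow" and M N assume "f \<in> homset (Mod_rep C R) M N"
  then show "farr sum_fctr f \<in> homset (Mod_ring G.alg) (fobj sum_fctr M) (fobj sum_fctr N)"
    by (rule farr_sum_fctr)
next
  fix f g :: "('i, 'c, 'x, 'f, 'u) rep_mod_arrow" and L M N assume f: "f \<in> homset (Mod_rep C R) L M"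
      and g: "g \<in> homset (Mod_rep C R) M N"
  have L: "right_rep_module C R L" and M: "right_rep_module C R M" and N: "right_rep_module C R N"
    using f g unfolding homset_Mod_rep by blast+
  note gf = cmp_Mod_rep[OF f g]
  note Ff = farr_sum_fctr[OF f] and Fg = farr_sum_fctr[OF g]
  note FgFf = cmp_Mod_ring[OF Ff(1) Fg(1)]
  show "farr sum_fctr (g \<cdot>\<^bsub>Mod_rep C R\<^esub> f) = farr sum_fctr g \<cdot>\<^bsub>Mod_ring G.alg\<^esub> farr sum_fctr f"
  proof (rule Mod_ring_eqI[OF farr_sum_fctr(1)[OF gf(1)] FgFf(1)])
    fix u assume u: "u \<in> carrier (fobj sum_fctr L)"
    then obtain m where m: "m \<in> carrier (sum_mod L)" "u = e m"
      by (auto simp: carrier_fobj[OF L])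
    have "family_sum (amap (g \<cdot>\<^bsub>Mod_rep C R\<^esub> f)) m = family_sum (amap g) (family_sum (amap f) m)"
      unfolding family_sum_apply[OF L N] family_sum_apply[OF M N] family_sum_apply[OF L M]
    proof (rule restrict_ext)
      fix p assume "p \<in> skew_ob"
      then obtain i x where p: "p = (i, x)" and i: "i \<in> obj C" and x: "x \<in> obj (rcat R i)"
        by (auto simp: skew_ob_def)
      show "(case p of (i, x) \<Rightarrow> amap (amap (g \<cdot>\<^bsub>Mod_rep C R\<^esub> f) i x) (m (i, x))) =
        (case p of (i, x) \<Rightarrow> amap (amap g i x)
            ((\<lambda>(i, x)\<in>skew_ob. amap (amap f i x) (m (i, x))) (i, x)))"
        using amap_cmp_Ab[OF Mod_rep_component[OF f i x] sum_mod_component[OF L m(1) i x], of "amap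
            g i x"]
        by (simp add: p skew_obI[OF i x] gf(2)[OF i x])
    qed
    then show "amap (farr sum_fctr (g \<cdot>\<^bsub>Mod_rep C R\<^esub> f)) u =
        amap (farr sum_fctr g \<cdot>\<^bsub>Mod_ring G.alg\<^esub> farr sum_fctr f) u"
      unfolding FgFf(2)[OF u] unfolding m(2) farr_sum_fctr(2)[OF gf(1) m(1)] Ff(2)[OF m(1)]
        Fg(2)[OF family_sum_closed[OF f m(1)]] by (simp only:)
  qed
qed

lemma equivalent_Mod_rep_Mod_alg: "equivalent_categories
    (Mod_rep C R :: (('i, 'c, 'x, 'f, 'u) rep_mod, ('i, 'c, 'x, 'f, 'u) rep_mod_arrow) cat)
    (Mod_ring G.alg :: (('c \<times> 'x \<times> 'x \<Rightarrow> 'f, 'u) rmod, ('c \<times> 'x \<times> 'x \<Rightarrow> 'f, 'u) rmod_arrow) cat)"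
proof (rule equivalent_categories_if_fully_faithful[OF cat_functor_sum_fctr])
  fix M N :: "('i, 'c, 'x, 'f, 'u) rep_mod" and g assume "M \<in> obj (Mod_rep C R)" "N \<in> obj
      (Mod_rep C R)"
    and g: "g \<in> homset (Mod_ring G.alg) (fobj sum_fctr M) (fobj sum_fctr N)"
  then have M: "right_rep_module C R M" and N: "right_rep_module C R N"
    by (simp_all add: Mod_rep_def)
  note eM = inj_on_sum_mod[OF M] and eN = inj_on_sum_mod[OF N]
  have fobj: "fobj sum_fctr L = transport e (sum_mod L)" for L
    by (simp add: sum_fctr_def)
  have g': "rmod_hom G.alg (transport e (sum_mod M)) (transport e (sum_mod N)) (amap g)"
    using g unfolding homset_Mod_ring fobj by blast
  \<comment> \<open>The given linear map, conjugated back to tuples so that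
    \<open>family_sum_full\<close> applies.\<close>
  define h where "h m = inv_into (carrier (sum_mod N)) e (amap g (e m))" for m
  have "rmod_hom G.alg (sum_mod M) (sum_mod N) h"
    unfolding h_def
    by (rule rmod_hom_comp[OF rmod_hom_comp[OF rmod_hom_transport[OF eM] g']
          rmod_hom_inv[OF right_module_sum_mod[OF N] rmod_hom_transport[OF eN]
              bij_betw_transport[OF eN]]])
  from family_sum_full[OF M N this] obtain \<phi> where \<phi>: "rep_mod_hom C R M N \<phi>" "\<phi> \<in> extensional
      (obj C)"
    "\<forall>i\<in>obj C. \<phi> i \<in> extensional (obj (rcat R i))" and h: "\<And>m. m \<in> carrier (sum_mod M) \<Longrightarrow> family_sum
        \<phi> m = h m"
    by blast
  have f: "Arrow M N \<phi> \<in> homset (Mod_rep C R) M N"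
    using M N \<phi> by (simp add: homset_Mod_rep)
  have "farr sum_fctr (Arrow M N \<phi>) = g"
  proof (rule Mod_ring_eqI[OF farr_sum_fctr(1)[OF f] g])
    fix u assume u: "u \<in> carrier (fobj sum_fctr M)"
    then obtain m where m: "m \<in> carrier (sum_mod M)" "u = e m"
      by (auto simp: carrier_fobj[OF M])
    have "amap g u \<in> e ` carrier (sum_mod N)"
      using Mod_ring_amap_closed[OF g u] by (simp add: carrier_fobj[OF N])
    then have "e (h m) = amap g u"
      unfolding h_def m(2) by (rule f_inv_into_f)
    then show "amap (farr sum_fctr (Arrow M N \<phi>)) u = amap g u"
      using farr_sum_fctr(2)[OF f m(1)] h[OF m(1)] m(2) by simp
  qed
  then show "\<exists>f\<in>homset (Mod_rep C R) M N. farr sum_fctr f = g"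
    using f by blast
next
  fix M N and f g :: "('i, 'c, 'x, 'f, 'u) rep_mod_arrow" assume f: "f \<in> homset (Mod_rep C R) M N"
      and g: "g \<in> homset (Mod_rep C R) M N"
    and eq: "farr sum_fctr f = farr sum_fctr g"
  have M: "right_rep_module C R M" and N: "right_rep_module C R N"
    and \<phi>: "rep_mod_hom C R M N (amap f)" and \<psi>: "rep_mod_hom C R M N (amap g)"
    using f g unfolding homset_Mod_rep by blast+
  \<comment> \<open>Injectivity of \<open>e\<close> on the direct sum of \<open>N\<close> removes
    the transport from the equation between the images of \<open>f\<close> and
    \<open>g\<close>.\<close>
  have "family_sum (amap f) m = family_sum (amap g) m" if m: "m \<in> carrier (sum_mod M)" for m
    using inj_onD[OF inj_on_sum_mod[OF N] _ family_sum_closed[OF f m] family_sum_closed[OF g m]]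
      farr_sum_fctr(2)[OF f m] farr_sum_fctr(2)[OF g m] eq by simp
  note faithful = family_sum_faithful[OF M N \<phi> \<psi> this]
  show "f = g"
  proof (rule Mod_rep_eqI[OF f g])
    fix i x assume i: "i \<in> obj C" and x: "x \<in> obj (rcat R i)"
    show "amap f i x = amap g i x"
      by (rule Ab_eqI[OF Mod_rep_component[OF f i x] Mod_rep_component[OF g i x]
          faithful[OF _ i x]])
  qed
next
  fix M :: "('c \<times> 'x \<times> 'x \<Rightarrow> 'f, 'u) rmod" assume "M \<in> obj (Mod_ring G.alg)"
  then have M: "right_module G.alg M" by (simp add: Mod_ring_def)
  obtain N :: "('i, 'c, 'x, 'f, 'u) rep_mod" and h where N: "right_rep_module C R N" and h:
      "rmod_hom G.alg M (sum_mod N) h"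
    and bij: "bij_betw h (carrier M) (carrier (sum_mod N))"
    using ex_rep_mod_decomposition[OF M] by blast
  note eN = inj_on_sum_mod[OF N] and F = right_module_fobj[OF N]
  define k where "k = (\<lambda>m. e (h m))"
  have k: "rmod_hom G.alg M (fobj sum_fctr N) k"
    unfolding k_def sum_fctr_def by (simp add: rmod_hom_comp[OF h rmod_hom_transport[OF eN]])
  have bij_k: "bij_betw k (carrier M) (carrier (fobj sum_fctr N))"
    using bij_betw_trans[OF bij bij_betw_transport[OF eN]] by
        (simp add: k_def sum_fctr_def comp_def)
  \<comment> \<open>The decomposition leads out of \<open>M\<close>, while essential surjectivity
    asks for an isomorphism from the image of \<open>N\<close> to \<open>M\<close>, hence the
    inverse.\<close>
  define r where "r = inv_into (carrier M) k"
  have r: "rmod_hom G.alg (fobj sum_fctr N) M r" "bij_betw r (carrier (fobj sum_fctr N))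
      (carrier M)"
    unfolding r_def by (rule rmod_hom_inv[OF M k bij_k]) (rule bij_betw_inv_into[OF bij_k])
  show "\<exists>N\<in>obj (Mod_rep C R). \<exists>f\<in>homset (Mod_ring G.alg) (fobj sum_fctr N) M. is_iso
      (Mod_ring G.alg) f"
    using N is_iso_Mod_ring[OF F M r] Mod_ring_arrow[OF F M r(1)]
    by (intro bexI[of _ N] bexI[of _ "Arrow (fobj sum_fctr N) M
        (restrict r (carrier (fobj sum_fctr N)))"])
      (simp_all add: Mod_rep_def)
qed

end

end

theorem theoremC:
  fixes C :: "('i, 'c) cat" and R :: "('i, 'c, 'x, 'f) rep"
  assumes "representation C R"
    and "finite (obj C)"
    and "\<And>i. i \<in> obj C \<Longrightarrow> finite (obj (rcat R i))"
    and "infinite (UNIV :: 'u set)"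
  shows "equivalent_categories
    (Mod_rep C R :: (('i, 'c, 'x, 'f, 'u) rep_mod, ('i, 'c, 'x, 'f, 'u) rep_mod_arrow) cat)
    (Mod_ring (skew_algebra C R)
      :: (('c \<times> 'x \<times> 'x \<Rightarrow> 'f, 'u) rmod, ('c \<times> 'x \<times> 'x \<Rightarrow> 'f, 'u) rmod_arrow) cat)"
proof -
  interpret finite_representation C R
    by (intro finite_representation.intro finite_representation_axioms.intro assms(1-3))
  obtain e :: "('i \<times> 'x \<Rightarrow> 'u) \<Rightarrow> 'u" where "inj_on e (extensional skew_ob)"
    using ex_inj_on_extensional[OF assms(4) G.finite_Ob] by blast
  then show ?thesis
    unfolding skew_algebra_alg by (rule equivalent_Mod_rep_Mod_alg)
qed

end
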